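(* Let $\dim V=3$ and let $a,b\ge 0$ be integers. Set $\mu=(a+b+1,a)$ and $\nu=(a+b+1,a+1)$. Let $T_{a,b}\in V^*\otimes S_\mu V^*\otimes S_\nu V$ be the nonzero $GL(V)$-invariant tensor, which is unique up to scale. Then $\underline{R}(T_{a,b})$ satisfies the following lower bounds: - for $a=0$ and $b=0,1,2,3,4$: $\underline{R}\ge 5,10,17,26,37$ respectively; - for $a=1$ and $b=0,1,2,3$: $\underline{R}\ge 10,19,31,46$; - for $a=2$ and $b=0,1,2$: $\underline{R}\ge 17,31,49$; - for $a=3$ and $b=0,1$: $\underline{R}\ge 26,46$; - for $a=4$ and $b=0$: $\underline{R}\ge 37$.
   Context: $S_\lambda V$ denotes the irreducible polynomial $GL(V)$-module indexed by the partition $\lambda$. Here $\dim S_\mu V=\frac{(a+b+3)(a+1)(b+2)}{2}$ and $\dim S_\nu V=\frac{(a+b+3)(a+2)(b+1)}{2}$. The border rank $\underline{R}(T)$ is the smallest $r$ such that $T$ is a limit of sums of $r$ rank-one tensors. *)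

theory Defs
  imports "Jordan_Normal_Form.Determinant" "HOL-Library.FuncSet"
begin

definition GL3 :: "complex mat set" where
  "GL3 = {g \<in> carrier_mat 3 3. det g \<noteq> 0}"

definition poly_fun3 :: "(complex mat \<Rightarrow> complex) \<Rightarrow> bool" where
  "poly_fun3 f \<longleftrightarrow> (\<exists>(D::nat) (c::(nat \<times> nat \<Rightarrow> nat) \<Rightarrow> complex).
     \<forall>g\<in>GL3. f g = (\<Sum>e \<in> ({..<3} \<times> {..<3}) \<rightarrow>\<^sub>E {..D}.
                       c e * (\<Prod>p \<in> {..<3} \<times> {..<3}. (g $$ p) ^ (e p))))"

definition poly_rep :: "nat \<Rightarrow> (complex mat \<Rightarrow> complex mat) \<Rightarrow> bool" where
  "poly_rep n \<rho> \<longleftrightarrow>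
     (\<forall>g\<in>GL3. \<rho> g \<in> carrier_mat n n) \<and>
     \<rho> (1\<^sub>m 3) = 1\<^sub>m n \<and>
     (\<forall>g\<in>GL3. \<forall>h\<in>GL3. \<rho> (g * h) = \<rho> g * \<rho> h) \<and>
     (\<forall>i<n. \<forall>j<n. poly_fun3 (\<lambda>g. \<rho> g $$ (i, j)))"

definition mat_trace :: "complex mat \<Rightarrow> complex" where
  "mat_trace A = (\<Sum>i<dim_row A. A $$ (i, i))"

definition diag3 :: "complex list \<Rightarrow> complex mat" where
  "diag3 t = mat 3 3 (\<lambda>(i, j). if i = j then t ! i else 0)"

definition alternant :: "nat list \<Rightarrow> complex list \<Rightarrow> complex" where
  "alternant lam t = det (mat 3 3 (\<lambda>(i, j). (t ! i) ^ (lam ! j + 2 - j)))"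

(* rho is (isomorphic to) S_lam V, dim V = 3: a polynomial representation whose character is
   the Schur polynomial s_lam = a_{lam+delta} / a_delta (bialternant formula) *)
definition schur_rep :: "nat list \<Rightarrow> nat \<Rightarrow> (complex mat \<Rightarrow> complex mat) \<Rightarrow> bool" where
  "schur_rep lam n \<rho> \<longleftrightarrow> poly_rep n \<rho> \<and>
     (\<forall>t. length t = 3 \<and> distinct t \<and> (\<forall>i<3. t ! i \<noteq> 0) \<longrightarrow>
        mat_trace (\<rho> (diag3 t)) * alternant [0, 0, 0] t = alternant lam t)"

(* T in V^* (x) W1^* (x) W2 (coordinates T i j k, i<3, j<n1, k<n2) is GL(V)-invariant,
   i.e. the induced map V (x) W1 -> W2 is GL(V)-equivariant *)
definition gl_invariant :: "nat \<Rightarrow> nat \<Rightarrow> (complex mat \<Rightarrow> complex mat) \<Rightarrow> (complex mat \<Rightarrow> complex mat)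
     \<Rightarrow> (nat \<Rightarrow> nat \<Rightarrow> nat \<Rightarrow> complex) \<Rightarrow> bool" where
  "gl_invariant n1 n2 \<rho>1 \<rho>2 T \<longleftrightarrow>
     (\<forall>g\<in>GL3. \<forall>i<3. \<forall>j<n1. \<forall>k<n2.
        (\<Sum>k'<n2. \<rho>2 g $$ (k, k') * T i j k') =
        (\<Sum>i'<3. \<Sum>j'<n1. g $$ (i', i) * \<rho>1 g $$ (j', j) * T i' j' k))"

definition rank_le :: "nat \<Rightarrow> nat \<Rightarrow> nat \<Rightarrow> nat \<Rightarrow> (nat \<Rightarrow> nat \<Rightarrow> nat \<Rightarrow> complex) \<Rightarrow> bool" where
  "rank_le n1 n2 n3 r S \<longleftrightarrow> (\<exists>u v w :: nat \<Rightarrow> nat \<Rightarrow> complex.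
     \<forall>i<n1. \<forall>j<n2. \<forall>k<n3. S i j k = (\<Sum>l<r. u l i * v l j * w l k))"

definition border_rank_le :: "nat \<Rightarrow> nat \<Rightarrow> nat \<Rightarrow> nat \<Rightarrow> (nat \<Rightarrow> nat \<Rightarrow> nat \<Rightarrow> complex) \<Rightarrow> bool" where
  "border_rank_le n1 n2 n3 r T \<longleftrightarrow> (\<forall>\<epsilon>>0. \<exists>S. rank_le n1 n2 n3 r S \<and>
     (\<forall>i<n1. \<forall>j<n2. \<forall>k<n3. cmod (S i j k - T i j k) < \<epsilon>))"

definition border_rank :: "nat \<Rightarrow> nat \<Rightarrow> nat \<Rightarrow> (nat \<Rightarrow> nat \<Rightarrow> nat \<Rightarrow> complex) \<Rightarrow> nat" where
  "border_rank n1 n2 n3 T = (LEAST r. border_rank_le n1 n2 n3 r T)"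

end

theory Submission
  imports Defs "HOL-Computational_Algebra.Fundamental_Theorem_Algebra"
begin

text \<open>
  Let \<open>v1\<close> and \<open>\<xi>2\<close> be a highest weight vector of the first representation and a highest weight
  covector of the second. Write \<open>x\<close> for the first row of \<open>g\<close> and \<open>y\<close> for the cross product of its first
  two rows, \<open>u\<close> and \<open>z\<close> for the same data of the columns of \<open>h\<close>; then \<open>x\<cdot>y = 0 = u\<cdot>z\<close>. Equivariance
  forces \<open>\<xi>2 g T(e_i, h v1) = c (x\<cdot>u)^b (y\<cdot>z)^a (y \<times> u)_i\<close> with \<open>c \<noteq> 0\<close>.

  Flatten \<open>T = \<Sum>i. e_i \<otimes> T_i\<close> to \<open>\<Sum>i. T_i \<otimes> D_i\<close>, where \<open>D_i = (p \<times> \<partial>/\<partial>q)_i\<close>, up to sign, acts on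
  forms of bidegree \<open>(b, a+1)\<close> in \<open>(p, q)\<close> restricted to the cone \<open>p\<cdot>q = 0\<close>. For a rank one tensor the
  flattening has rank at most \<open>\<rho> = (a+1)(b+1)(a+b+4)/2\<close>, the rank of a single derivation
  \<open>\<Sum>i. c_i D_i\<close>. For the invariant tensor it is, up to a scalar, the operator
  \<open>(p\<cdot>\<partial>x)(y\<cdot>\<partial>q) - (p\<cdot>y)(\<partial>x\<cdot>\<partial>q)\<close> on functions on the product of the cones \<open>x\<cdot>y = 0\<close> and
  \<open>p\<cdot>q = 0\<close>, and an \<open>sl2\<close> argument shows that this operator is onto. Comparing the rank
  \<open>dim S_\<mu> \<cdot> dim S_\<nu>\<close> with \<open>r \<cdot> \<rho>\<close>, and using that rank is lower semicontinuous, gives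
  \<open>r \<ge> dim S_\<mu> \<cdot> dim S_\<nu> / \<rho>\<close>; rounded up, these are the stated numbers.
\<close>

section \<open>Multihomogeneous polynomial functions of four vectors\<close>

text \<open>The degrees make the flattening square. It sends S_\<mu> tensor the forms of bidegree
  (b, a+1) in (p, q) to the forms of bidegree (b, a+1) in (x, y) tensor those of bidegree (b+1, a)
  in (p, q); both sides have dimension dim S_\<mu> \<cdot> dim S_\<nu>, so being onto means full
  rank.

  The obstacle is that the two representations are known only through their characters. The
  functions of bidegree (m, k) on the cone x\<cdot>y = 0 serve as a concrete model of S_(m+k,k).
  Three facts tie it to an abstract representation: the products (x\<cdot>u)^m (y\<cdot>z)^k with
  u\<cdot>z = 0 span it, the standard monomials are independent in it, and their number is the
  dimension read off from the character. Irreducibility thus takes the form that the orbits of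
  \<open>v1\<close> and \<open>\<xi>2\<close> span, and this is what gives c \<noteq> 0 for a
  nonzero tensor.

  Quotients by the equations of the cones are replaced by evaluation at points of the cones. Rank
  becomes linear independence of functions on sample points, and semicontinuity has to be checked on
  finitely many points only.\<close>

datatype blk = X | P | Y | Q

type_synonym pt = "blk \<Rightarrow> nat \<Rightarrow> complex"

text \<open>A point assigns to each block a vector; only its components 0, 1, 2 matter.\<close>

definition upd :: "pt \<Rightarrow> blk \<Rightarrow> nat \<Rightarrow> complex \<Rightarrow> pt" where
  "upd a s i t = a(s := (a s)(i := t))"

text \<open>Derivations act on functions of points, so the same objects can be differentiated and
  evaluated on a cone. \<open>polyfun\<close> guarantees that the derivative exists.\<close>

definition pd :: "blk \<Rightarrow> nat \<Rightarrow> (pt \<Rightarrow> complex) \<Rightarrow> pt \<Rightarrow> complex" where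
  "pd s i f a = (THE D. ((\<lambda>t. f (upd a s i t)) has_field_derivative D) (at (a s i)))"

text \<open>The generating rules match the rules of differentiation, so closure under
  \<open>pd\<close> and commutation of partial derivatives are inductions.\<close>

inductive polyfun :: "(pt \<Rightarrow> complex) \<Rightarrow> bool" where
  polyfun_const: "polyfun (\<lambda>a. c)"
| polyfun_var: "polyfun (\<lambda>a. a s i)"
| polyfun_add: "polyfun f \<Longrightarrow> polyfun g \<Longrightarrow> polyfun (\<lambda>a. f a + g a)"
| polyfun_mult: "polyfun f \<Longrightarrow> polyfun g \<Longrightarrow> polyfun (\<lambda>a. f a * g a)"

declare polyfun.intros [simp, intro]

lemma upd_same [simp]: "upd a s i (a s i) = a"
  by (simp add: upd_def)

lemma pd_eqI: "((\<lambda>t. f (upd a s i t)) has_field_derivative D) (at (a s i)) \<Longrightarrow> pd s i f a = D"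
  unfolding pd_def by (blast intro: DERIV_unique)

lemma upd_apply: "upd a s i t s' j = (if s' = s \<and> j = i then t else a s' j)"
  by (simp add: upd_def)

lemma polyfun_differentiable:
  "polyfun f \<Longrightarrow> \<exists>D. ((\<lambda>t. f (upd a s i t)) has_field_derivative D) (at (a s i))"
proof (induction rule: polyfun.induct)
  case (polyfun_const c) show ?case by (rule exI, rule DERIV_const)
next
  case (polyfun_var s' j)
  show ?case
  proof (cases "s' = s \<and> j = i")
    case True then show ?thesis by (intro exI[of _ 1]) (simp add: upd_apply)
  next
    case False
    then have "(\<lambda>t. upd a s i t s' j) = (\<lambda>t. a s' j)" by (auto simp: upd_apply)
    then show ?thesis by (intro exI[of _ 0]) simp
  qed
next
  case (polyfun_add f g) then show ?case using DERIV_add by fast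
next
  case (polyfun_mult f g) then show ?case using DERIV_mult by fast
qed

lemma polyfun_has_pd:
  "polyfun f \<Longrightarrow> ((\<lambda>t. f (upd a s i t)) has_field_derivative pd s i f a) (at (a s i))"
  using polyfun_differentiable[of f a s i] pd_eqI by metis

lemma pd_const [simp]: "pd s i (\<lambda>a. c) = (\<lambda>a. 0)"
  by (rule ext, rule pd_eqI) (rule DERIV_const)

lemma pd_var [simp]: "pd s i (\<lambda>a. a s' j) = (\<lambda>a. if s' = s \<and> j = i then 1 else 0)"
  by (rule ext, rule pd_eqI) (auto simp: upd_apply intro: DERIV_ident DERIV_const)

lemma pd_add [simp]:
  "polyfun f \<Longrightarrow> polyfun g \<Longrightarrow> pd s i (\<lambda>a. f a + g a) = (\<lambda>a. pd s i f a + pd s i g a)"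
  by (rule ext, rule pd_eqI) (intro DERIV_add polyfun_has_pd)

lemma pd_mult [simp]:
  assumes "polyfun f" "polyfun g"
  shows "pd s i (\<lambda>a. f a * g a) = (\<lambda>a. pd s i f a * g a + f a * pd s i g a)"
proof
  fix a
  show "pd s i (\<lambda>a. f a * g a) a = pd s i f a * g a + f a * pd s i g a"
    using DERIV_mult[OF polyfun_has_pd[OF assms(1), of a s i] polyfun_has_pd[OF assms(2), of a s i]]
    by (intro pd_eqI) (simp add: algebra_simps)
qed

lemma polyfun_uminus [simp, intro]: "polyfun f \<Longrightarrow> polyfun (\<lambda>a. - f a)"
  using polyfun_mult[OF polyfun_const[of "-1"], of f] by simp

lemma polyfun_diff [simp, intro]: "polyfun f \<Longrightarrow> polyfun g \<Longrightarrow> polyfun (\<lambda>a. f a - g a)"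
  using polyfun_add[OF _ polyfun_uminus, of f g] by simp

lemma polyfun_power [simp, intro]: "polyfun f \<Longrightarrow> polyfun (\<lambda>a. f a ^ n)"
  by (induction n) auto

lemma pd_uminus [simp]: "polyfun f \<Longrightarrow> pd s i (\<lambda>a. - f a) = (\<lambda>a. - pd s i f a)"
  using pd_mult[OF polyfun_const[of "-1"], of f] by simp

lemma pd_diff [simp]:
  "polyfun f \<Longrightarrow> polyfun g \<Longrightarrow> pd s i (\<lambda>a. f a - g a) = (\<lambda>a. pd s i f a - pd s i g a)"
  using pd_add[OF _ polyfun_uminus, of f g] by simp

lemma pd_power [simp]:
  "polyfun f \<Longrightarrow> pd s i (\<lambda>a. f a ^ Suc n) = (\<lambda>a. of_nat (Suc n) * f a ^ n * pd s i f a)"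
  by (induction n) (auto simp: fun_eq_iff algebra_simps)

lemma polyfun_pd [simp, intro]: "polyfun f \<Longrightarrow> polyfun (pd s i f)"
  by (induction rule: polyfun.induct) auto

lemma pd_commute: "polyfun f \<Longrightarrow> pd s i (pd t j f) = pd t j (pd s i f)"
  by (induction rule: polyfun.induct) (auto simp: fun_eq_iff algebra_simps)

section \<open>Multihomogeneous functions and Euler's identity\<close>

inductive multihom :: "(blk \<Rightarrow> nat) \<Rightarrow> (pt \<Rightarrow> complex) \<Rightarrow> bool" where
  multihom_one: "multihom (\<lambda>_. 0) (\<lambda>a. 1)"
| multihom_add: "multihom d f \<Longrightarrow> multihom d g \<Longrightarrow> multihom d (\<lambda>a. f a + g a)"
| multihom_cmult: "multihom d f \<Longrightarrow> multihom d (\<lambda>a. c * f a)"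
| multihom_var_mult: "multihom d f \<Longrightarrow> i < 3 \<Longrightarrow> multihom (d(s := Suc (d s))) (\<lambda>a. a s i * f a)"
| multihom_zero: "multihom d (\<lambda>a. 0)"

lemma multihom_polyfun: "multihom d f \<Longrightarrow> polyfun f"
  by (induction rule: multihom.induct) auto

lemma multihom_diff: "multihom d f \<Longrightarrow> multihom d g \<Longrightarrow> multihom d (\<lambda>a. f a - g a)"
  using multihom_add[OF _ multihom_cmult[of d g "-1"], of f] by simp

lemma multihom_cong: "multihom d f \<Longrightarrow> d = d' \<Longrightarrow> (\<And>a. f a = g a) \<Longrightarrow> multihom d' g"
  by (metis ext)

lemma multihom_var: "i < 3 \<Longrightarrow> multihom ((\<lambda>_. 0)(s := 1)) (\<lambda>a. a s i)"
  using multihom_var_mult[OF multihom_one, of i s] by simp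

lemma multihom_mult: "multihom d f \<Longrightarrow> multihom e g \<Longrightarrow> multihom (\<lambda>s. d s + e s) (\<lambda>a. f a * g a)"
proof (induction rule: multihom.induct)
  case multihom_one then show ?case by simp
next
  case (multihom_add d f g') then show ?case using multihom.multihom_add by (fastforce simp: algebra_simps)
next
  case (multihom_cmult d f c) then show ?case using multihom.multihom_cmult[of _ _ c] by (fastforce simp: algebra_simps)
next
  case (multihom_var_mult d f i s)
  then have "multihom ((\<lambda>s. d s + e s)(s := Suc (d s + e s))) (\<lambda>a. a s i * (f a * g a))"
    by (intro multihom.multihom_var_mult) auto
  then show ?case by (rule multihom_cong) (auto simp: fun_eq_iff)
next
  case (multihom_zero d) then show ?case by (simp add: multihom.multihom_zero)
qed

lemma multihom_power: "multihom d f \<Longrightarrow> multihom (\<lambda>s. n * d s) (\<lambda>a. f a ^ n)"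
proof (induction n)
  case 0 then show ?case by (simp add: multihom_one)
next
  case (Suc n)
  then have "multihom (\<lambda>s. d s + n * d s) (\<lambda>a. f a * f a ^ n)" by (intro multihom_mult) auto
  then show ?case by simp
qed

lemma multihom_pd_zero: "multihom d f \<Longrightarrow> d s = 0 \<Longrightarrow> pd s i f = (\<lambda>a. 0)"
  by (induction rule: multihom.induct) (auto simp: multihom_polyfun fun_eq_iff split: if_splits)

text \<open>The truncated degree \<open>d s - 1\<close> is correct even for \<open>d s = 0\<close>:
  the derivative is then 0, which has every multidegree.\<close>

lemma multihom_pd: "multihom d f \<Longrightarrow> multihom (d(s := d s - 1)) (pd s i f)"
proof (induction rule: multihom.induct)
  case multihom_one then show ?case by (simp add: multihom_zero)
next
  case (multihom_add d f g) then show ?case by (simp add: multihom_polyfun multihom.multihom_add)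
next
  case (multihom_cmult d f c) then show ?case by (simp add: multihom_polyfun multihom.multihom_cmult)
next
  case (multihom_zero d) then show ?case by (simp add: multihom.multihom_zero)
next
  case (multihom_var_mult d f j t)
  have polyfun: "polyfun f" using multihom_var_mult by (blast intro: multihom_polyfun)
  have eq: "pd s i (\<lambda>a. a t j * f a) = (\<lambda>a. (if t = s \<and> j = i then 1 else 0) * f a + a t j * pd s i f a)"
    using polyfun by (simp add: fun_eq_iff)
  show ?case
  proof (cases "t = s")
    case True
    have 1: "multihom d (\<lambda>a. (if t = s \<and> j = i then 1 else 0) * f a)"
      by (rule multihom.multihom_cmult) (rule multihom_var_mult)
    have 2: "multihom d (\<lambda>a. a t j * pd s i f a)"
    \<comment> \<open>For \<open>d s = 0\<close> the degree \<open>Suc (d s - 1)\<close> would be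
      off by one; the term itself vanishes.\<close>
    proof (cases "d s = 0")
      case True
      then show ?thesis using multihom_pd_zero[OF multihom_var_mult(1) True] by (simp add: multihom.multihom_zero)
    next
      case False
      have "multihom ((d(s := d s - 1))(t := Suc ((d(s := d s - 1)) t))) (\<lambda>a. a t j * pd s i f a)"
        by (rule multihom.multihom_var_mult) (fact multihom_var_mult)+
      then show ?thesis by (rule multihom_cong) (use True False in \<open>auto simp: fun_eq_iff\<close>)
    qed
    show ?thesis unfolding eq by (rule multihom_cong[OF multihom.multihom_add[OF 1 2]]) (use True in auto)
  next
    case False
    have "multihom ((d(s := d s - 1))(t := Suc ((d(s := d s - 1)) t))) (\<lambda>a. a t j * pd s i f a)"
      by (rule multihom.multihom_var_mult) (fact multihom_var_mult)+
    then show ?thesis unfolding eq by (rule multihom_cong) (use False in \<open>auto simp: fun_eq_iff\<close>)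
  qed
qed

text \<open>Euler's identity, the source of the numerical coefficients in this section and the next:
  the \<open>sl2\<close> weights and the constant in \<open>M_mult_XQ\<close>.\<close>

lemma multihom_euler:
  "multihom d f \<Longrightarrow> a s 0 * pd s 0 f a + a s 1 * pd s 1 f a + a s 2 * pd s 2 f a = of_nat (d s) * f a"
proof (induction rule: multihom.induct)
  case (multihom_var_mult d f i t)
  have polyfun: "polyfun f" using multihom_var_mult by (blast intro: multihom_polyfun)
  have "i = 0 \<or> i = 1 \<or> i = 2" using multihom_var_mult by auto
  then have "a s 0 * pd s 0 (\<lambda>a. a t i * f a) a + a s 1 * pd s 1 (\<lambda>a. a t i * f a) a
      + a s 2 * pd s 2 (\<lambda>a. a t i * f a) a
      = (if t = s then a t i * f a else 0)
        + a t i * (a s 0 * pd s 0 f a + a s 1 * pd s 1 f a + a s 2 * pd s 2 f a)"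
    using polyfun by (auto simp: algebra_simps)
  also have "\<dots> = of_nat ((d(t := Suc (d t))) s) * (a t i * f a)"
    unfolding multihom_var_mult.IH by (simp add: algebra_simps)
  finally show ?case .
next
  case (multihom_add d f g)
  have "polyfun f" "polyfun g" using multihom_add by (blast intro: multihom_polyfun)+
  then have "a s 0 * pd s 0 (\<lambda>a. f a + g a) a + a s 1 * pd s 1 (\<lambda>a. f a + g a) a
      + a s 2 * pd s 2 (\<lambda>a. f a + g a) a
      = (a s 0 * pd s 0 f a + a s 1 * pd s 1 f a + a s 2 * pd s 2 f a)
        + (a s 0 * pd s 0 g a + a s 1 * pd s 1 g a + a s 2 * pd s 2 g a)"
    by (simp add: algebra_simps)
  also have "\<dots> = of_nat (d s) * (f a + g a)"
    unfolding multihom_add.IH by (simp add: algebra_simps)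
  finally show ?case .
next
  case (multihom_cmult d f c)
  have "polyfun f" using multihom_cmult by (blast intro: multihom_polyfun)
  then have "a s 0 * pd s 0 (\<lambda>a. c * f a) a + a s 1 * pd s 1 (\<lambda>a. c * f a) a
      + a s 2 * pd s 2 (\<lambda>a. c * f a) a
      = c * (a s 0 * pd s 0 f a + a s 1 * pd s 1 f a + a s 2 * pd s 2 f a)"
    by (simp add: algebra_simps)
  also have "\<dots> = of_nat (d s) * (c * f a)"
    unfolding multihom_cmult.IH by (simp add: algebra_simps)
  finally show ?case .
qed auto

section \<open>Surjectivity of the flattening operator\<close>

definition dot :: "blk \<Rightarrow> blk \<Rightarrow> pt \<Rightarrow> complex" where
  "dot s t a = a s 0 * a t 0 + a s 1 * a t 1 + a s 2 * a t 2"

definition pol :: "blk \<Rightarrow> blk \<Rightarrow> (pt \<Rightarrow> complex) \<Rightarrow> pt \<Rightarrow> complex" where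
  "pol s t f a = a t 0 * pd s 0 f a + a t 1 * pd s 1 f a + a t 2 * pd s 2 f a"

definition lap :: "blk \<Rightarrow> blk \<Rightarrow> (pt \<Rightarrow> complex) \<Rightarrow> pt \<Rightarrow> complex" where
  "lap s t f a = pd s 0 (pd t 0 f) a + pd s 1 (pd t 1 f) a + pd s 2 (pd t 2 f) a"

lemma polyfun_dot [simp, intro]: "polyfun (dot s t)"
  unfolding dot_def[abs_def] by auto

lemma pd_dot: "pd u i (dot s t) = (\<lambda>a. (if s = u \<and> i < 3 then a t i else 0) + (if t = u \<and> i < 3 then a s i else 0))"
proof -
  consider "i = 0" | "i = 1" | "i = 2" | "\<not> i < 3" by linarith
  then show ?thesis
    unfolding dot_def[abs_def] by cases (auto simp: fun_eq_iff)
qed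

lemma pol_zero [simp]: "pol s t (\<lambda>a. 0) = (\<lambda>a. 0)"
  by (simp add: pol_def fun_eq_iff)

lemma polyfun_pol [simp, intro]: "polyfun f \<Longrightarrow> polyfun (pol s t f)"
  unfolding pol_def[abs_def] by (intro polyfun_add polyfun_mult polyfun_var polyfun_pd)

lemma pol_add: "polyfun f \<Longrightarrow> polyfun g \<Longrightarrow> pol s t (\<lambda>a. f a + g a) = (\<lambda>a. pol s t f a + pol s t g a)"
  by (simp add: pol_def fun_eq_iff algebra_simps)

lemma pol_diff: "polyfun f \<Longrightarrow> polyfun g \<Longrightarrow> pol s t (\<lambda>a. f a - g a) = (\<lambda>a. pol s t f a - pol s t g a)"
  by (simp add: pol_def fun_eq_iff algebra_simps)

lemma pol_cmult: "polyfun f \<Longrightarrow> pol s t (\<lambda>a. c * f a) = (\<lambda>a. c * pol s t f a)"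
  by (simp add: pol_def fun_eq_iff algebra_simps)

lemma pol_mult: "polyfun f \<Longrightarrow> polyfun g \<Longrightarrow> pol s t (\<lambda>a. f a * g a) = (\<lambda>a. pol s t f a * g a + f a * pol s t g a)"
  by (simp add: pol_def fun_eq_iff algebra_simps)

lemma pol_dot:
  "pol u v (dot s t) = (\<lambda>a. (if s = u then dot v t a else 0) + (if t = u then dot v s a else 0))"
  by (auto simp: pol_def pd_dot dot_def fun_eq_iff algebra_simps)

lemma multihom_pol:
  assumes "multihom d f" "s \<noteq> t" "d s = Suc n"
  shows "multihom (d(s := n, t := Suc (d t))) (pol s t f)"
proof -
  have 1: "multihom (d(s := n, t := Suc (d t))) (\<lambda>a. a t i * pd s i f a)" if "i < 3" for i
    by (rule multihom_cong[OF multihom_var_mult[OF multihom_pd[OF assms(1), of s] that, of t]]) (use assms in auto)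
  show ?thesis unfolding pol_def[abs_def]
    by (intro multihom_add 1) auto
qed

lemma pol_eq_zero: "multihom d f \<Longrightarrow> d s = 0 \<Longrightarrow> pol s t f = (\<lambda>a. 0)"
  by (simp add: pol_def fun_eq_iff multihom_pd_zero)

text \<open>The second-order terms cancel; what remains is the difference of the Euler operators of
  the blocks \<open>s\<close> and \<open>t\<close>.\<close>

lemma pol_pol_commutator:
  assumes "multihom d f" "s \<noteq> t"
  shows "pol t s (pol s t f) a = pol s t (pol t s f) a + (of_nat (d s) - of_nat (d t)) * f a"
proof -
  have polyfun: "polyfun f" using assms multihom_polyfun by blast
  have "pol t s (pol s t f) a - pol s t (pol t s f) a
      = (a s 0 * pd s 0 f a + a s 1 * pd s 1 f a + a s 2 * pd s 2 f a)
        - (a t 0 * pd t 0 f a + a t 1 * pd t 1 f a + a t 2 * pd t 2 f a)"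
    unfolding pol_def[abs_def] using polyfun assms(2)
    by (simp add: algebra_simps pd_commute[OF polyfun, of s _ t])
  also have "\<dots> = (of_nat (d s) - of_nat (d t)) * f a"
    unfolding multihom_euler[OF assms(1)] by (simp add: algebra_simps)
  finally show ?thesis by (simp add: algebra_simps)
qed

lemma multihom_pol_funpow:
  assumes "multihom d f" "s \<noteq> t" "m \<le> d s"
  shows "multihom (d(s := d s - m, t := d t + m)) ((pol s t ^^ m) f)"
  using assms(3)
proof (induction m)
  case 0 then show ?case using assms by simp
next
  case (Suc m)
  let ?d = "d(s := d s - m, t := d t + m)"
  have "multihom (?d(s := d s - Suc m, t := Suc (?d t))) (pol s t ((pol s t ^^ m) f))"
    by (rule multihom_pol) (use Suc.prems assms in \<open>auto intro: Suc.IH\<close>)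
  then show ?case by (rule multihom_cong) (use assms in auto)
qed

lemma pol_funpow_cmult: "polyfun f \<Longrightarrow> (pol s t ^^ m) (\<lambda>a. c * f a) = (\<lambda>a. c * (pol s t ^^ m) f a)
    \<and> polyfun ((pol s t ^^ m) f)"
  by (induction m) (auto simp: pol_cmult)

lemma pol_funpow_add: "polyfun f \<Longrightarrow> polyfun g \<Longrightarrow>
  (pol s t ^^ m) (\<lambda>a. f a + g a) = (\<lambda>a. (pol s t ^^ m) f a + (pol s t ^^ m) g a)"
proof (induction m)
  case (Suc m)
  then show ?case using pol_funpow_cmult[of f m s t] pol_funpow_cmult[of g m s t]
    by (simp add: pol_add)
qed simp

text \<open>The operators \<open>pol s t\<close> and \<open>pol t s\<close> span a copy of \<open>sl2\<close>, whose weights are differences of degrees.\<close>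

lemma pol_lowest_weight:
  assumes "multihom d h" "s \<noteq> t" "pol s t h = (\<lambda>a. 0)" "d t = d s + m" "k < m"
  shows "pol s t ((pol t s ^^ Suc k) h) = (\<lambda>a. of_nat (Suc k * (m - k)) * (pol t s ^^ k) h a)"
  using assms(5)
proof (induction k)
  case 0
  show ?case
  proof
    fix a
    show "pol s t ((pol t s ^^ Suc 0) h) a = of_nat (Suc 0 * (m - 0)) * (pol t s ^^ 0) h a"
      using pol_pol_commutator[OF assms(1,2), of a] assms by (simp add: algebra_simps)
  qed
next
  case (Suc k)
  let ?g = "(pol t s ^^ Suc k) h"
  have g: "multihom (d(t := d t - Suc k, s := d s + Suc k)) ?g"
    by (rule multihom_pol_funpow[OF assms(1)]) (use assms Suc in auto)
  have pfk: "polyfun ((pol t s ^^ k) h)"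
    using pol_funpow_cmult[OF multihom_polyfun[OF assms(1)]] by blast
  show ?case
  proof
    fix a
    have "pol t s (pol s t ?g) a = of_nat (Suc k * (m - k)) * ?g a"
      using Suc pfk by (simp add: pol_cmult)
    moreover have "pol t s (pol s t ?g) a = pol s t (pol t s ?g) a
        + (of_nat (d s + Suc k) - of_nat (d t - Suc k)) * ?g a"
      using pol_pol_commutator[OF g assms(2), of a] assms(2) by simp
    moreover obtain r where r: "m = Suc (Suc (k + r))"
      using Suc.prems less_imp_Suc_add by blast
    ultimately show "pol s t ((pol t s ^^ Suc (Suc k)) h) a
        = of_nat (Suc (Suc k) * (m - Suc k)) * (pol t s ^^ Suc k) h a"
      using assms(4) by (simp add: algebra_simps Suc_diff_le)
  qed
qed

text \<open>Step \<open>j\<close> of the descent multiplies by \<open>(j + 1) * (m - j)\<close>, and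
  these factors are nonzero for \<open>j < k \<le> m\<close>.\<close>

lemma pol_funpow_lowest_weight:
  assumes "multihom d h" "s \<noteq> t" "pol s t h = (\<lambda>a. 0)" "d t = d s + m" "k \<le> m"
  shows "\<exists>c. c \<noteq> 0 \<and> (pol s t ^^ k) ((pol t s ^^ k) h) = (\<lambda>a. c * h a)"
  using assms(5)
proof (induction k)
  case 0 then show ?case by (intro exI[of _ 1]) simp
next
  case (Suc k)
  then obtain c where c: "c \<noteq> 0" "(pol s t ^^ k) ((pol t s ^^ k) h) = (\<lambda>a. c * h a)" by auto
  have pfk: "polyfun ((pol t s ^^ k) h)"
    using pol_funpow_cmult[OF multihom_polyfun[OF assms(1)]] by blast
  let ?e = "of_nat (Suc k * (m - k)) :: complex"
  have "(pol s t ^^ Suc k) ((pol t s ^^ Suc k) h) = (pol s t ^^ k) (pol s t ((pol t s ^^ Suc k) h))"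
    by (simp add: funpow_swap1)
  also have "\<dots> = (\<lambda>a. ?e * (c * h a))"
    using pol_lowest_weight[OF assms(1-4), of k] Suc pol_funpow_cmult[OF pfk, of k s t ?e] c
    by simp
  finally have "(pol s t ^^ Suc k) ((pol t s ^^ Suc k) h) = (\<lambda>a. (?e * c) * h a)"
    by (simp only: mult.assoc)
  moreover have "?e * c \<noteq> 0"
    using c(1) Suc.prems by (simp only: mult_eq_0_iff of_nat_eq_0_iff) simp
  ultimately show ?case by blast
qed

text \<open>In an \<open>sl2\<close>-module the m-th power of the raising operator maps weight -m
  onto weight m or conversely; here the weight is the difference of the degrees in \<open>s\<close>
  and \<open>t\<close>. Induction on the degree in \<open>s\<close> reduces to a vector killed by
  \<open>pol s t\<close>.\<close>

lemma pol_funpow_surj: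
  assumes "s \<noteq> t" "multihom d g" "d s = n" "d t = n + m"
  shows "\<exists>f. multihom (d(s := n + m, t := n)) f \<and> (pol s t ^^ m) f = g"
  using assms(2-)
proof (induction n arbitrary: m d g)
  case (0 m d g)
  have z: "pol s t g = (\<lambda>a. 0)" using pol_eq_zero[OF 0(1,2)] .
  obtain c where c: "c \<noteq> 0" "(pol s t ^^ m) ((pol t s ^^ m) g) = (\<lambda>a. c * g a)"
    using pol_funpow_lowest_weight[OF 0(1) assms(1) z, of m m] 0(2,3) by auto
  have h: "multihom (d(t := d t - m, s := d s + m)) ((pol t s ^^ m) g)"
    by (rule multihom_pol_funpow[OF 0(1)]) (use 0(2,3) assms(1) in auto)
  have "(pol s t ^^ m) (\<lambda>a. inverse c * (pol t s ^^ m) g a) = g"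
    using pol_funpow_cmult[OF multihom_polyfun[OF h], of m s t "inverse c"] c by (simp flip: mult.assoc)
  moreover have "multihom (d(s := 0 + m, t := 0)) (\<lambda>a. inverse c * (pol t s ^^ m) g a)"
    by (rule multihom_cong[OF multihom_cmult[OF h]]) (use 0(2,3) assms(1) in \<open>auto simp: fun_eq_iff\<close>)
  ultimately show ?case by blast
next
  case (Suc n m d g)
  have e: "(d(s := n, t := Suc (d t))) s = n" "(d(s := n, t := Suc (d t))) t = n + (m + 2)"
    using assms(1) Suc.prems by auto
  \<comment> \<open>Applying \<open>pol s t\<close> lowers the degree in \<open>s\<close> to
    \<open>n\<close> and widens the gap of the degrees to \<open>m + 2\<close>, so the induction
    hypothesis is used with exponent \<open>m + 2\<close>.\<close>
  have "multihom (d(s := n, t := Suc (d t))) (pol s t g)"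
    by (rule multihom_pol[OF Suc.prems(1)]) (use Suc.prems assms in auto)
  from Suc.IH[OF this e] obtain g1 where g1': "multihom (d(s := n, t := Suc (d t), s := n + (m + 2), t := n)) g1"
     "(pol s t ^^ (m + 2)) g1 = pol s t g" by blast
  have g1: "multihom (d(s := n + m + 2, t := n)) g1"
    by (rule multihom_cong[OF g1'(1)]) (use assms(1) in \<open>auto simp: fun_eq_iff\<close>)
  have pg1: "multihom (d(s := n + m + 1, t := Suc n)) (pol s t g1)"
    by (rule multihom_cong[OF multihom_pol[OF g1 assms(1), of "n + m + 1"]]) (use assms(1) in \<open>auto simp: fun_eq_iff\<close>)
  \<comment> \<open>The choice of \<open>g1\<close> makes \<open>h\<close> a vector killed by
    \<open>pol s t\<close>; it is recovered up to the factor \<open>c\<close> from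
    \<open>(pol t s ^^ m) h\<close>, and the rest of \<open>g\<close> is in the image by
    construction.\<close>
  define h where "h = (\<lambda>a. g a - (pol s t ^^ m) (pol s t g1) a)"
  have h1: "multihom d ((pol s t ^^ m) (pol s t g1))"
    by (rule multihom_cong[OF multihom_pol_funpow[OF pg1 assms(1), of m]])
      (use assms(1) Suc.prems in \<open>auto simp: fun_eq_iff\<close>)
  have h: "multihom d h" unfolding h_def by (rule multihom_diff[OF Suc.prems(1) h1])
  have "pol s t h = (\<lambda>a. pol s t g a - pol s t ((pol s t ^^ m) (pol s t g1)) a)"
    unfolding h_def using multihom_polyfun[OF Suc.prems(1)] multihom_polyfun[OF h1] by (rule pol_diff)
  also have "pol s t ((pol s t ^^ m) (pol s t g1)) = pol s t g"
    using g1'(2) by (simp add: funpow_swap1)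
  finally have z: "pol s t h = (\<lambda>a. 0)" by simp
  obtain c where c: "c \<noteq> 0" "(pol s t ^^ m) ((pol t s ^^ m) h) = (\<lambda>a. c * h a)"
    using pol_funpow_lowest_weight[OF h assms(1) z, of m m] Suc.prems by auto
  have hm: "multihom (d(t := d t - m, s := d s + m)) ((pol t s ^^ m) h)"
    by (rule multihom_pol_funpow[OF h]) (use Suc.prems assms in auto)
  let ?f2 = "\<lambda>a. inverse c * (pol t s ^^ m) h a"
  have hf2: "multihom (d(s := Suc n + m, t := Suc n)) ?f2"
    by (rule multihom_cong[OF multihom_cmult[OF hm]]) (use Suc assms(1) in \<open>auto simp: fun_eq_iff\<close>)
  have "multihom (d(s := Suc n + m, t := Suc n)) (\<lambda>a. pol s t g1 a + ?f2 a)"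
    by (rule multihom_add[OF _ hf2]) (use pg1 in simp)
  moreover have "(pol s t ^^ m) (\<lambda>a. pol s t g1 a + ?f2 a) = g"
  proof -
    have "(pol s t ^^ m) ?f2 = h"
      using pol_funpow_cmult[OF multihom_polyfun[OF hm], of m s t "inverse c"] c by (simp flip: mult.assoc)
    then show ?thesis
      using pol_funpow_add[OF multihom_polyfun[OF pg1] multihom_polyfun[OF hf2], of m s t] by (simp add: h_def)
  qed
  ultimately show ?case by blast
qed

section \<open>The operator \<open>M\<close> on the product of two cones\<close>

fun deg4 :: "nat \<Rightarrow> nat \<Rightarrow> nat \<Rightarrow> nat \<Rightarrow> blk \<Rightarrow> nat" where
  "deg4 x p y q X = x"
| "deg4 x p y q P = p"
| "deg4 x p y q Y = y"
| "deg4 x p y q Q = q"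

lemma deg4_upd [simp]:
  "(deg4 x p y q)(X := n) = deg4 n p y q"
  "(deg4 x p y q)(P := n) = deg4 x n y q"
  "(deg4 x p y q)(Y := n) = deg4 x p n q"
  "(deg4 x p y q)(Q := n) = deg4 x p y n"
  by (rule ext, case_tac xa; simp)+

lemma deg4_ext: "d X = x \<Longrightarrow> d P = p \<Longrightarrow> d Y = y \<Longrightarrow> d Q = q \<Longrightarrow> d = deg4 x p y q"
  by (rule ext, case_tac xa) auto

lemma deg4_zero: "(\<lambda>_. 0) = deg4 0 0 0 0"
proof
  fix s show "0 = deg4 0 0 0 0 s" by (cases s) auto
qed

definition cone2 :: "pt \<Rightarrow> bool" where
  "cone2 a \<longleftrightarrow> dot X Y a = 0 \<and> dot P Q a = 0"

text \<open>By the Lagrange identity this equals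
  \<open>- (y \<times> \<partial>x) \<cdot> (p \<times> \<partial>q)\<close>, which is how it meets
  the derivations of the flattening in \<open>M_product\<close>.\<close>

definition M :: "(pt \<Rightarrow> complex) \<Rightarrow> pt \<Rightarrow> complex" where
  "M f a = pol X P (pol Q Y f) a - dot P Y a * lap X Q f a"

lemma M_add: "polyfun f \<Longrightarrow> polyfun g \<Longrightarrow> M (\<lambda>a. f a + g a) a = M f a + M g a"
  by (simp add: M_def pol_add lap_def algebra_simps)

lemma M_cmult: "polyfun f \<Longrightarrow> M (\<lambda>a. c * f a) a = c * M f a"
  by (simp add: M_def pol_cmult lap_def algebra_simps)

lemma M_mult_PY: "polyfun f \<Longrightarrow> M (\<lambda>a. dot P Y a * f a) a = dot P Y a * M f a"
  by (simp add: M_def pol_mult pol_dot lap_def pd_dot algebra_simps)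

text \<open>On the cone \<open>pol Q Y\<close> and \<open>pol X P\<close> send x\<cdot>q to
  x\<cdot>y = 0 and p\<cdot>q = 0; only the mixed second derivative p\<cdot>y survives. It offsets
  one unit of the \<open>3 + d X + d Q\<close> produced by the Laplacian, which leaves
  \<open>2 + d X + d Q\<close>.\<close>

lemma M_mult_XQ:
  assumes "multihom d f" "cone2 a"
  shows "M (\<lambda>a. dot X Q a * f a) a
    = dot X Q a * M f a - of_nat (2 + d X + d Q) * dot P Y a * f a"
proof -
  have polyfun: "polyfun f" using assms multihom_polyfun by blast
  have 1: "pol X P (pol Q Y (\<lambda>a. dot X Q a * f a)) a
     = dot P Y a * f a + dot X Q a * pol X P (pol Q Y f) a"
    using assms(2) polyfun
    by (simp add: pol_mult pol_dot pol_add cone2_def) (simp add: dot_def algebra_simps)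
  have "lap X Q (\<lambda>a. dot X Q a * f a) a = 3 * f a
      + (a X 0 * pd X 0 f a + a X 1 * pd X 1 f a + a X 2 * pd X 2 f a)
      + (a Q 0 * pd Q 0 f a + a Q 1 * pd Q 1 f a + a Q 2 * pd Q 2 f a)
      + dot X Q a * lap X Q f a"
    using polyfun by (simp add: lap_def pd_dot algebra_simps)
  also have "\<dots> = of_nat (3 + d X + d Q) * f a + dot X Q a * lap X Q f a"
    unfolding multihom_euler[OF assms(1)] by (simp add: algebra_simps)
  finally show ?thesis unfolding M_def 1 by (simp add: algebra_simps)
qed

lemma multihom_dot: "multihom (\<lambda>u. (if u = s then 1 else 0) + (if u = t then 1 else 0)) (dot s t)"
proof -
  have 1: "multihom (\<lambda>u. (if u = s then 1 else 0) + (if u = t then 1 else 0)) (\<lambda>a. a s i * a t i)" if "i < 3" for i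
    by (rule multihom_cong[OF multihom_mult[OF multihom_var[OF that, of s] multihom_var[OF that, of t]]]) auto
  show ?thesis unfolding dot_def[abs_def] by (intro multihom_add 1) auto
qed

lemma multihom_XQ: "multihom (deg4 1 0 0 1) (dot X Q)"
proof (rule multihom_cong[OF multihom_dot[of X Q]])
  show "(\<lambda>u. (if u = X then 1 else 0) + (if u = Q then 1 else 0)) = deg4 1 0 0 1"
    by (rule ext, case_tac u) auto
qed simp

lemma multihom_PY: "multihom (deg4 0 1 1 0) (dot P Y)"
proof (rule multihom_cong[OF multihom_dot[of P Y]])
  show "(\<lambda>u. (if u = P then 1 else 0) + (if u = Y then 1 else 0)) = deg4 0 1 1 0"
    by (rule ext, case_tac u) auto
qed simp

lemma multihom_XQ_PY:
  assumes "multihom (deg4 dx dp dy dq) g"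
  shows "multihom (deg4 (i + dx) (j + dp) (j + dy) (i + dq)) (\<lambda>a. dot X Q a ^ i * dot P Y a ^ j * g a)"
  by (rule multihom_cong[OF multihom_mult[OF multihom_mult[OF multihom_power[OF multihom_XQ, of i] multihom_power[OF multihom_PY, of j]] assms]])
    (rule deg4_ext, simp_all)

text \<open>The constants \<open>2 + (dx + l) + (dq + l)\<close> for \<open>l < i\<close> add up to
  \<open>i * (i + 1 + dx + dq)\<close>. For \<open>i = 0\<close> this coefficient is 0, so the
  truncated exponent \<open>i - 1\<close> does no harm.\<close>

lemma M_XQ_PY:
  assumes g: "multihom (deg4 dx dp dy dq) g" and "cone2 a"
  shows "M (\<lambda>a. dot X Q a ^ i * dot P Y a ^ j * g a) a
    = dot X Q a ^ i * dot P Y a ^ j * pol X P (pol Q Y g) a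
      - of_nat (i * (i + 1 + dx + dq)) * dot X Q a ^ (i - 1) * dot P Y a ^ (j + 1) * g a
      - dot X Q a ^ i * dot P Y a ^ (j + 1) * lap X Q g a"
proof (induction i)
  case 0
  have polyfun: "polyfun g" using g multihom_polyfun by blast
  have "M (\<lambda>a. dot P Y a ^ j * g a) a = dot P Y a ^ j * M g a"
  proof (induction j)
    case (Suc j)
    have "M (\<lambda>a. dot P Y a * (dot P Y a ^ j * g a)) a = dot P Y a * M (\<lambda>a. dot P Y a ^ j * g a) a"
      using polyfun by (intro M_mult_PY) auto
    then show ?case using Suc by (simp add: algebra_simps)
  qed simp
  then show ?case by (simp add: M_def algebra_simps)
next
  case (Suc i)
  have h: "multihom (deg4 (i + dx) (j + dp) (j + dy) (i + dq)) (\<lambda>a. dot X Q a ^ i * dot P Y a ^ j * g a)"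
    by (rule multihom_XQ_PY[OF g])
  have "M (\<lambda>a. dot X Q a ^ Suc i * dot P Y a ^ j * g a) a
     = M (\<lambda>a. dot X Q a * (dot X Q a ^ i * dot P Y a ^ j * g a)) a"
    by (simp add: mult.assoc)
  also have "\<dots> = dot X Q a * M (\<lambda>a. dot X Q a ^ i * dot P Y a ^ j * g a) a
      - of_nat (2 + (i + dx) + (i + dq)) * dot P Y a * (dot X Q a ^ i * dot P Y a ^ j * g a)"
    using M_mult_XQ[OF h assms(2)] by simp
  also have "\<dots> = dot X Q a ^ Suc i * dot P Y a ^ j * pol X P (pol Q Y g) a
      - of_nat (Suc i * (Suc i + 1 + dx + dq)) * dot X Q a ^ (Suc i - 1) * dot P Y a ^ (j + 1) * g a
      - dot X Q a ^ Suc i * dot P Y a ^ (j + 1) * lap X Q g a"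
    unfolding Suc by (cases i) (simp_all add: algebra_simps)
  finally show ?case .
qed

lemma multihom_lap:
  assumes "multihom (deg4 (Suc dx) dp dy (Suc dq)) g"
  shows "multihom (deg4 dx dp dy dq) (lap X Q g)"
proof -
  have 1: "multihom (deg4 dx dp dy dq) (pd X i (pd Q i g))" for i
    by (rule multihom_cong[OF multihom_pd[OF multihom_pd[OF assms, of Q i], of X i]]) auto
  show ?thesis unfolding lap_def[abs_def] by (intro multihom_add 1)
qed

lemma lap_eq_zero:
  assumes "multihom (deg4 dx dp dy dq) g" "dx = 0 \<or> dq = 0"
  shows "lap X Q g = (\<lambda>a. 0)"
proof (cases "dq = 0")
  case True
  then have "pd Q i g = (\<lambda>a. 0)" for i using multihom_pd_zero[OF assms(1), of Q i] by simp
  then show ?thesis by (intro ext) (simp add: lap_def)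
next
  case False
  then have "pd X i (pd Q i g) = (\<lambda>a. 0)" for i
    using multihom_pd_zero[OF multihom_pd[OF assms(1), of Q i], of X i] assms(2) by simp
  then show ?thesis by (intro ext) (simp add: lap_def)
qed

section \<open>The image of \<open>M\<close> on the cones\<close>

definition imM :: "nat \<Rightarrow> nat \<Rightarrow> (pt \<Rightarrow> complex) \<Rightarrow> bool" where
  "imM b c H \<longleftrightarrow> (\<exists>f. multihom (deg4 (b + 1) b c (c + 1)) f \<and> (\<forall>a. cone2 a \<longrightarrow> M f a = H a))"

lemma imM_add: "imM b c H \<Longrightarrow> imM b c H' \<Longrightarrow> imM b c (\<lambda>a. H a + H' a)"
  unfolding imM_def by (elim exE conjE) (intro exI conjI, erule (1) multihom_add, simp add: M_add multihom_polyfun)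

lemma imM_cmult: "imM b c H \<Longrightarrow> imM b c (\<lambda>a. k * H a)"
  unfolding imM_def by (elim exE conjE) (intro exI conjI, erule multihom_cmult[where c = k], simp add: M_cmult multihom_polyfun)

lemma imM_cong: "imM b c H \<Longrightarrow> (\<And>a. cone2 a \<Longrightarrow> H a = H' a) \<Longrightarrow> imM b c H'"
  unfolding imM_def by metis

lemma imM_zero: "imM b c (\<lambda>a. 0)"
  unfolding imM_def by (rule exI[of _ "\<lambda>a. 0"]) (simp add: multihom_zero M_def lap_def)

abbreviation AD :: "(pt \<Rightarrow> complex) \<Rightarrow> pt \<Rightarrow> complex" where
  "AD g \<equiv> pol X P (pol Q Y g)"

lemma multihom_AD: "multihom (deg4 (Suc dx) dp dy (Suc dq)) g \<Longrightarrow> multihom (deg4 dx (Suc dp) (Suc dy) dq) (AD g)"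
  using multihom_pol[OF multihom_pol[of "deg4 (Suc dx) dp dy (Suc dq)" g Q Y dq], of X P dx] by simp

lemma AD_eq_zero:
  assumes g: "multihom (deg4 dx dp dy dq) g" and "dx = 0 \<or> dq = 0"
  shows "AD g = (\<lambda>a. 0)"
proof (cases dq)
  case 0
  then show ?thesis using pol_eq_zero[OF g, of Q Y] by simp
next
  case (Suc n)
  have "multihom (deg4 dx dp (Suc dy) n) (pol Q Y g)"
    using multihom_pol[OF g, of Q Y n] Suc by simp
  from pol_eq_zero[OF this, of X P] show ?thesis using assms Suc by simp
qed

lemma pol_commute:
  assumes "polyfun g" shows "pol X P (pol Q Y g) = pol Q Y (pol X P g)"
  unfolding pol_def[abs_def] using assms
  by (simp add: algebra_simps pd_commute[OF assms, of X _ Q])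

lemma AD_funpow: "polyfun g \<Longrightarrow> (AD ^^ m) g = (pol X P ^^ m) ((pol Q Y ^^ m) g)"
proof (induction m)
  case (Suc m)
  have pfm: "polyfun ((pol s t ^^ m) f)" if "polyfun f" for s t m f
    using pol_funpow_cmult[OF that] by blast
  have "pol Q Y ((pol X P ^^ m) f) = (pol X P ^^ m) (pol Q Y f)" if "polyfun f" for f
    by (induction m) (auto simp: pol_commute[symmetric] pfm that)
  then show ?case using Suc pfm by (simp add: pfm)
qed simp

lemma multihom_AD_funpow:
  "multihom (deg4 (m + dx) dp dy (m + dq)) g \<Longrightarrow> multihom (deg4 dx (m + dp) (m + dy) dq) ((AD ^^ m) g)"
proof (induction m arbitrary: dx dq)
  case (Suc m)
  then have "multihom (deg4 (Suc dx) (m + dp) (m + dy) (Suc dq)) ((AD ^^ m) g)" by simp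
  then show ?case by (simp add: multihom_AD)
qed simp

text \<open>The Laplacian term of \<open>M_XQ_PY\<close> has one more factor p\<cdot>y, so it
  belongs to level \<open>i + j + 1\<close> and is handled by \<open>lower\<close>. The other two
  terms lie on level \<open>i + j\<close>; modulo the image they become proportional.\<close>

lemma imM_relation:
  assumes g: "multihom (deg4 dx dp dy dq) g"
    and d: "dx + i = b + 1" "dp + j = b" "dy + j = c" "dq + i = c + 1"
    and lower: "\<And>g'. dx \<noteq> 0 \<Longrightarrow> dq \<noteq> 0 \<Longrightarrow> multihom (deg4 (dx - 1) dp dy (dq - 1)) g' \<Longrightarrow>
        imM b c (\<lambda>a. dot X Q a ^ i * dot P Y a ^ (j + 1) * g' a)"
  shows "imM b c (\<lambda>a. dot X Q a ^ i * dot P Y a ^ j * AD g a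
      - of_nat (i * (i + 1 + dx + dq)) * dot X Q a ^ (i - 1) * dot P Y a ^ (j + 1) * g a)"
proof -
  have "multihom (deg4 (b + 1) b c (c + 1)) (\<lambda>a. dot X Q a ^ i * dot P Y a ^ j * g a)"
    by (rule multihom_cong[OF multihom_XQ_PY[OF g, of i j]]) (use d in \<open>auto simp: add.commute\<close>)
  then have 1: "imM b c (M (\<lambda>a. dot X Q a ^ i * dot P Y a ^ j * g a))"
    unfolding imM_def by blast
  have 2: "imM b c (\<lambda>a. dot X Q a ^ i * dot P Y a ^ (j + 1) * lap X Q g a)"
  proof (cases "dx = 0 \<or> dq = 0")
    case True then show ?thesis using lap_eq_zero[OF g] imM_zero by simp
  next
    case False
    then show ?thesis by (intro lower multihom_lap) (use g in auto)
  qed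
  show ?thesis
    by (rule imM_cong[OF imM_add[OF 1 2]]) (use M_XQ_PY[OF g] in auto)
qed

text \<open>
  Surjectivity is proved by downward induction on \<open>k = i + j\<close> in \<open>(x\<cdot>q)^i (p\<cdot>y)^j g\<close>. On level \<open>k\<close> the
  relation above lets one trade \<open>x\<cdot>q\<close> for \<open>p\<cdot>y\<close>, and \<open>AD^(k+1)\<close> is onto.\<close>

lemma imM_level:
  fixes b c k :: nat
  assumes lower: "\<And>i j dx dp dy dq g. dx + i = b \<Longrightarrow> dp + j = b + 1 \<Longrightarrow> dy + j = c + 1 \<Longrightarrow>
      dq + i = c \<Longrightarrow> i + j = Suc k \<Longrightarrow> multihom (deg4 dx dp dy dq) g \<Longrightarrow>
      imM b c (\<lambda>a. dot X Q a ^ i * dot P Y a ^ j * g a)"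
    and d: "dx + i = b" "dp + j = b + 1" "dy + j = c + 1" "dq + i = c" "i + j = k"
    and g: "multihom (deg4 dx dp dy dq) g"
  shows "imM b c (\<lambda>a. dot X Q a ^ i * dot P Y a ^ j * g a)"
proof -
  have rel: "imM b c (\<lambda>a. dot X Q a ^ i * dot P Y a ^ j * AD g a
      - of_nat (i * (i + 1 + dx + dq)) * dot X Q a ^ (i - 1) * dot P Y a ^ (j + 1) * g a)"
    if "multihom (deg4 dx dp dy dq) g" "dx + i = b + 1" "dp + j = b" "dy + j = c" "dq + i = c + 1" "i + j = k"
    for dx dp dy dq i j g
    by (rule imM_relation[OF that(1-5)]) (rule lower, use that in auto)
  \<comment> \<open>At \<open>i = 0\<close> the second term of the relation has coefficient 0, so
    (p\<cdot>y)^k \<open>AD g\<close> is in the image outright. Each further step exchanges a factor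
    p\<cdot>y for x\<cdot>q at the cost of one more \<open>AD\<close>.\<close>
  have up: "imM b c (\<lambda>a. dot X Q a ^ i * dot P Y a ^ (k - i) * (AD ^^ Suc i) g a)"
    if g: "multihom (deg4 (b + 1) (b - k) (c - k) (c + 1)) g" and k: "k \<le> b" "k \<le> c" and i: "i \<le> k" for g i
    using i
  proof (induction i)
    case 0
    show ?case using rel[OF g, of 0 k] k by simp
  next
    case (Suc i)
    have h: "multihom (deg4 (b - i) (Suc i + (b - k)) (Suc i + (c - k)) (c - i)) ((AD ^^ Suc i) g)"
      by (rule multihom_AD_funpow, rule multihom_cong[OF g]) (use k Suc in auto)
    have 1: "imM b c (\<lambda>a. dot X Q a ^ Suc i * dot P Y a ^ (k - Suc i) * AD ((AD ^^ Suc i) g) a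
      - of_nat (Suc i * (Suc i + 1 + (b - i) + (c - i))) * dot X Q a ^ (Suc i - 1) * dot P Y a ^ (k - Suc i + 1)
          * (AD ^^ Suc i) g a)"
      by (rule rel[OF h]) (use Suc k in auto)
    have 2: "imM b c (\<lambda>a. of_nat (Suc i * (Suc i + 1 + (b - i) + (c - i))) *
          (dot X Q a ^ i * dot P Y a ^ (k - i) * (AD ^^ Suc i) g a))"
      by (rule imM_cmult) (use Suc in auto)
    have "k - Suc i + 1 = k - i" using Suc by auto
    then show ?case
      by (intro imM_cong[OF imM_add[OF 1 2]]) (simp add: algebra_simps)
  qed
  show ?thesis using d g
  proof (induction j arbitrary: i dx dp dy dq g)
    case 0
    have ki: "i = k" "k \<le> b" "k \<le> c" using 0 by auto
    \<comment> \<open>At \<open>j = 0\<close> the degrees in P and X, and likewise those in Y and Q,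
      differ by exactly \<open>k + 1\<close>. The surjectivity of \<open>sl2\<close> powers
      therefore applies twice, once for each pair of blocks.\<close>
    obtain g1 where g1: "multihom ((deg4 dx dp dy dq)(X := dx + Suc k, P := dx)) g1" "(pol X P ^^ Suc k) g1 = g"
      using pol_funpow_surj[of X P "deg4 dx dp dy dq" g dx "Suc k"] 0 ki by auto
    have g1': "multihom (deg4 (b + 1) (b - k) (c + 1) (c - k)) g1"
      by (rule multihom_cong[OF g1(1)]) (use 0 ki in auto)
    obtain g0 where g0: "multihom ((deg4 (b + 1) (b - k) (c + 1) (c - k))(Q := (c - k) + Suc k, Y := c - k)) g0"
        "(pol Q Y ^^ Suc k) g0 = g1"
      using pol_funpow_surj[of Q Y "deg4 (b + 1) (b - k) (c + 1) (c - k)" g1 "c - k" "Suc k"] g1' ki by auto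
    have g0': "multihom (deg4 (b + 1) (b - k) (c - k) (c + 1)) g0"
      by (rule multihom_cong[OF g0(1)]) (use ki in auto)
    have "(AD ^^ Suc k) g0 = g"
      using AD_funpow[OF multihom_polyfun[OF g0']] g0(2) g1(2) by metis
    then show ?case using up[OF g0' ki(2,3) order_refl] ki by simp
  next
    case (Suc j)
    have 1: "imM b c (\<lambda>a. dot X Q a ^ Suc i * dot P Y a ^ j * AD g a
      - of_nat (Suc i * (Suc i + 1 + dx + dq)) * dot X Q a ^ (Suc i - 1) * dot P Y a ^ (j + 1) * g a)"
      by (rule rel) (use Suc in auto)
    have 2: "imM b c (\<lambda>a. dot X Q a ^ Suc i * dot P Y a ^ j * AD g a)"
    proof (cases "dx = 0 \<or> dq = 0")
      case True
      then show ?thesis using AD_eq_zero[OF Suc.prems(6)] imM_zero by simp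
    next
      case False
      then obtain x q where dd: "dx = Suc x" "dq = Suc q" by (auto simp: gr0_conv_Suc)
      have "multihom (deg4 x (Suc dp) (Suc dy) q) (AD g)"
        by (rule multihom_AD) (use Suc.prems(6) dd in simp)
      then show ?thesis by (rule Suc.IH[rotated 5]) (use Suc.prems dd in auto)
    qed
    \<comment> \<open>The relation is solved for its second term, whose coefficient is nonzero
      because the exponent of x\<cdot>q is \<open>Suc i\<close>.\<close>
    let ?k = "of_nat (Suc i * (Suc i + 1 + dx + dq)) :: complex"
    have k0: "?k \<noteq> 0" by (simp only: of_nat_eq_0_iff) simp
    have "imM b c (\<lambda>a. inverse ?k * (dot X Q a ^ Suc i * dot P Y a ^ j * AD g a
       + (- 1) * (dot X Q a ^ Suc i * dot P Y a ^ j * AD g a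
      - ?k * dot X Q a ^ (Suc i - 1) * dot P Y a ^ (j + 1) * g a)))"
      by (intro imM_cmult imM_add 1 2)
    then show ?case
      by (rule imM_cong) (use k0 in \<open>simp add: mult.assoc del: of_nat_mult of_nat_add of_nat_Suc\<close>)
  qed
qed

theorem M_surj:
  assumes "multihom (deg4 b (b + 1) (c + 1) c) H"
  shows "imM b c H"
proof -
  have "imM b c (\<lambda>a. dot X Q a ^ i * dot P Y a ^ j * g a)"
    if "dx + i = b" "dp + j = b + 1" "dy + j = c + 1" "dq + i = c" "multihom (deg4 dx dp dy dq) g"
    for i j dx dp dy dq g
    using that
  \<comment> \<open>Since \<open>i \<le> b\<close> and \<open>j \<le> b + 1\<close>, the sum
    \<open>i + j\<close> stays below \<open>2 * b + 2\<close>, so the measure drops strictly as the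
    level rises.\<close>
  proof (induction "2 * b + 2 - (i + j)" arbitrary: i j dx dp dy dq g rule: less_induct)
    case less
    show ?case
      by (rule imM_level[OF _ less.prems(1-4) refl less.prems(5)], rule less.hyps) (use less.prems in auto)
  qed
  from this[of b 0 "b + 1" 0 "c + 1" c H] assms show ?thesis by simp
qed

section \<open>Lower semicontinuity of rank\<close>

text \<open>Elimination: a pivot \<open>B j0 k0\<close> removes one equation and one unknown
  together, so the strict inequality of the cardinalities persists.\<close>

lemma wide_system_kernel:
  fixes B :: "'j \<Rightarrow> 'k \<Rightarrow> complex"
  assumes "finite J" "finite I" "card J < card I"
  shows "\<exists>\<alpha>. (\<exists>k\<in>I. \<alpha> k \<noteq> 0) \<and> (\<forall>j\<in>J. (\<Sum>k\<in>I. \<alpha> k * B j k) = 0)"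
  using assms
proof (induction J arbitrary: I B rule: finite_induct)
  case empty
  then obtain k where "k \<in> I" by (metis card.empty less_irrefl equals0I)
  then show ?case by (intro exI[of _ "\<lambda>_. 1"]) auto
next
  case (insert j0 J)
  show ?case
  proof (cases "\<forall>k\<in>I. B j0 k = 0")
    case True
    have "card J < card I" using insert.prems insert.hyps by simp
    from insert.IH[OF insert.prems(1) this, of B]
    obtain \<alpha> where "\<exists>k\<in>I. \<alpha> k \<noteq> 0" "\<forall>j\<in>J. (\<Sum>k\<in>I. \<alpha> k * B j k) = 0" by blast
    then show ?thesis using True by (intro exI[of _ \<alpha>]) auto
  next
    case False
    then obtain k0 where k0: "k0 \<in> I" "B j0 k0 \<noteq> 0" by auto
    let ?I = "I - {k0}"
    let ?B = "\<lambda>j k. B j k - B j k0 * B j0 k / B j0 k0"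
    obtain \<alpha> where \<alpha>: "\<exists>k\<in>?I. \<alpha> k \<noteq> 0" "\<forall>j\<in>J. (\<Sum>k\<in>?I. \<alpha> k * ?B j k) = 0"
    proof -
      have "finite ?I" "card J < card ?I" using insert.prems insert.hyps k0 by auto
      from insert.IH[OF this, of ?B] that show ?thesis by blast
    qed
    define S where "S = (\<Sum>k\<in>?I. \<alpha> k * B j0 k)"
    define \<beta> where "\<beta> = \<alpha>(k0 := - S / B j0 k0)"
    have sum: "(\<Sum>k\<in>I. \<beta> k * B j k) = - S / B j0 k0 * B j k0 + (\<Sum>k\<in>?I. \<alpha> k * B j k)" for j
    proof -
      have "(\<Sum>k\<in>I. \<beta> k * B j k) = \<beta> k0 * B j k0 + (\<Sum>k\<in>?I. \<beta> k * B j k)"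
        using insert.prems k0 by (intro sum.remove) auto
      also have "(\<Sum>k\<in>?I. \<beta> k * B j k) = (\<Sum>k\<in>?I. \<alpha> k * B j k)"
        by (intro sum.cong) (auto simp: \<beta>_def)
      finally show ?thesis by (simp add: \<beta>_def)
    qed
    have "(\<Sum>k\<in>I. \<beta> k * B j k) = 0" if "j \<in> J" for j
    proof -
      have "(\<Sum>k\<in>?I. \<alpha> k * ?B j k) = (\<Sum>k\<in>?I. \<alpha> k * B j k) - B j k0 / B j0 k0 * S"
        by (simp add: S_def sum_distrib_left algebra_simps flip: sum_subtractf)
      moreover have "(\<Sum>k\<in>?I. \<alpha> k * ?B j k) = 0" using \<alpha>(2) that by blast
      ultimately have "(\<Sum>k\<in>?I. \<alpha> k * B j k) = B j k0 / B j0 k0 * S" by simp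
      then show ?thesis unfolding sum by simp
    qed
    moreover have "(\<Sum>k\<in>I. \<beta> k * B j0 k) = 0"
      using sum[of j0] k0 by (simp add: S_def)
    moreover have "\<exists>k\<in>I. \<beta> k \<noteq> 0" using \<alpha>(1) by (auto simp: \<beta>_def)
    ultimately show ?thesis by (intro exI[of _ \<beta>]) auto
  qed
qed

text \<open>By independence the new function minus its interpolant by the old ones is nonzero at
  some point, and adding that point completes a dual basis of finite combinations of evaluations.
  The lemma serves semicontinuity, extraction of coefficients and the trace of an
  idempotent.\<close>

lemma dual_evaluations:
  fixes F :: "'k \<Rightarrow> 'p \<Rightarrow> complex"
  assumes "finite I"
    and "\<And>\<alpha>. (\<forall>p\<in>S. (\<Sum>k\<in>I. \<alpha> k * F k p) = 0) \<Longrightarrow> \<forall>k\<in>I. \<alpha> k = 0"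
  shows "\<exists>A w. finite A \<and> A \<subseteq> S \<and>
     (\<forall>m\<in>I. \<forall>k\<in>I. (\<Sum>p\<in>A. w m p * F k p) = (if m = k then 1 else 0))"
  using assms
proof (induction I rule: finite_induct)
  case empty then show ?case by (intro exI[of _ "{}"]) auto
next
  case (insert k0 I)
  have "\<forall>k\<in>I. \<alpha> k = 0" if "\<forall>p\<in>S. (\<Sum>k\<in>I. \<alpha> k * F k p) = 0" for \<alpha>
  proof -
    have "(\<Sum>k\<in>I. (\<alpha>(k0 := 0)) k * F k p) = (\<Sum>k\<in>I. \<alpha> k * F k p)" for p
      using insert.hyps by (intro sum.cong) auto
    then have "\<forall>k\<in>insert k0 I. (\<alpha>(k0 := 0)) k = 0"
      using that insert.hyps by (intro insert.prems) simp
    then show ?thesis using insert.hyps by (metis fun_upd_other insertI2)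
  qed
  from insert.IH[OF this] obtain A w where Aw: "finite A" "A \<subseteq> S"
    "\<forall>m\<in>I. \<forall>k\<in>I. (\<Sum>p\<in>A. w m p * F k p) = (if m = k then 1 else 0)" by auto
  define w0 where "w0 m p = (if p \<in> A then w m p else 0)" for m p
  define L where "L m = (\<Sum>p\<in>A. w m p * F k0 p)" for m
  define G where "G p = F k0 p - (\<Sum>m\<in>I. L m * F m p)" for p
  have "\<exists>p\<in>S. G p \<noteq> 0"
  proof (rule ccontr)
    assume "\<not> ?thesis"
    then have G0: "\<forall>p\<in>S. G p = 0" by auto
    let ?\<alpha> = "\<lambda>k. if k = k0 then 1 else - L k"
    have "(\<Sum>k\<in>insert k0 I. ?\<alpha> k * F k p) = G p" for p
    proof -
      have "(\<Sum>k\<in>I. ?\<alpha> k * F k p) = (\<Sum>k\<in>I. - (L k * F k p))"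
        using insert.hyps by (intro sum.cong) auto
      then show ?thesis using insert.hyps by (simp add: G_def sum_negf)
    qed
    then have "\<forall>k\<in>insert k0 I. ?\<alpha> k = 0" using G0 by (intro insert.prems) simp
    then show False by simp
  qed
  then obtain p0 where p0: "p0 \<in> S" "G p0 \<noteq> 0" by auto
  let ?A = "insert p0 A"
  \<comment> \<open>Evaluation at \<open>p0\<close>, corrected so as to vanish on the old functions
    and normalised by \<open>G p0\<close>.\<close>
  define v where "v p = ((if p = p0 then 1 else 0) - (\<Sum>m\<in>I. F m p0 * w0 m p)) / G p0" for p
  have w0: "(\<Sum>p\<in>?A. w0 m p * H p) = (\<Sum>p\<in>A. w m p * H p)" for m H
  proof -
    have "(\<Sum>p\<in>?A. w0 m p * H p) = (\<Sum>p\<in>A. w0 m p * H p)"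
      using Aw by (intro sum.mono_neutral_right) (auto simp: w0_def)
    also have "\<dots> = (\<Sum>p\<in>A. w m p * H p)" by (intro sum.cong) (auto simp: w0_def)
    finally show ?thesis .
  qed
  have v: "(\<Sum>p\<in>?A. v p * H p) = (H p0 - (\<Sum>m\<in>I. F m p0 * (\<Sum>p\<in>A. w m p * H p))) / G p0" for H
  proof -
    have "v p * H p = ((if p = p0 then H p else 0) - (\<Sum>m\<in>I. F m p0 * (w0 m p * H p))) / G p0" for p
      by (simp add: v_def left_diff_distrib sum_distrib_right mult.assoc)
    then have "(\<Sum>p\<in>?A. v p * H p)
      = ((\<Sum>p\<in>?A. (if p = p0 then H p else 0)) - (\<Sum>p\<in>?A. \<Sum>m\<in>I. F m p0 * (w0 m p * H p))) / G p0"
      by (simp add: sum_subtractf del: sum.insert flip: sum_divide_distrib)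
    also have "(\<Sum>p\<in>?A. (if p = p0 then H p else 0)) = H p0"
      using Aw by (simp add: sum.delta)
    also have "(\<Sum>p\<in>?A. \<Sum>m\<in>I. F m p0 * (w0 m p * H p)) = (\<Sum>m\<in>I. F m p0 * (\<Sum>p\<in>?A. w0 m p * H p))"
      by (subst sum.swap) (simp add: sum_distrib_left)
    finally show ?thesis unfolding w0 .
  qed
  have vI: "(\<Sum>p\<in>?A. v p * F k p) = 0" if "k \<in> I" for k
  proof -
    have "(\<Sum>m\<in>I. F m p0 * (\<Sum>p\<in>A. w m p * F k p)) = (\<Sum>m\<in>I. if m = k then F m p0 else 0)"
      using Aw(3) that by (intro sum.cong) auto
    also have "\<dots> = F k p0" using that insert.hyps by (simp add: sum.delta)
    finally show ?thesis unfolding v by simp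
  qed
  have vk: "(\<Sum>p\<in>?A. v p * F k0 p) = 1"
  proof -
    have "(\<Sum>m\<in>I. F m p0 * (\<Sum>p\<in>A. w m p * F k0 p)) = (\<Sum>m\<in>I. L m * F m p0)"
      by (simp add: L_def mult.commute)
    then show ?thesis unfolding v using p0(2) by (simp add: G_def)
  qed
  define w' where "w' m = (if m = k0 then v else (\<lambda>p. w0 m p - L m * v p))" for m
  have "(\<Sum>p\<in>?A. w' m p * F k p) = (if m = k then 1 else 0)"
    if "m \<in> insert k0 I" "k \<in> insert k0 I" for m k
  proof (cases "m = k0")
    case True
    then show ?thesis using that vI vk by (auto simp: w'_def)
  next
    case False
    have "(\<Sum>p\<in>?A. w' m p * F k p) = (\<Sum>p\<in>?A. w0 m p * F k p) - L m * (\<Sum>p\<in>?A. v p * F k p)"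
      using False by (simp add: w'_def algebra_simps sum_subtractf sum_distrib_left)
    also have "\<dots> = (if m = k then 1 else 0)"
      unfolding w0 using that False Aw(3) vI vk L_def by auto
    finally show ?thesis .
  qed
  then show ?case using Aw p0 by (intro exI[of _ ?A] exI[of _ w']) auto
qed

text \<open>Independence of the functions \<open>B k\<close> is witnessed by finitely many points,
  where a small perturbation cannot destroy it; a factorization through fewer than
  \<open>card I\<close> functions would. Approximation on finite subsets of \<open>S\<close> is
  exactly what a convergent sequence of tensors supplies.\<close>

lemma rank_semicontinuous:
  fixes B :: "'k \<Rightarrow> 'p \<Rightarrow> complex" and R :: nat
  assumes fin: "finite I"
    and indep: "\<And>\<alpha>. (\<forall>p\<in>S. (\<Sum>k\<in>I. \<alpha> k * B k p) = 0) \<Longrightarrow> \<forall>k\<in>I. \<alpha> k = 0"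
    and approx: "\<And>A \<epsilon>. finite A \<Longrightarrow> A \<subseteq> S \<Longrightarrow> \<epsilon> > 0 \<Longrightarrow>
      \<exists>B' (J :: 'j set) y z. finite J \<and> card J \<le> R \<and>
        (\<forall>p\<in>A. \<forall>k\<in>I. cmod (B' k p - B k p) < \<epsilon> \<and> B' k p = (\<Sum>j\<in>J. y j p * z j k))"
  shows "card I \<le> R"
proof (rule ccontr)
  assume "\<not> ?thesis"
  then have R: "R < card I" by simp
  from dual_evaluations[where S = S and F = B, OF fin indep] obtain A w where A: "finite A" "A \<subseteq> S"
    and w: "\<forall>m\<in>I. \<forall>k\<in>I. (\<Sum>p\<in>A. w m p * B k p) = (if m = k then 1 else 0)" by auto
  define W where "W = (\<Sum>m\<in>I. \<Sum>p\<in>A. cmod (w m p)) + 1"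
  have W: "W > 0" unfolding W_def by (intro add_nonneg_pos sum_nonneg) auto
  \<comment> \<open>Chosen so that the total error \<open>card I * (mx * (W * \<epsilon>))\<close>
    is \<open>mx / 2\<close>.\<close>
  define \<epsilon> where "\<epsilon> = 1 / (2 * real (card I) * W)"
  have \<epsilon>: "\<epsilon> > 0" using W R by (simp add: \<epsilon>_def)
  obtain B' and J :: "'j set" and y z where J: "finite J" "card J \<le> R"
    and B': "\<forall>p\<in>A. \<forall>k\<in>I. cmod (B' k p - B k p) < \<epsilon>"
    and yz: "\<forall>p\<in>A. \<forall>k\<in>I. B' k p = (\<Sum>j\<in>J. y j p * z j k)"
    using approx[OF A \<epsilon>] by (elim exE conjE) blast
  obtain \<alpha> where \<alpha>: "\<exists>k\<in>I. \<alpha> k \<noteq> 0" "\<forall>j\<in>J. (\<Sum>k\<in>I. \<alpha> k * z j k) = 0"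
    using wide_system_kernel[OF J(1) fin, of z] J R by auto
  have z0: "(\<Sum>k\<in>I. \<alpha> k * B' k p) = 0" if "p \<in> A" for p
  proof -
    have "(\<Sum>k\<in>I. \<alpha> k * B' k p) = (\<Sum>k\<in>I. \<Sum>j\<in>J. y j p * (\<alpha> k * z j k))"
      using yz that by (intro sum.cong) (auto simp: sum_distrib_left algebra_simps)
    also have "\<dots> = (\<Sum>j\<in>J. y j p * (\<Sum>k\<in>I. \<alpha> k * z j k))"
      by (subst sum.swap) (simp add: sum_distrib_left)
    also have "\<dots> = 0" using \<alpha>(2) by simp
    finally show ?thesis .
  qed
  have ne: "I \<noteq> {}" using \<alpha> by auto
  \<comment> \<open>The dual functional of a coefficient of largest modulus is applied to the
    relation, so that the error can be compared with that coefficient itself.\<close>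
  define mx where "mx = Max ((\<lambda>k. cmod (\<alpha> k)) ` I)"
  have "mx \<in> (\<lambda>k. cmod (\<alpha> k)) ` I" unfolding mx_def using fin ne by (intro Max_in) auto
  then obtain m where m: "m \<in> I" "mx = cmod (\<alpha> m)" by auto
  have le: "cmod (\<alpha> k) \<le> mx" if "k \<in> I" for k unfolding mx_def using fin that by auto
  have "mx > 0" using \<alpha>(1) le by (metis norm_le_zero_iff not_le order.trans)
  define E where "E k = (\<Sum>p\<in>A. w m p * (B' k p - B k p))" for k
  have E: "cmod (E k) \<le> W * \<epsilon>" if "k \<in> I" for k
  proof -
    have "cmod (E k) \<le> (\<Sum>p\<in>A. cmod (w m p) * \<epsilon>)"
      unfolding E_def by (rule order.trans[OF norm_sum sum_mono])
        (use B' that in \<open>auto simp: norm_mult intro!: mult_left_mono intro: less_imp_le\<close>)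
    also have "\<dots> = (\<Sum>p\<in>A. cmod (w m p)) * \<epsilon>" by (simp add: sum_distrib_right)
    also have "\<dots> \<le> W * \<epsilon>"
    proof (rule mult_right_mono)
      have "(\<Sum>p\<in>A. cmod (w m p)) \<le> (\<Sum>m\<in>I. \<Sum>p\<in>A. cmod (w m p))"
        using m fin by (intro member_le_sum) (auto intro: sum_nonneg)
      then show "(\<Sum>p\<in>A. cmod (w m p)) \<le> W" by (simp add: W_def)
    qed (use \<epsilon> in simp)
    finally show ?thesis .
  qed
  have "0 = (\<Sum>p\<in>A. w m p * (\<Sum>k\<in>I. \<alpha> k * B' k p))" using z0 by simp
  also have "\<dots> = (\<Sum>k\<in>I. \<alpha> k * (\<Sum>p\<in>A. w m p * B' k p))"
    by (simp add: sum_distrib_left algebra_simps) (rule sum.swap)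
  also have "\<dots> = (\<Sum>k\<in>I. \<alpha> k * ((if m = k then 1 else 0) + E k))"
  proof (rule sum.cong)
    fix k assume k: "k \<in> I"
    have "(\<Sum>p\<in>A. w m p * B' k p) = (\<Sum>p\<in>A. w m p * B k p) + E k"
      by (simp add: E_def algebra_simps sum_subtractf)
    then show "\<alpha> k * (\<Sum>p\<in>A. w m p * B' k p) = \<alpha> k * ((if m = k then 1 else 0) + E k)"
      using w m k by simp
  qed simp
  also have "\<dots> = \<alpha> m + (\<Sum>k\<in>I. \<alpha> k * E k)"
  proof -
    have "\<alpha> k * ((if m = k then 1 else 0) + E k) = (if m = k then \<alpha> k else 0) + \<alpha> k * E k" for k
      by (simp add: distrib_left)
    then show ?thesis using m fin by (simp add: sum.distrib)
  qed
  finally have "cmod (\<alpha> m) = cmod (\<Sum>k\<in>I. \<alpha> k * E k)"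
    by (metis add_eq_0_iff norm_minus_cancel)
  also have "\<dots> \<le> (\<Sum>k\<in>I. mx * (W * \<epsilon>))"
    by (rule order.trans[OF norm_sum sum_mono])
      (use le E \<open>mx > 0\<close> in \<open>auto simp: norm_mult intro!: mult_mono\<close>)
  also have "\<dots> = mx / 2" using W R by (simp add: \<epsilon>_def)
  finally show False using m \<open>mx > 0\<close> by simp
qed

text \<open>Interpolation: the weights dual to the powers \<open>t ^ i\<close> express each
  coefficient as a finite linear combination of values of the polynomial.\<close>

lemma coefficient_closed:
  fixes F :: "nat \<Rightarrow> 'a \<Rightarrow> complex" and Z :: "('a \<Rightarrow> complex) \<Rightarrow> bool"
  assumes zero: "Z (\<lambda>a. 0)" and add: "\<And>f g. Z f \<Longrightarrow> Z g \<Longrightarrow> Z (\<lambda>a. f a + g a)"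
    and cmult: "\<And>c f. Z f \<Longrightarrow> Z (\<lambda>a. c * f a)"
    and all: "\<And>t. Z (\<lambda>a. \<Sum>i\<le>d. F i a * t ^ i)" and k: "k \<le> d"
  shows "Z (F k)"
proof -
  have "\<forall>i\<in>{..d}. \<alpha> i = 0" if "\<forall>t\<in>UNIV. (\<Sum>i\<in>{..d}. \<alpha> i * t ^ i) = 0" for \<alpha> :: "nat \<Rightarrow> complex"
    using that polyfun_eq_0[of \<alpha> d] by auto
  from dual_evaluations[where S = UNIV and F = "\<lambda>i t. t ^ i", OF _ this] obtain A and w :: "nat \<Rightarrow> complex \<Rightarrow> complex" where A: "finite A"
    and w: "\<forall>m\<in>{..d}. \<forall>i\<in>{..d}. (\<Sum>t\<in>A. w m t * t ^ i) = (if m = i then 1 else 0)" by auto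
  have "Z (\<lambda>a. \<Sum>t\<in>A. w k t * (\<Sum>i\<le>d. F i a * t ^ i))"
    using A
  proof (induction A rule: finite_induct)
    case (insert t A)
    then show ?case using add[OF cmult[OF all[of t], of "w k t"] insert.IH] by simp
  qed (simp add: zero)
  moreover have "(\<Sum>t\<in>A. w k t * (\<Sum>i\<le>d. F i a * t ^ i)) = F k a" for a
  proof -
    have "(\<Sum>t\<in>A. w k t * (\<Sum>i\<le>d. F i a * t ^ i)) = (\<Sum>i\<le>d. F i a * (\<Sum>t\<in>A. w k t * t ^ i))"
      by (simp add: sum_distrib_left algebra_simps) (rule sum.swap)
    also have "\<dots> = (\<Sum>i\<le>d. if k = i then F i a else 0)"
      using w k by (intro sum.cong) auto
    finally show ?thesis using k by simp
  qed
  ultimately show ?thesis by simp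
qed

section \<open>Products of powers of linear forms on the incidence cone\<close>

definition vdot :: "(nat \<Rightarrow> complex) \<Rightarrow> (nat \<Rightarrow> complex) \<Rightarrow> complex" where
  "vdot u v = u 0 * v 0 + u 1 * v 1 + u 2 * v 2"

definition cross :: "(nat \<Rightarrow> complex) \<Rightarrow> (nat \<Rightarrow> complex) \<Rightarrow> nat \<Rightarrow> complex" where
  "cross u v i = (if i = 0 then u 1 * v 2 - u 2 * v 1
     else if i = 1 then u 2 * v 0 - u 0 * v 2 else u 0 * v 1 - u 1 * v 0)"

lemma cross_simps [simp]:
  "cross u v 0 = u 1 * v 2 - u 2 * v 1"
  "cross u v (Suc 0) = u 2 * v 0 - u 0 * v 2"
  "cross u v 2 = u 0 * v 1 - u 1 * v 0"
  by (simp_all add: cross_def)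

lemma cross_scale: "cross u (\<lambda>i. c * v i) j = c * cross u v j"
  by (simp add: cross_def algebra_simps)

abbreviation lin :: "blk \<Rightarrow> (nat \<Rightarrow> complex) \<Rightarrow> pt \<Rightarrow> complex" where
  "lin s u a \<equiv> vdot (a s) u"

definition bideg :: "blk \<Rightarrow> blk \<Rightarrow> nat \<Rightarrow> nat \<Rightarrow> blk \<Rightarrow> nat" where
  "bideg s t m n = (\<lambda>_. 0)(s := m, t := n)"

lemma multihom_lin: "multihom ((\<lambda>_. 0)(s := 1)) (lin s u)"
proof -
  have 1: "multihom ((\<lambda>_. 0)(s := 1)) (\<lambda>a. u i * a s i)" if "i < 3" for i
    by (rule multihom_cmult[OF multihom_var[OF that]])
  have "multihom ((\<lambda>_. 0)(s := 1)) (\<lambda>a. u 0 * a s 0 + u 1 * a s 1 + u 2 * a s 2)"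
    by (intro multihom_add 1) auto
  then show ?thesis by (rule multihom_cong) (auto simp: vdot_def)
qed

lemma polyfun_lin [simp, intro]: "polyfun (lin s u)"
  by (rule multihom_polyfun[OF multihom_lin])

lemma bideg_mult:
  assumes "multihom (bideg s t m n) f" "multihom (bideg s t m' n') g"
  shows "multihom (bideg s t (m + m') (n + n')) (\<lambda>a. f a * g a)"
  by (rule multihom_cong[OF multihom_mult[OF assms]]) (auto simp: bideg_def)

lemma multihom_lin_power1: "s \<noteq> t \<Longrightarrow> multihom (bideg s t m 0) (\<lambda>a. lin s u a ^ m)"
  by (rule multihom_cong[OF multihom_power[OF multihom_lin]]) (auto simp: bideg_def)

lemma multihom_lin_power2: "s \<noteq> t \<Longrightarrow> multihom (bideg s t 0 n) (\<lambda>a. lin t u a ^ n)"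
  by (rule multihom_cong[OF multihom_power[OF multihom_lin]]) (auto simp: bideg_def)

lemma multihom_lin_lin:
  assumes "s \<noteq> t"
  shows "multihom (bideg s t m n) (\<lambda>a. lin s u a ^ m * lin t z a ^ n)"
  using bideg_mult[OF multihom_lin_power1[OF assms, of m u] multihom_lin_power2[OF assms, of n z]] by simp

text \<open>The generators with \<open>vdot u z = 0\<close> are the translates of a highest weight
  vector among the functions on the cone. The multiples of \<open>dot s t\<close> are included so
  that the span can be compared with all bihomogeneous functions, not just their restrictions to the
  cone.\<close>

inductive cone_span :: "blk \<Rightarrow> blk \<Rightarrow> nat \<Rightarrow> nat \<Rightarrow> (pt \<Rightarrow> complex) \<Rightarrow> bool" for s t where
  cone_span_base: "vdot u z = 0 \<Longrightarrow> cone_span s t m n (\<lambda>a. lin s u a ^ m * lin t z a ^ n)"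
| cone_span_add: "cone_span s t m n f \<Longrightarrow> cone_span s t m n g \<Longrightarrow> cone_span s t m n (\<lambda>a. f a + g a)"
| cone_span_cmult: "cone_span s t m n f \<Longrightarrow> cone_span s t m n (\<lambda>a. c * f a)"
| cone_span_ideal: "multihom (bideg s t m n) h \<Longrightarrow> cone_span s t (Suc m) (Suc n) (\<lambda>a. dot s t a * h a)"

lemma vdot_zero: "vdot (\<lambda>_. 0) z = 0" "vdot z (\<lambda>_. 0) = 0"
  by (simp_all add: vdot_def)

lemma cone_span_zero: "cone_span s t m n (\<lambda>a. 0)"
  using cone_span_cmult[OF cone_span_base[of "\<lambda>_. 0" "\<lambda>_. 0"], where c = 0] by (simp add: vdot_zero)

lemma cone_span_cong: "cone_span s t m n f \<Longrightarrow> (\<And>a. f a = g a) \<Longrightarrow> cone_span s t m n g"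
  by (metis ext)

lemma vdot_commute: "vdot u v = vdot v u"
  by (simp add: vdot_def mult.commute)

lemma dot_commute: "dot s t = dot t s"
  by (simp add: dot_def fun_eq_iff mult.commute)

lemma cone_span_sym: "cone_span s t m n f \<Longrightarrow> s \<noteq> t \<Longrightarrow> cone_span t s n m f"
proof (induction rule: cone_span.induct)
  case (cone_span_base u z m n)
  then show ?case using cone_span.cone_span_base[of z u t s n m] by (simp add: vdot_commute mult.commute)
next
  case (cone_span_ideal m n h)
  have "multihom (bideg t s n m) h"
    by (rule multihom_cong[OF cone_span_ideal(1)]) (use cone_span_ideal in \<open>auto simp: bideg_def\<close>)
  then show ?case unfolding dot_commute[of s t] by (rule cone_span.cone_span_ideal)
qed (auto intro: cone_span.intros)

lemma cone_span_poly_coeff: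
  assumes "\<And>t'. cone_span s t m n (\<lambda>a. poly (p a) t')" "\<And>a. degree (p a) \<le> d" "k \<le> d"
  shows "cone_span s t m n (\<lambda>a. coeff (p a) k)"
proof (rule coefficient_closed[where d = d and F = "\<lambda>i a. coeff (p a) i"])
  fix t'
  have "poly (p a) t' = (\<Sum>i\<le>d. coeff (p a) i * t' ^ i)" for a
  proof -
    have "(\<Sum>i\<le>d. coeff (p a) i * t' ^ i) = (\<Sum>i\<le>degree (p a). coeff (p a) i * t' ^ i)"
      using assms(2)[of a] by (intro sum.mono_neutral_right) (auto simp: coeff_eq_0)
    then show ?thesis by (simp add: poly_altdef)
  qed
  then show "cone_span s t m n (\<lambda>a. \<Sum>i\<le>d. coeff (p a) i * t' ^ i)" using assms(1)[of t'] by simp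
qed (auto intro: cone_span.intros cone_span_zero assms)

lemma degree_linear_powers: "degree ([:A, B:] ^ m * [:C, D:] ^ n) \<le> m + n"
  for A B C D :: complex
proof -
  have "degree ([:A, B:] ^ m) \<le> m" "degree ([:C, D:] ^ n) \<le> n"
    by (rule order.trans[OF degree_power_le], simp)+
  then show ?thesis by (meson add_mono degree_mult_le order.trans)
qed

lemma coeff_1_linear_powers:
  fixes A B C D :: complex
  shows "coeff ([:A, B:] ^ m * [:C, D:] ^ n) 1
    = of_nat m * A ^ (m - 1) * B * C ^ n + of_nat n * A ^ m * C ^ (n - 1) * D"
proof -
  have pw: "poly (pderiv ([:A, B:] ^ m)) 0 = of_nat m * A ^ (m - 1) * B" for A B :: complex and m
    by (cases m) (simp_all add: pderiv_power_Suc pderiv_pCons del: power_Suc)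
  have "coeff ([:A, B:] ^ m * [:C, D:] ^ n) 1 = poly (pderiv ([:A, B:] ^ m * [:C, D:] ^ n)) 0"
    by (simp add: poly_0_coeff_0 coeff_pderiv)
  also have "\<dots> = A ^ m * (of_nat n * C ^ (n - 1) * D) + C ^ n * (of_nat m * A ^ (m - 1) * B)"
    unfolding pderiv_mult poly_add poly_mult pw by simp
  finally show ?thesis by (simp add: algebra_simps)
qed

text \<open>The derivative at 0 of a polynomial curve in the span is its coefficient of degree 1,
  hence in the span by interpolation. The factor \<open>E\<close> is constant along the
  curve.\<close>

lemma cone_span_curve_derivative:
  assumes "\<And>t' :: complex. cone_span s t m n (\<lambda>a. (A a + t' * B a) ^ k * (C a + t' * D a) ^ l * E a)" "0 < k + l"
  shows "cone_span s t m n (\<lambda>a. (of_nat k * A a ^ (k - 1) * B a * C a ^ l + of_nat l * A a ^ k * C a ^ (l - 1) * D a) * E a)"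
proof -
  let ?p = "\<lambda>a. smult (E a) ([:A a, B a:] ^ k * [:C a, D a:] ^ l)"
  have "cone_span s t m n (\<lambda>a. coeff (?p a) 1)"
  proof (rule cone_span_poly_coeff[where d = "k + l"])
    show "degree (?p a) \<le> k + l" for a
      using degree_linear_powers by (meson degree_smult_le order.trans)
    show "cone_span s t m n (\<lambda>a. poly (?p a) t')" for t'
      using assms(1)[of t'] by (simp add: mult_ac)
  qed (use assms(2) in linarith)
  then show ?thesis by (simp add: coeff_1_linear_powers mult.commute del: One_nat_def)
qed

lemma vdot_add_scale: "vdot (\<lambda>i. u i + c * v i) w = vdot u w + c * vdot v w"
   "vdot w (\<lambda>i. u i + c * v i) = vdot w u + c * vdot w v"
  by (simp_all add: vdot_def algebra_simps)

text \<open>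
  The curves \<open>(u + tv, z - tc)\<close> and \<open>(u + te, z + s(w - tc))\<close> stay on the cone \<open>u\<cdot>z = 0\<close>; the result is
  a combination of their derivatives and of a multiple of \<open>dot s t\<close>.\<close>

lemma cone_span_times_lin_frame:
  assumes "s \<noteq> t" and uz: "vdot u z = 0" and tau: "\<tau> \<noteq> 0"
    and r: "vdot v z = \<tau>" "vdot u c = \<tau>" "vdot v c = 0" "vdot e c = 0" "vdot e z = 0"
      "vdot u w = 0" "vdot e w = \<tau>"
    and id: "\<And>a. \<tau> * dot s t a = lin s u a * lin t c a + lin s e a * lin t w a + lin s v a * lin t z a"
  shows "cone_span s t (Suc m) n (\<lambda>a. lin s v a * (lin s u a ^ m * lin t z a ^ n))"
proof -
  let ?al = "\<lambda>a. lin s v a * (lin s u a ^ m * lin t z a ^ n)"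
  have c1: "cone_span s t (Suc m) n (\<lambda>a. (of_nat (Suc m) * lin s u a ^ (Suc m - 1) * lin s v a * lin t z a ^ n
     + of_nat n * lin s u a ^ (Suc m) * lin t z a ^ (n - 1) * (- lin t c a)) * 1)"
  proof (rule cone_span_curve_derivative)
    fix t'
    have "vdot (\<lambda>i. u i + t' * v i) (\<lambda>i. z i + (- t') * c i) = 0"
      unfolding vdot_add_scale using uz r by (simp add: algebra_simps)
    from cone_span_base[OF this, of s t "Suc m" n]
    show "cone_span s t (Suc m) n (\<lambda>a. (lin s u a + t' * lin s v a) ^ Suc m * (lin t z a + t' * - lin t c a) ^ n * 1)"
      unfolding vdot_add_scale by simp
  qed simp
  show ?thesis
  proof (cases n)
    case 0
    then have "cone_span s t (Suc m) n (\<lambda>a. inverse (of_nat (Suc m)) * ((of_nat (Suc m) * lin s u a ^ (Suc m - 1) * lin s v a * lin t z a ^ n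
     + of_nat n * lin s u a ^ (Suc m) * lin t z a ^ (n - 1) * (- lin t c a)) * 1))"
      using c1 by (intro cone_span_cmult)
    then show ?thesis by (rule cone_span_cong) (use 0 in \<open>simp add: field_simps del: of_nat_Suc\<close>)
  next
    case (Suc l)
    let ?be = "\<lambda>a. lin s e a * lin s u a ^ m * lin t w a * lin t z a ^ l"
    let ?J = "\<lambda>a. dot s t a * (lin s u a ^ m * lin t z a ^ l)"
    have J: "cone_span s t (Suc m) n ?J"
      unfolding Suc by (rule cone_span_ideal[OF multihom_lin_lin[OF assms(1)]])
    \<comment> \<open>Derivative of the second curve in its inner parameter; the vacuous factor with
      exponent 0 fits it to the shape of \<open>cone_span_curve_derivative\<close>. The outer
      parameter is differentiated in \<open>c2\<close>.\<close>
    have c2s: "cone_span s t (Suc m) n (\<lambda>a. (of_nat n * 1 ^ 0 * lin t z a ^ (n - 1) * (lin t w a + t' * - lin t c a))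
          * (lin s u a + t' * lin s e a) ^ Suc m)" for t'
    proof -
      have "cone_span s t (Suc m) n (\<lambda>a. (of_nat 0 * 1 ^ (0 - 1) * 0 * lin t z a ^ n
           + of_nat n * 1 ^ 0 * lin t z a ^ (n - 1) * (lin t w a + t' * - lin t c a))
          * (lin s u a + t' * lin s e a) ^ Suc m)"
      proof (rule cone_span_curve_derivative)
        fix s'
        have "vdot (\<lambda>i. u i + t' * e i) (\<lambda>i. (z i + s' * w i) + (- (s' * t')) * c i) = 0"
          unfolding vdot_add_scale using uz r by (simp add: algebra_simps)
        from cone_span_base[OF this, of s t "Suc m" n]
        show "cone_span s t (Suc m) n (\<lambda>a. (1 + s' * 0) ^ 0 * (lin t z a + s' * (lin t w a + t' * - lin t c a)) ^ n
           * (lin s u a + t' * lin s e a) ^ Suc m)"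
          unfolding vdot_add_scale by (rule cone_span_cong) (simp add: algebra_simps)
      qed (use Suc in simp)
      then show ?thesis by simp
    qed
    have c2: "cone_span s t (Suc m) n (\<lambda>a. (of_nat (Suc m) * lin s u a ^ (Suc m - 1) * lin s e a * lin t w a ^ 1
        + of_nat 1 * lin s u a ^ Suc m * lin t w a ^ (1 - 1) * (- lin t c a)) * (of_nat n * lin t z a ^ l))"
    proof (rule cone_span_curve_derivative)
      fix t'
      show "cone_span s t (Suc m) n (\<lambda>a. (lin s u a + t' * lin s e a) ^ Suc m * (lin t w a + t' * - lin t c a) ^ 1
          * (of_nat n * lin t z a ^ l))"
        using c2s[of t'] Suc by (simp add: mult_ac)
    qed simp
    \<comment> \<open>A multiple of \<open>?J\<close> turns the product
      \<open>lin s u a * lin t c a\<close> into the two other terms of the frame identity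
      \<open>id\<close>.\<close>
    have e1: "cone_span s t (Suc m) n (\<lambda>a. (of_nat (Suc m + n)) * ?al a + of_nat n * ?be a)"
    proof -
      have "cone_span s t (Suc m) n (\<lambda>a. (of_nat (Suc m) * lin s u a ^ (Suc m - 1) * lin s v a * lin t z a ^ n
        + of_nat n * lin s u a ^ (Suc m) * lin t z a ^ (n - 1) * (- lin t c a)) * 1 + (of_nat n * \<tau>) * ?J a)"
        by (intro cone_span_add c1 cone_span_cmult J)
      moreover have "(of_nat (Suc m) * lin s u a ^ (Suc m - 1) * lin s v a * lin t z a ^ n
        + of_nat n * lin s u a ^ (Suc m) * lin t z a ^ (n - 1) * (- lin t c a)) * 1 + (of_nat n * \<tau>) * ?J a
        = (of_nat (Suc m + n)) * ?al a + of_nat n * ?be a" for a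
      proof -
        have "(of_nat n * \<tau>) * ?J a = of_nat n * (\<tau> * dot s t a) * (lin s u a ^ m * lin t z a ^ l)" by simp
        then show ?thesis unfolding id using Suc by (simp add: algebra_simps)
      qed
      ultimately show ?thesis by simp
    qed
    have e2: "cone_span s t (Suc m) n (\<lambda>a. (of_nat (Suc (Suc m))) * ?be a + ?al a)"
    proof -
      have "cone_span s t (Suc m) n (\<lambda>a. inverse (of_nat n) * ((of_nat (Suc m) * lin s u a ^ (Suc m - 1) * lin s e a * lin t w a ^ 1
        + of_nat 1 * lin s u a ^ Suc m * lin t w a ^ (1 - 1) * (- lin t c a)) * (of_nat n * lin t z a ^ l))
        + \<tau> * ?J a)"
        by (intro cone_span_add c2 cone_span_cmult J)
      moreover have "inverse (of_nat n) * ((of_nat (Suc m) * lin s u a ^ (Suc m - 1) * lin s e a * lin t w a ^ 1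
        + of_nat 1 * lin s u a ^ Suc m * lin t w a ^ (1 - 1) * (- lin t c a)) * (of_nat n * lin t z a ^ l))
        + \<tau> * ?J a = (of_nat (Suc (Suc m))) * ?be a + ?al a" for a
      proof -
        have n0: "(of_nat n :: complex) \<noteq> 0" using Suc by (simp del: of_nat_Suc)
        have cancel: "inverse (of_nat n) * (x * (of_nat n * y)) = x * y" for x y :: complex
          using n0 by simp
        have J: "\<tau> * ?J a = (\<tau> * dot s t a) * (lin s u a ^ m * lin t z a ^ l)" by simp
        show ?thesis unfolding cancel J id using Suc by (simp add: algebra_simps)
      qed
      ultimately show ?thesis by simp
    qed
    \<comment> \<open>The determinant \<open>(m + 2) * (m + 1 + n) - n\<close> of the linear system
      \<open>e1\<close>, \<open>e2\<close> in the unknowns \<open>?al\<close>,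
      \<open>?be\<close>.\<close>
    define K where "K = (of_nat ((m + 2) * (m + 1) + n * (m + 1)) :: complex)"
    have K: "K \<noteq> 0" unfolding K_def by (simp only: of_nat_eq_0_iff) simp
    have "cone_span s t (Suc m) n (\<lambda>a. inverse K * (of_nat (Suc (Suc m)) * ((of_nat (Suc m + n)) * ?al a + of_nat n * ?be a)
       + (- of_nat n) * ((of_nat (Suc (Suc m))) * ?be a + ?al a)))"
      by (intro cone_span_cmult cone_span_add e1 e2)
    moreover have "inverse K * (of_nat (Suc (Suc m)) * ((of_nat (Suc m + n)) * ?al a + of_nat n * ?be a)
       + (- of_nat n) * ((of_nat (Suc (Suc m))) * ?be a + ?al a)) = ?al a" for a
    proof -
      have "of_nat (Suc (Suc m)) * ((of_nat (Suc m + n)) * x + of_nat n * y)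
       + (- of_nat n) * ((of_nat (Suc (Suc m))) * y + x) = K * x" for x y :: complex
        unfolding K_def by (simp add: algebra_simps)
      then show ?thesis using K by simp
    qed
    ultimately show ?thesis by simp
  qed
qed

definition nz3 :: "(nat \<Rightarrow> complex) \<Rightarrow> bool" where
  "nz3 u \<longleftrightarrow> u 0 \<noteq> 0 \<or> u 1 \<noteq> 0 \<or> u 2 \<noteq> 0"

lemma nz3_vdot_cnj: "nz3 u \<Longrightarrow> vdot u (\<lambda>i. cnj (u i)) \<noteq> 0"
proof -
  assume u: "nz3 u"
  have "vdot u (\<lambda>i. cnj (u i)) = of_real ((cmod (u 0))\<^sup>2 + (cmod (u 1))\<^sup>2 + (cmod (u 2))\<^sup>2)"
    by (simp only: vdot_def of_real_add complex_norm_square)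
  moreover have "(cmod (u 0))\<^sup>2 + (cmod (u 1))\<^sup>2 + (cmod (u 2))\<^sup>2 > 0"
    using u by (auto simp: nz3_def add_pos_nonneg add_nonneg_pos)
  ultimately show ?thesis by (metis of_real_eq_0_iff less_irrefl)
qed

text \<open>From \<open>u \<times> (z \<times> cnj u) = (u \<cdot> cnj u) z - (u \<cdot> z) cnj
  u\<close>. The conjugate enters because \<open>u \<cdot> u\<close> can vanish for a nonzero
  complex vector.\<close>

lemma orthogonal_imp_cross:
  assumes "nz3 u" and uz: "vdot u z = 0"
  obtains e where "\<And>i. i < 3 \<Longrightarrow> cross u e i = z i"
proof -
  define N where "N = vdot u (\<lambda>i. cnj (u i))"
  have N: "N \<noteq> 0" unfolding N_def by (rule nz3_vdot_cnj[OF assms(1)])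
  define e where "e = (\<lambda>i. inverse N * cross z (\<lambda>i. cnj (u i)) i)"
  have "cross u e i = z i" if "i < 3" for i
  proof -
    have "i = 0 \<or> i = 1 \<or> i = 2" using that by auto
    then have "cross u (cross z (\<lambda>i. cnj (u i))) i = N * z i - vdot u z * cnj (u i)"
      by (elim disjE) (simp_all add: N_def vdot_def algebra_simps)
    moreover have "N * cross u e i = cross u (cross z (\<lambda>i. cnj (u i))) i"
      using N cross_scale[of u "inverse N" "cross z (\<lambda>i. cnj (u i))" i] by (simp add: e_def)
    ultimately show ?thesis using N uz by simp
  qed
  then show ?thesis by (rule that)
qed

lemma exists_orthogonal: "\<exists>u. nz3 u \<and> vdot u z = 0"
proof (cases "z 0 = 0 \<and> z 1 = 0")
  case True
  then show ?thesis by (intro exI[of _ "\<lambda>i. if i = 0 then 1 else 0"]) (simp add: vdot_def nz3_def)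
next
  case False
  then show ?thesis
    by (intro exI[of _ "\<lambda>i. if i = 0 then z 1 else if i = 1 then - z 0 else 0"]) (auto simp: vdot_def nz3_def)
qed

text \<open>With \<open>z = u \<times> e\<close>, the vectors \<open>e \<times> v\<close>,
  \<open>v \<times> u\<close>, \<open>z\<close> are, up to the factor \<open>vdot v z\<close>, the
  dual basis of \<open>u\<close>, \<open>e\<close>, \<open>v\<close>; that factor is the determinant
  of the frame.\<close>

lemma cone_span_times_lin_nonzero:
  assumes "s \<noteq> t" and uz: "vdot u z = 0" and u: "nz3 u" and vz: "vdot v z \<noteq> 0"
  shows "cone_span s t (Suc m) n (\<lambda>a. lin s v a * (lin s u a ^ m * lin t z a ^ n))"
proof -
  obtain e where ue: "\<And>i. i < 3 \<Longrightarrow> cross u e i = z i" using orthogonal_imp_cross[OF u uz] by blast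
  have z: "z 0 = u 1 * e 2 - u 2 * e 1" "z (Suc 0) = u 2 * e 0 - u 0 * e 2" "z 2 = u 0 * e 1 - u 1 * e 0"
    using ue[of 0] ue[of "Suc 0"] ue[of 2] by simp_all
  show ?thesis
  proof (rule cone_span_times_lin_frame[where \<tau> = "vdot v z" and c = "cross e v" and e = e and w = "cross v u"])
    show "vdot v z * dot s t a = lin s u a * lin t (cross e v) a + lin s e a * lin t (cross v u) a
        + lin s v a * lin t z a" for a
      by (simp add: vdot_def dot_def z algebra_simps)
  qed (use assms in \<open>simp_all add: vdot_def z algebra_simps\<close>)
qed

text \<open>If \<open>vdot v z = 0\<close>, the curve \<open>(u + t v, z)\<close> stays on the cone
  and one derivative suffices; otherwise the frame argument applies once \<open>u\<close> is
  nonzero.\<close>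

lemma cone_span_times_lin:
  assumes "s \<noteq> t" and uz: "vdot u z = 0"
  shows "cone_span s t (Suc m) n (\<lambda>a. lin s v a * (lin s u a ^ m * lin t z a ^ n))"
proof (cases "vdot v z = 0")
  case True
  have "cone_span s t (Suc m) n (\<lambda>a. (of_nat (Suc m) * lin s u a ^ (Suc m - 1) * lin s v a * 1 ^ 0
     + of_nat 0 * lin s u a ^ (Suc m) * 1 ^ (0 - 1) * 0) * lin t z a ^ n)"
  proof (rule cone_span_curve_derivative)
    fix t'
    have "vdot (\<lambda>i. u i + t' * v i) z = 0"
      unfolding vdot_add_scale using uz True by simp
    from cone_span_base[OF this, of s t "Suc m" n]
    show "cone_span s t (Suc m) n (\<lambda>a. (lin s u a + t' * lin s v a) ^ Suc m * (1 + t' * 0) ^ 0 * lin t z a ^ n)"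
      by (simp add: vdot_add_scale)
  qed simp
  then have "cone_span s t (Suc m) n (\<lambda>a. inverse (of_nat (Suc m)) * ((of_nat (Suc m) * lin s u a ^ (Suc m - 1) * lin s v a * 1 ^ 0
     + of_nat 0 * lin s u a ^ (Suc m) * 1 ^ (0 - 1) * 0) * lin t z a ^ n))"
    by (rule cone_span_cmult)
  then show ?thesis by (rule cone_span_cong) (simp add: field_simps del: of_nat_Suc)
next
  case False
  show ?thesis
  proof (cases "nz3 u")
    case True
    then show ?thesis by (rule cone_span_times_lin_nonzero[OF assms _ False])
  next
    case u0: False
    then have lu: "lin s u a = 0" for a by (simp add: vdot_def nz3_def)
    show ?thesis
    \<comment> \<open>For \<open>u = 0\<close> the power \<open>lin s u a ^ m\<close> is 1 or 0. In
      the first case \<open>u\<close> can be replaced by any nonzero vector orthogonal to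
      \<open>z\<close>.\<close>
    proof (cases m)
      case 0
      obtain u' where "vdot u' z = 0" "nz3 u'" using exists_orthogonal by blast
      from cone_span_times_lin_nonzero[OF assms(1) this False, of 0 n] show ?thesis using 0 by simp
    next
      case (Suc k)
      then show ?thesis using cone_span_zero by (simp add: lu)
    qed
  qed
qed

lemma cone_span_times_var:
  assumes "cone_span s t m n f" "s \<noteq> t" "i < 3"
  shows "cone_span s t (Suc m) n (\<lambda>a. a s i * f a)"
  using assms(1)
proof (induction rule: cone_span.induct)
  case (cone_span_base u z m n)
  let ?e = "\<lambda>j. if j = i then 1 else 0 :: complex"
  have e: "lin s ?e a = a s i" for a
  proof -
    have "i = 0 \<or> i = 1 \<or> i = 2" using assms by auto
    then show ?thesis by (auto simp: vdot_def)
  qed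
  show ?case using cone_span_times_lin[OF assms(2) cone_span_base, of m n ?e] unfolding e .
next
  case (cone_span_add m n f g)
  then show ?case using cone_span.cone_span_add[of s t "Suc m" n] by (simp add: distrib_left)
next
  case (cone_span_cmult m n f c)
  then show ?case using cone_span.cone_span_cmult[of s t "Suc m" n _ c] by (simp add: mult.left_commute)
next
  case (cone_span_ideal m n h)
  have "multihom (bideg s t (Suc m) n) (\<lambda>a. a s i * h a)"
    by (rule multihom_cong[OF multihom_var_mult[OF cone_span_ideal assms(3), of s]]) (use assms in \<open>auto simp: bideg_def\<close>)
  from cone_span.cone_span_ideal[OF this] show ?case by (simp add: mult.left_commute)
qed

lemma cone_span_times_var':
  assumes "cone_span s t m n f" "s \<noteq> t" "i < 3"
  shows "cone_span s t m (Suc n) (\<lambda>a. a t i * f a)"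
  using cone_span_times_var[OF cone_span_sym[OF assms(1,2)], of i] cone_span_sym assms by metis

text \<open>Monomials are built from 1 by multiplication with variables, which preserves the span.
  Geometrically: the functions of a given bidegree on the incidence cone are spanned by the
  translates of a highest weight vector.\<close>

theorem multihom_imp_cone_span:
  assumes "multihom d f" "s \<noteq> t" "\<And>r. r \<noteq> s \<Longrightarrow> r \<noteq> t \<Longrightarrow> d r = 0"
  shows "cone_span s t (d s) (d t) f"
  using assms(1,3)
proof (induction rule: multihom.induct)
  case multihom_one
  show ?case using cone_span_base[of "\<lambda>_. 0" "\<lambda>_. 0" s t 0 0] by (simp add: vdot_zero)
next
  case (multihom_var_mult d f i r)
  have IH: "cone_span s t (d s) (d t) f"
    by (rule multihom_var_mult.IH) (use multihom_var_mult.prems in \<open>metis fun_upd_apply nat.distinct(1)\<close>)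
  consider "r = s" | "r = t" using multihom_var_mult.prems[of r] by fastforce
  then show ?case
  proof cases
    case 1 then show ?thesis using cone_span_times_var[OF IH assms(2), of i] multihom_var_mult assms(2) by simp
  next
    case 2 then show ?thesis using cone_span_times_var'[OF IH assms(2), of i] multihom_var_mult assms(2) by simp
  qed
qed (auto intro: cone_span.intros cone_span_zero)

section \<open>Standard monomials\<close>

type_synonym sidx = "(nat \<times> nat \<times> nat) + (nat \<times> nat \<times> nat)"

text \<open>
  The monomials \<open>smon m n q\<close> with \<open>q \<in> std m n\<close> are those of bidegree \<open>(m, n)\<close> not divisible by \<open>x0 y0\<close>;
  they form a basis modulo \<open>x\<cdot>y\<close>. The index set \<open>std'\<close> omits those which involve neither \<open>y0\<close> nor \<open>y1\<close>.\<close>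

definition stdA :: "nat \<Rightarrow> nat set \<Rightarrow> (nat \<times> nat \<times> nat) set" where
  "stdA m L = (SIGMA k:{..m}. {..m - k} \<times> L)"

definition stdB :: "nat \<Rightarrow> nat \<Rightarrow> (nat \<times> nat \<times> nat) set" where
  "stdB m n = (SIGMA k:{..<n}. {..m} \<times> {..n - Suc k})"

definition std :: "nat \<Rightarrow> nat \<Rightarrow> sidx set" where
  "std m n = stdA m {..n} <+> stdB m n"

definition std' :: "nat \<Rightarrow> nat \<Rightarrow> sidx set" where
  "std' m n = stdA m {1..n} <+> stdB m n"

fun smon :: "nat \<Rightarrow> nat \<Rightarrow> sidx \<Rightarrow> (nat \<Rightarrow> complex) \<Rightarrow> (nat \<Rightarrow> complex) \<Rightarrow> complex" where
  "smon m n (Inl (k, i, l)) x y = x 0 ^ k * x 1 ^ i * x 2 ^ (m - k - i) * (y 1 ^ l * y 2 ^ (n - l))"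
| "smon m n (Inr (k, i, l)) x y = x 1 ^ i * x 2 ^ (m - i) * (y 0 ^ Suc k * y 1 ^ l * y 2 ^ (n - Suc k - l))"

lemma finite_std [simp]: "finite (std m n)" "finite (std' m n)"
  by (simp_all add: std_def std'_def stdA_def stdB_def)

lemma sum_countdown: "2 * (\<Sum>k\<le>m. Suc (m - k)) = (m + 1) * (m + 2)"
proof -
  have "(\<Sum>k\<le>m. Suc (m - k)) = (\<Sum>k\<le>m. Suc k)"
    by (rule sum.reindex_bij_witness[of _ "\<lambda>k. m - k" "\<lambda>k. m - k"]) auto
  moreover have "2 * (\<Sum>k\<le>m. Suc k) = (m + 1) * (m + 2)" by (induction m) auto
  ultimately show ?thesis by simp
qed

lemma card_stdA:
  assumes "finite L"
  shows "2 * card (stdA m L) = (m + 1) * (m + 2) * card L"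
proof -
  have "card (stdA m L) = (\<Sum>k\<le>m. Suc (m - k) * card L)"
    unfolding stdA_def using assms by (subst card_SigmaI) (auto simp: card_cartesian_product)
  also have "\<dots> = (\<Sum>k\<le>m. Suc (m - k)) * card L" by (simp only: sum_distrib_right)
  finally have "2 * card (stdA m L) = (2 * (\<Sum>k\<le>m. Suc (m - k))) * card L" by (simp only: mult.assoc)
  then show ?thesis unfolding sum_countdown .
qed

lemma card_stdB: "2 * card (stdB m n) = (m + 1) * (n * (n + 1))"
proof (cases n)
  case (Suc r)
  have "card (stdB m n) = (\<Sum>k<n. Suc m * Suc (n - Suc k))"
    unfolding stdB_def by (subst card_SigmaI) (auto simp: card_cartesian_product)
  also have "\<dots> = Suc m * (\<Sum>k\<le>r. Suc (r - k))"
    unfolding Suc lessThan_Suc_atMost diff_Suc_Suc by (simp only: sum_distrib_left)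
  finally have "2 * card (stdB m n) = Suc m * (2 * (\<Sum>k\<le>r. Suc (r - k)))" by (simp only: mult.left_commute)
  then show ?thesis unfolding sum_countdown Suc by simp
qed (simp add: stdB_def)

text \<open>The same number as in \<open>schur_rep_dim\<close> for the partition (m + n, n). This
  equality lets \<open>kernel_spanning\<close> conclude by counting.\<close>

lemma card_std: "2 * card (std m n) = (m + 1) * (n + 1) * (m + n + 2)"
proof -
  have "2 * card (std m n) = 2 * card (stdA m {..n}) + 2 * card (stdB m n)"
    by (simp add: std_def card_Plus stdA_def stdB_def)
  then show ?thesis by (simp only: card_stdA card_stdB finite_atMost card_atMost) (simp add: algebra_simps)
qed

text \<open>For bidegree (b, a+1) this is twice the rank bound of a single derivation.\<close>

lemma card_std': "2 * card (std' m n) = (m + 1) * n * (m + n + 3)"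
proof -
  have "2 * card (std' m n) = 2 * card (stdA m {1..n}) + 2 * card (stdB m n)"
    by (simp add: std'_def card_Plus stdA_def stdB_def)
  then show ?thesis by (simp only: card_stdA card_stdB finite_atLeastAtMost card_atLeastAtMost) (simp add: algebra_simps)
qed

lemma sum_over_Sigma:
  "finite A \<Longrightarrow> (\<And>x. finite (B x)) \<Longrightarrow> sum F (Sigma A B) = (\<Sum>k\<in>A. \<Sum>p\<in>B k. F (k, p))"
  by (simp add: sum.Sigma split_def)

lemma polyfun_zero_infinite:
  fixes c :: "nat \<Rightarrow> complex"
  assumes "infinite S" "\<And>x. x \<in> S \<Longrightarrow> (\<Sum>i\<le>n. c i * x ^ i) = 0" "i \<le> n"
  shows "c i = 0"
proof (rule ccontr)
  assume "c i \<noteq> 0"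
  then have "finite {z. (\<Sum>i\<le>n. c i * z ^ i) = 0}"
    using polyfun_finite_roots[of c n] assms(3) by blast
  moreover have "S \<subseteq> {z. (\<Sum>i\<le>n. c i * z ^ i) = 0}" using assms(2) by auto
  ultimately show False using assms(1) finite_subset by blast
qed

lemma infinite_cofinite_complex: "finite F \<Longrightarrow> infinite (- F :: complex set)"
  by (simp add: Compl_eq_Diff_UNIV infinite_UNIV_char_0)

text \<open>The excluded curve is where \<open>std_independent\<close> cannot divide by
  \<open>x * y + 1\<close>; for fixed \<open>y\<close> it removes at most one value of
  \<open>x\<close>.\<close>

lemma bivariate_zero:
  fixes c :: "nat \<Rightarrow> nat \<Rightarrow> complex"
  assumes "\<And>x y. x * y \<noteq> -1 \<Longrightarrow> (\<Sum>i\<le>m. \<Sum>l\<le>n. c i l * x ^ i * y ^ l) = 0" "i \<le> m" "l \<le> n"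
  shows "c i l = 0"
proof -
  have "(\<Sum>l\<le>n. c i l * y ^ l) = 0" for y
  proof (rule polyfun_zero_infinite[where S = "- {- inverse y}" and c = "\<lambda>i. \<Sum>l\<le>n. c i l * y ^ l"])
    show "infinite (- {- inverse y})" by (rule infinite_cofinite_complex) simp
    fix x assume x: "x \<in> - {- inverse y}"
    have "x * y \<noteq> -1"
    proof
      assume *: "x * y = -1"
      then have "y \<noteq> 0" by auto
      with * have "x = - inverse y" by (simp add: field_simps)
      with x show False by simp
    qed
    from assms(1)[OF this] have "(\<Sum>i\<le>m. \<Sum>l\<le>n. c i l * x ^ i * y ^ l) = 0" .
    then show "(\<Sum>i\<le>m. (\<Sum>l\<le>n. c i l * y ^ l) * x ^ i) = 0"
      by (simp add: sum_distrib_left sum_distrib_right mult_ac)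
  qed (rule assms)
  then show ?thesis using polyfun_eq_0[of "c i" n] assms(3) by blast
qed

text \<open>On the points with x2 = y2 = 1, y0 = r and x0 = -(x1 y1 + 1)/r, multiplication by r^m
  turns the first family into terms in r^(m-k) and the second into terms in r^(m+k+1). No exponent
  is shared between different k or between the families, so each block of coefficients vanishes
  separately. The normalisation also keeps the test points nonzero in both vectors.\<close>

lemma std_independent:
  fixes c :: "sidx \<Rightarrow> complex"
  assumes "\<And>x y. vdot x y = 0 \<Longrightarrow> x 2 = 1 \<Longrightarrow> y 2 = 1 \<Longrightarrow> (\<Sum>q\<in>std m n. c q * smon m n q x y) = 0"
    and "q \<in> std m n"
  shows "c q = 0"
proof -
  define f where "f k x y = (- (x * y + 1)) ^ k * (\<Sum>i\<le>m - k. \<Sum>l\<le>n. c (Inl (k, i, l)) * x ^ i * y ^ l)" for k and x y :: complex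
  define g where "g k x y = (\<Sum>i\<le>m. \<Sum>l\<le>n - Suc k. c (Inr (k, i, l)) * x ^ i * y ^ l)" for k and x y :: complex
  define C where "C x y j = (if j \<le> m then f (m - j) x y else g (j - Suc m) x y)" for x y j
  have C0: "C x y j = 0" if "j \<le> m + n" for x y j
  proof (rule polyfun_zero_infinite[where S = "- {0}"])
    show "infinite (- {0 :: complex})" by (rule infinite_cofinite_complex) simp
    fix r :: complex assume r: "r \<in> - {0}"
    let ?x = "\<lambda>i. if i = 0 then - (x * y + 1) / r else if i = 1 then x else (1::complex)"
    let ?y = "\<lambda>i. if i = 0 then r else if i = 1 then y else (1::complex)"
    have a1: "(\<Sum>q\<in>std m n. c q * smon m n q ?x ?y) = 0"
      by (rule assms(1)) (use r in \<open>auto simp: vdot_def field_simps\<close>)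
    have a2: "(\<Sum>q\<in>std m n. c q * smon m n q ?x ?y)
        = (\<Sum>q\<in>stdA m {..n}. c (Inl q) * smon m n (Inl q) ?x ?y) + (\<Sum>q\<in>stdB m n. c (Inr q) * smon m n (Inr q) ?x ?y)"
      unfolding std_def by (subst sum.Plus) (simp_all add: stdA_def stdB_def)
    have a3: "r ^ m * (\<Sum>q\<in>stdA m {..n}. c (Inl q) * smon m n (Inl q) ?x ?y) = (\<Sum>k\<le>m. f k x y * r ^ (m - k))"
    proof -
      have "(\<Sum>q\<in>stdA m {..n}. c (Inl q) * smon m n (Inl q) ?x ?y)
         = (\<Sum>k\<le>m. \<Sum>i\<le>m - k. \<Sum>l\<le>n. c (Inl (k, i, l)) * ((- (x * y + 1) / r) ^ k * x ^ i * y ^ l))"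
        unfolding stdA_def by (subst sum_over_Sigma) (simp_all add: sum.cartesian_product')
      also have "\<dots> = (\<Sum>k\<le>m. f k x y / r ^ k)"
        unfolding f_def by (intro sum.cong refl) (simp add: sum_distrib_left sum_divide_distrib power_divide mult_ac)
      finally have "r ^ m * (\<Sum>q\<in>stdA m {..n}. c (Inl q) * smon m n (Inl q) ?x ?y) = (\<Sum>k\<le>m. r ^ m * (f k x y / r ^ k))"
        by (simp add: sum_distrib_left)
      also have "\<dots> = (\<Sum>k\<le>m. f k x y * r ^ (m - k))"
        by (intro sum.cong refl) (use r in \<open>simp add: power_diff\<close>)
      finally show ?thesis .
    qed
    have a4: "r ^ m * (\<Sum>q\<in>stdB m n. c (Inr q) * smon m n (Inr q) ?x ?y) = (\<Sum>k<n. g k x y * r ^ (m + Suc k))"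
    proof -
      have "(\<Sum>q\<in>stdB m n. c (Inr q) * smon m n (Inr q) ?x ?y)
         = (\<Sum>k<n. \<Sum>i\<le>m. \<Sum>l\<le>n - Suc k. c (Inr (k, i, l)) * (x ^ i * (r ^ Suc k * y ^ l)))"
        unfolding stdB_def by (subst sum_over_Sigma) (simp_all add: sum.cartesian_product')
      also have "\<dots> = (\<Sum>k<n. g k x y * r ^ Suc k)"
        unfolding g_def by (intro sum.cong refl) (simp add: sum_distrib_left sum_distrib_right mult_ac)
      finally show ?thesis by (simp add: sum_distrib_left power_add mult_ac)
    qed
    have a5: "(\<Sum>i\<le>m + n. C x y i * r ^ i) = (\<Sum>k\<le>m. f k x y * r ^ (m - k)) + (\<Sum>k<n. g k x y * r ^ (m + Suc k))"
    proof -
      have "{..m + n} = {..m} \<union> {m<..m + n}" by auto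
      then have "(\<Sum>i\<le>m + n. C x y i * r ^ i) = (\<Sum>i\<le>m. C x y i * r ^ i) + (\<Sum>i\<in>{m<..m + n}. C x y i * r ^ i)"
        by (simp only:) (rule sum.union_disjoint, auto)
      also have "(\<Sum>i\<le>m. C x y i * r ^ i) = (\<Sum>k\<le>m. f k x y * r ^ (m - k))"
        by (rule sum.reindex_bij_witness[of _ "\<lambda>k. m - k" "\<lambda>k. m - k"]) (auto simp: C_def)
      also have "(\<Sum>i\<in>{m<..m + n}. C x y i * r ^ i) = (\<Sum>k<n. g k x y * r ^ (m + Suc k))"
        by (rule sum.reindex_bij_witness[of _ "\<lambda>k. m + Suc k" "\<lambda>i. i - Suc m"]) (auto simp: C_def)
      finally show ?thesis .
    qed
    show "(\<Sum>i\<le>m + n. C x y i * r ^ i) = 0"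
      unfolding a5 a3[symmetric] a4[symmetric] distrib_left[symmetric] a2[symmetric] a1 by simp
  qed (rule that)
  have A: "c (Inl (k, i, l)) = 0" if "k \<le> m" "i \<le> m - k" "l \<le> n" for k i l
  proof (rule bivariate_zero[where c = "\<lambda>i l. c (Inl (k, i, l))"])
    fix x y :: complex assume xy: "x * y \<noteq> -1"
    have "f k x y = 0" using C0[of "m - k" x y] that by (simp add: C_def)
    moreover have "- (x * y + 1) \<noteq> 0" using xy by (metis add_eq_0_iff2 neg_equal_0_iff_equal)
    ultimately show "(\<Sum>i\<le>m - k. \<Sum>l\<le>n. c (Inl (k, i, l)) * x ^ i * y ^ l) = 0"
      by (simp add: f_def)
  qed (use that in auto)
  have B: "c (Inr (k, i, l)) = 0" if "k < n" "i \<le> m" "l \<le> n - Suc k" for k i l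
  proof (rule bivariate_zero[where c = "\<lambda>i l. c (Inr (k, i, l))"])
    fix x y :: complex
    show "(\<Sum>i\<le>m. \<Sum>l\<le>n - Suc k. c (Inr (k, i, l)) * x ^ i * y ^ l) = 0"
      using C0[of "m + Suc k" x y] that by (simp add: C_def g_def)
  qed (use that in auto)
  show ?thesis using assms(2) A B by (auto simp: std_def stdA_def stdB_def)
qed

lemma multihom_smon:
  assumes "q \<in> std m n" "s \<noteq> t"
  shows "multihom (bideg s t m n) (\<lambda>a. smon m n q (a s) (a t))"
proof -
  have s: "multihom (bideg s t k 0) (\<lambda>a. a s i ^ k)" if "i < 3" for i k
    by (rule multihom_cong[OF multihom_power[OF multihom_var[OF that]]]) (use assms in \<open>auto simp: bideg_def\<close>)
  have t: "multihom (bideg s t 0 k) (\<lambda>a. a t i ^ k)" if "i < 3" for i k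
    by (rule multihom_cong[OF multihom_power[OF multihom_var[OF that]]]) (use assms in \<open>auto simp: bideg_def\<close>)
  show ?thesis
  proof (cases q)
    case (Inl r)
    obtain k i l where r: "r = (k, i, l)" by (cases r)
    have d: "k \<le> m" "i \<le> m - k" "l \<le> n" using assms(1) by (auto simp: std_def stdA_def Inl r)
    have "multihom (bideg s t (k + 0 + (i + 0) + (m - k - i + 0) + 0) (0 + (0 + 0) + 0 + 0 + (l + (n - l))))
      (\<lambda>a. a s 0 ^ k * a s 1 ^ i * a s 2 ^ (m - k - i) * (a t 1 ^ l * a t 2 ^ (n - l)))"
      using bideg_mult[OF bideg_mult[OF bideg_mult[OF s[of 0 k] s[of 1 i]] s[of 2 "m - k - i"]]
         bideg_mult[OF t[of 1 l] t[of 2 "n - l"]]] by simp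
    then show ?thesis by (rule multihom_cong) (use d in \<open>auto simp: Inl r\<close>)
  next
    case (Inr r)
    obtain k i l where r: "r = (k, i, l)" by (cases r)
    have d: "k < n" "i \<le> m" "l \<le> n - Suc k" using assms(1) by (auto simp: std_def stdB_def Inr r)
    have "multihom (bideg s t (i + (m - i)) (Suc k + l + (n - Suc k - l)))
      (\<lambda>a. a s 1 ^ i * a s 2 ^ (m - i) * (a t 0 ^ Suc k * a t 1 ^ l * a t 2 ^ (n - Suc k - l)))"
      using bideg_mult[OF bideg_mult[OF s[of 1 i] s[of 2 "m - i"]]
         bideg_mult[OF bideg_mult[OF t[of 0 "Suc k"] t[of 1 l]] t[of 2 "n - Suc k - l"]]] by simp
    then show ?thesis by (rule multihom_cong) (use d in \<open>auto simp: Inr r\<close>)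
  qed
qed

text \<open>Standard monomials in adapted coordinates \<open>U\<close>, \<open>V\<close>. The ideal
  is taken with arbitrary polynomial multipliers because its elements are later evaluated on the
  cone only.\<close>

inductive std_span :: "(pt \<Rightarrow> nat \<Rightarrow> complex) \<Rightarrow> (pt \<Rightarrow> nat \<Rightarrow> complex) \<Rightarrow> blk \<Rightarrow> blk \<Rightarrow> nat \<Rightarrow> nat \<Rightarrow> (pt \<Rightarrow> complex) \<Rightarrow> bool"
  for U V s t m n where
  std_span_base: "q \<in> std m n \<Longrightarrow> std_span U V s t m n (\<lambda>a. smon m n q (U a) (V a))"
| std_span_add: "std_span U V s t m n f \<Longrightarrow> std_span U V s t m n g \<Longrightarrow> std_span U V s t m n (\<lambda>a. f a + g a)"
| std_span_cmult: "std_span U V s t m n f \<Longrightarrow> std_span U V s t m n (\<lambda>a. c * f a)"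
| std_span_ideal: "polyfun h \<Longrightarrow> std_span U V s t m n (\<lambda>a. dot s t a * h a)"

lemma std_span_cong: "std_span U V s t m n f \<Longrightarrow> (\<And>a. f a = g a) \<Longrightarrow> std_span U V s t m n g"
  by (metis ext)

text \<open>Straightening: modulo \<open>dot s t\<close>, a factor \<open>U a 0 * V a 0\<close>
  becomes \<open>- (U a 1 * V a 1 + U a 2 * V a 2)\<close>, which lowers the exponent of
  \<open>U a 0\<close>.\<close>

lemma std_span_monomial:
  assumes rel: "\<And>a. vdot (U a) (V a) = w * dot s t a"
    and polyfun: "\<And>j. polyfun (\<lambda>a. U a j)" "\<And>j. polyfun (\<lambda>a. V a j)"
  shows "std_span U V s t (b0 + b1 + b2) (c0 + c1 + c2)
     (\<lambda>a. U a 0 ^ b0 * U a 1 ^ b1 * U a 2 ^ b2 * (V a 0 ^ c0 * V a 1 ^ c1 * V a 2 ^ c2))"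
proof (induction b0 arbitrary: b1 b2 c0 c1 c2)
  case 0
  show ?case
  proof (cases c0)
    case c0: 0
    have "Inl (0, b1, c1) \<in> std (b1 + b2) (c1 + c2)" by (auto simp: std_def stdA_def)
    from std_span_base[OF this, of U V s t] show ?thesis by (simp add: c0)
  next
    case (Suc c)
    have "Inr (c, b1, c1) \<in> std (b1 + b2) (Suc c + c1 + c2)" by (auto simp: std_def stdB_def)
    from std_span_base[OF this, of U V s t] show ?thesis by (simp add: Suc)
  qed
next
  case (Suc b)
  show ?case
  proof (cases c0)
    case c0: 0
    have "Inl (Suc b, b1, c1) \<in> std (Suc b + b1 + b2) (c1 + c2)" by (auto simp: std_def stdA_def)
    from std_span_base[OF this, of U V s t] show ?thesis by (simp add: c0 del: power_Suc)
  next
    case c: (Suc c)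
    let ?h = "\<lambda>a. U a 0 ^ b * U a 1 ^ b1 * U a 2 ^ b2 * (V a 0 ^ c * V a 1 ^ c1 * V a 2 ^ c2)"
    have h: "std_span U V s t (Suc b + b1 + b2) (c0 + c1 + c2) (\<lambda>a. dot s t a * (w * ?h a))"
      by (intro std_span_ideal polyfun_mult polyfun_power polyfun polyfun_const)
    have 1: "std_span U V s t (Suc b + b1 + b2) (c0 + c1 + c2)
      (\<lambda>a. U a 0 ^ b * U a 1 ^ Suc b1 * U a 2 ^ b2 * (V a 0 ^ c * V a 1 ^ Suc c1 * V a 2 ^ c2))"
      using Suc[of "Suc b1" b2 c "Suc c1" c2] by (simp add: c)
    have 2: "std_span U V s t (Suc b + b1 + b2) (c0 + c1 + c2)
      (\<lambda>a. U a 0 ^ b * U a 1 ^ b1 * U a 2 ^ Suc b2 * (V a 0 ^ c * V a 1 ^ c1 * V a 2 ^ Suc c2))"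
      using Suc[of b1 "Suc b2" c c1 "Suc c2"] by (simp add: c)
    show ?thesis
    proof (rule std_span_cong[OF std_span_add[OF h std_span_cmult[OF std_span_add[OF 1 2], of "-1"]]])
      fix a
      have "dot s t a * (w * ?h a) = vdot (U a) (V a) * ?h a" by (simp add: rel)
      then show "dot s t a * (w * ?h a) + - 1 * (U a 0 ^ b * U a 1 ^ Suc b1 * U a 2 ^ b2 * (V a 0 ^ c * V a 1 ^ Suc c1 * V a 2 ^ c2)
         + U a 0 ^ b * U a 1 ^ b1 * U a 2 ^ Suc b2 * (V a 0 ^ c * V a 1 ^ c1 * V a 2 ^ Suc c2))
        = U a 0 ^ Suc b * U a 1 ^ b1 * U a 2 ^ b2 * (V a 0 ^ c0 * V a 1 ^ c1 * V a 2 ^ c2)"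
        by (simp add: vdot_def c algebra_simps)
    qed
  qed
qed

text \<open>The stage before straightening: a form in the original variables is first rewritten in
  the coordinates \<open>U\<close>, \<open>V\<close>, which differ from them by a linear
  change.\<close>

inductive monomial_span :: "(pt \<Rightarrow> nat \<Rightarrow> complex) \<Rightarrow> (pt \<Rightarrow> nat \<Rightarrow> complex) \<Rightarrow> nat \<Rightarrow> nat \<Rightarrow> (pt \<Rightarrow> complex) \<Rightarrow> bool"
  for U V where
  monomial_span_base: "monomial_span U V (b0 + b1 + b2) (c0 + c1 + c2)
     (\<lambda>a. U a 0 ^ b0 * U a 1 ^ b1 * U a 2 ^ b2 * (V a 0 ^ c0 * V a 1 ^ c1 * V a 2 ^ c2))"
| monomial_span_add: "monomial_span U V m n f \<Longrightarrow> monomial_span U V m n g \<Longrightarrow> monomial_span U V m n (\<lambda>a. f a + g a)"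
| monomial_span_cmult: "monomial_span U V m n f \<Longrightarrow> monomial_span U V m n (\<lambda>a. c * f a)"

lemma monomial_span_cong: "monomial_span U V m n f \<Longrightarrow> m = m' \<Longrightarrow> n = n' \<Longrightarrow> (\<And>a. f a = g a) \<Longrightarrow> monomial_span U V m' n' g"
  by (metis ext)

lemma monomial_span_times:
  assumes "monomial_span U V m n f"
  shows "monomial_span U V (Suc m) n (\<lambda>a. vdot l (U a) * f a)" "monomial_span U V m (Suc n) (\<lambda>a. vdot l (V a) * f a)"
proof -
  have "monomial_span U V (Suc m) n (\<lambda>a. vdot l (U a) * f a) \<and> monomial_span U V m (Suc n) (\<lambda>a. vdot l (V a) * f a)"
    using assms
  proof (induction rule: monomial_span.induct)
    case (monomial_span_base b0 b1 b2 c0 c1 c2)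
    show ?case
    proof
      let ?m = "Suc (b0 + b1 + b2)" and ?n = "c0 + c1 + c2"
      have 0: "monomial_span U V ?m ?n (\<lambda>a. U a 0 ^ Suc b0 * U a 1 ^ b1 * U a 2 ^ b2 * (V a 0 ^ c0 * V a 1 ^ c1 * V a 2 ^ c2))"
        by (rule monomial_span_cong[OF monomial_span.monomial_span_base[of U V "Suc b0" b1 b2 c0 c1 c2]]) auto
      have 1: "monomial_span U V ?m ?n (\<lambda>a. U a 0 ^ b0 * U a 1 ^ Suc b1 * U a 2 ^ b2 * (V a 0 ^ c0 * V a 1 ^ c1 * V a 2 ^ c2))"
        by (rule monomial_span_cong[OF monomial_span.monomial_span_base[of U V b0 "Suc b1" b2 c0 c1 c2]]) auto
      have 2: "monomial_span U V ?m ?n (\<lambda>a. U a 0 ^ b0 * U a 1 ^ b1 * U a 2 ^ Suc b2 * (V a 0 ^ c0 * V a 1 ^ c1 * V a 2 ^ c2))"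
        by (rule monomial_span_cong[OF monomial_span.monomial_span_base[of U V b0 b1 "Suc b2" c0 c1 c2]]) auto
      show "monomial_span U V ?m ?n
        (\<lambda>a. vdot l (U a) * (U a 0 ^ b0 * U a 1 ^ b1 * U a 2 ^ b2 * (V a 0 ^ c0 * V a 1 ^ c1 * V a 2 ^ c2)))"
        by (rule monomial_span_cong[OF monomial_span_add[OF monomial_span_add[OF monomial_span_cmult[OF 0, where c = "l 0"] monomial_span_cmult[OF 1, where c = "l 1"]]
            monomial_span_cmult[OF 2, where c = "l 2"]]]) (auto simp: vdot_def algebra_simps)
    next
      let ?m = "b0 + b1 + b2" and ?n = "Suc (c0 + c1 + c2)"
      have 0: "monomial_span U V ?m ?n (\<lambda>a. U a 0 ^ b0 * U a 1 ^ b1 * U a 2 ^ b2 * (V a 0 ^ Suc c0 * V a 1 ^ c1 * V a 2 ^ c2))"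
        by (rule monomial_span_cong[OF monomial_span.monomial_span_base[of U V b0 b1 b2 "Suc c0" c1 c2]]) auto
      have 1: "monomial_span U V ?m ?n (\<lambda>a. U a 0 ^ b0 * U a 1 ^ b1 * U a 2 ^ b2 * (V a 0 ^ c0 * V a 1 ^ Suc c1 * V a 2 ^ c2))"
        by (rule monomial_span_cong[OF monomial_span.monomial_span_base[of U V b0 b1 b2 c0 "Suc c1" c2]]) auto
      have 2: "monomial_span U V ?m ?n (\<lambda>a. U a 0 ^ b0 * U a 1 ^ b1 * U a 2 ^ b2 * (V a 0 ^ c0 * V a 1 ^ c1 * V a 2 ^ Suc c2))"
        by (rule monomial_span_cong[OF monomial_span.monomial_span_base[of U V b0 b1 b2 c0 c1 "Suc c2"]]) auto
      show "monomial_span U V ?m ?n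
        (\<lambda>a. vdot l (V a) * (U a 0 ^ b0 * U a 1 ^ b1 * U a 2 ^ b2 * (V a 0 ^ c0 * V a 1 ^ c1 * V a 2 ^ c2)))"
        by (rule monomial_span_cong[OF monomial_span_add[OF monomial_span_add[OF monomial_span_cmult[OF 0, where c = "l 0"] monomial_span_cmult[OF 1, where c = "l 1"]]
            monomial_span_cmult[OF 2, where c = "l 2"]]]) (auto simp: vdot_def algebra_simps)
    qed
  next
    case (monomial_span_add m n f g)
    then show ?case using monomial_span.monomial_span_add[of U V "Suc m" n] monomial_span.monomial_span_add[of U V m "Suc n"] by (simp add: distrib_left)
  next
    case (monomial_span_cmult m n f c)
    then show ?case using monomial_span.monomial_span_cmult[of U V "Suc m" n _ c] monomial_span.monomial_span_cmult[of U V m "Suc n" _ c]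
      by (simp add: mult.left_commute)
  qed
  then show "monomial_span U V (Suc m) n (\<lambda>a. vdot l (U a) * f a)" "monomial_span U V m (Suc n) (\<lambda>a. vdot l (V a) * f a)"
    by auto
qed

lemma multihom_imp_monomial_span:
  assumes "multihom d f" "s \<noteq> t" "\<And>r. r \<noteq> s \<Longrightarrow> r \<noteq> t \<Longrightarrow> d r = 0"
    and U: "\<And>i. i < 3 \<Longrightarrow> \<exists>l. \<forall>a. a s i = vdot l (U a)"
    and V: "\<And>i. i < 3 \<Longrightarrow> \<exists>l. \<forall>a. a t i = vdot l (V a)"
  shows "monomial_span U V (d s) (d t) f"
  using assms(1,3)
proof (induction rule: multihom.induct)
  case multihom_one
  show ?case using monomial_span_base[of U V 0 0 0 0 0 0] by simp
next
  case (multihom_var_mult d f i r)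
  have IH: "monomial_span U V (d s) (d t) f"
    by (rule multihom_var_mult.IH) (use multihom_var_mult.prems in \<open>metis fun_upd_apply nat.distinct(1)\<close>)
  consider "r = s" | "r = t" using multihom_var_mult.prems[of r] by fastforce
  then show ?case
  proof cases
    case 1
    obtain l where "\<forall>a. a s i = vdot l (U a)" using U multihom_var_mult by blast
    then show ?thesis using monomial_span_times(1)[OF IH, of l] assms(2) 1 by simp
  next
    case 2
    obtain l where "\<forall>a. a t i = vdot l (V a)" using V multihom_var_mult by blast
    then show ?thesis using monomial_span_times(2)[OF IH, of l] assms(2) 2 by simp
  qed
next
  case (multihom_zero d)
  have "monomial_span U V (d s) (d t) (\<lambda>a. U a 0 ^ d s * U a 1 ^ 0 * U a 2 ^ 0 * (V a 0 ^ d t * V a 1 ^ 0 * V a 2 ^ 0))"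
    using monomial_span_base[of U V "d s" 0 0 "d t" 0 0] by simp
  from monomial_span_cmult[OF this, of 0] show ?case by simp
qed (auto intro: monomial_span.intros)

lemma monomial_span_imp_std_span:
  assumes "monomial_span U V m n f"
    and rel: "\<And>a. vdot (U a) (V a) = w * dot s t a"
    and polyfun: "\<And>j. polyfun (\<lambda>a. U a j)" "\<And>j. polyfun (\<lambda>a. V a j)"
  shows "std_span U V s t m n f"
  using assms(1)
proof (induction rule: monomial_span.induct)
  case (monomial_span_base b0 b1 b2 c0 c1 c2)
  show ?case by (rule std_span_monomial[OF rel polyfun])
qed (auto intro: std_span.intros)

section \<open>The derivations of the flattening and their rank\<close>

definition Dp :: "(nat \<Rightarrow> complex) \<Rightarrow> (pt \<Rightarrow> complex) \<Rightarrow> pt \<Rightarrow> complex" where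
  "Dp c f a = vdot (cross c (a P)) (\<lambda>i. pd Q i f a)"

lemma Dp_add: "polyfun f \<Longrightarrow> polyfun g \<Longrightarrow> Dp c (\<lambda>a. f a + g a) a = Dp c f a + Dp c g a"
  by (simp add: Dp_def vdot_def algebra_simps)

lemma Dp_cmult: "polyfun f \<Longrightarrow> Dp c (\<lambda>a. k * f a) a = k * Dp c f a"
  by (simp add: Dp_def vdot_def algebra_simps)

lemma Dp_mult: "polyfun f \<Longrightarrow> polyfun g \<Longrightarrow> Dp c (\<lambda>a. f a * g a) a = Dp c f a * g a + f a * Dp c g a"
  by (simp add: Dp_def vdot_def algebra_simps)

lemma Dp_power_zero: "polyfun f \<Longrightarrow> (\<And>a. Dp c f a = 0) \<Longrightarrow> Dp c (\<lambda>a. f a ^ k) a = 0"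
proof (induction k)
  case 0 then show ?case by (simp add: Dp_def vdot_def)
next
  case (Suc k)
  have "Dp c (\<lambda>a. f a * f a ^ k) a = 0" using Suc by (simp add: Dp_mult)
  then show ?case by simp
qed

text \<open>The vector \<open>c \<times> p\<close> is orthogonal to \<open>p\<close>, so the
  derivation is tangent to the cone p\<cdot>q = 0 and is well defined on functions on it.\<close>

lemma Dp_ideal: "polyfun h \<Longrightarrow> dot P Q a = 0 \<Longrightarrow> Dp c (\<lambda>a. dot P Q a * h a) a = 0"
proof -
  assume h: "polyfun h" "dot P Q a = 0"
  have "Dp c (dot P Q) a = 0" by (simp add: Dp_def pd_dot vdot_def algebra_simps)
  then show ?thesis using h by (simp add: Dp_mult)
qed

text \<open>A standard monomial outside \<open>std'\<close> is a product of powers of coordinates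
  killed by the derivation, and multiples of \<open>dot P Q\<close> contribute nothing on the cone.
  The derivatives of the remaining standard monomials therefore span the image.\<close>

lemma Dp_std_span:
  assumes "std_span U V P Q m n f"
    and polyfun: "\<And>j. polyfun (\<lambda>a. U a j)" "\<And>j. polyfun (\<lambda>a. V a j)"
    and kill: "\<And>j a. Dp c (\<lambda>a. U a j) a = 0" "\<And>a. Dp c (\<lambda>a. V a 2) a = 0"
  shows "\<exists>k. \<forall>a. dot P Q a = 0 \<longrightarrow>
     Dp c f a = (\<Sum>q\<in>std' m n. k q * Dp c (\<lambda>a. smon m n q (U a) (V a)) a)"
proof -
  have pfs: "polyfun (\<lambda>a. smon m n q (U a) (V a))" for q
    by (cases q; clarify?; (case_tac a | case_tac b)?; auto intro!: polyfun_mult polyfun_power polyfun)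
  have pff: "std_span U V P Q m n f \<Longrightarrow> polyfun f" for f
    by (induction rule: std_span.induct) (auto simp: pfs)
  show ?thesis using assms(1)
  proof (induction rule: std_span.induct)
    case (std_span_base q)
    show ?case
    proof (cases "q \<in> std' m n")
      case True
      have "(\<Sum>r\<in>std' m n. (if r = q then 1 else 0) * Dp c (\<lambda>a. smon m n r (U a) (V a)) a)
        = (\<Sum>r\<in>std' m n. if r = q then Dp c (\<lambda>a. smon m n r (U a) (V a)) a else 0)" for a
        by (intro sum.cong) auto
      then show ?thesis using True by (intro exI[of _ "\<lambda>r. if r = q then 1 else 0"]) simp
    next
      case False
      then obtain k i where q: "q = Inl (k, i, 0)"
        using std_span_base by (force simp: std_def std'_def stdA_def)
      have "Dp c (\<lambda>a. smon m n q (U a) (V a)) a = 0" for a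
        unfolding q by (simp add: Dp_mult Dp_power_zero polyfun kill)
      then show ?thesis by (intro exI[of _ "\<lambda>_. 0"]) simp
    qed
  next
    case (std_span_add f g)
    then obtain k l where "\<forall>a. dot P Q a = 0 \<longrightarrow>
     Dp c f a = (\<Sum>q\<in>std' m n. k q * Dp c (\<lambda>a. smon m n q (U a) (V a)) a)"
     "\<forall>a. dot P Q a = 0 \<longrightarrow>
     Dp c g a = (\<Sum>q\<in>std' m n. l q * Dp c (\<lambda>a. smon m n q (U a) (V a)) a)" by auto
    then show ?case using std_span_add pff
      by (intro exI[of _ "\<lambda>q. k q + l q"]) (simp add: Dp_add distrib_right sum.distrib)
  next
    case (std_span_cmult f r)
    then obtain k where "\<forall>a. dot P Q a = 0 \<longrightarrow>
     Dp c f a = (\<Sum>q\<in>std' m n. k q * Dp c (\<lambda>a. smon m n q (U a) (V a)) a)" by auto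
    then show ?case using std_span_cmult pff
      by (intro exI[of _ "\<lambda>q. r * k q"]) (simp add: Dp_cmult sum_distrib_left mult.assoc)
  next
    case (std_span_ideal h)
    then show ?case by (intro exI[of _ "\<lambda>_. 0"]) (simp add: Dp_ideal)
  qed
qed

text \<open>
  In coordinates \<open>U\<close>, \<open>V\<close> adapted to \<open>c\<close>, the derivation \<open>Dp c\<close> kills all \<open>U\<close> and \<open>V 2 = c\<cdot>q\<close>, hence
  the standard monomials indexed by \<open>std - std'\<close>.\<close>

theorem Dp_span:
  "\<exists>\<psi> :: sidx \<Rightarrow> pt \<Rightarrow> complex. \<forall>f. multihom (deg4 0 m 0 n) f \<longrightarrow>
     (\<exists>k. \<forall>a. dot P Q a = 0 \<longrightarrow> Dp c f a = (\<Sum>q\<in>std' m n. k q * \<psi> q a))"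
proof (cases "c 0 = 0 \<and> c 1 = 0 \<and> c 2 = 0")
  case True
  then have "Dp c f a = 0" for f a by (simp add: Dp_def vdot_def)
  then show ?thesis by (intro exI[of _ "\<lambda>_ _. 0"]) simp
next
  case False
  \<comment> \<open>A cyclic relabelling that puts a nonzero entry of \<open>c\<close> in the last
    place, so that \<open>a Q k\<close> can be recovered from \<open>lin Q c a\<close>.\<close>
  then have "\<exists>i j k. (i, j, k) \<in> {(0, 1, 2 :: nat), (1, 2, 0), (2, 0, 1)} \<and> c k \<noteq> 0" by auto
  then obtain i j k :: nat where ijk: "(i, j, k) \<in> {(0, 1, 2 :: nat), (1, 2, 0), (2, 0, 1)}" and ck: "c k \<noteq> 0" by blast
  \<comment> \<open>\<open>U\<close> is chosen to go with the third coordinate c\<cdot>q of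
    \<open>V\<close>, so that \<open>vdot (U a) (V a) = c k * dot P Q a\<close> and the equation of
    the cone keeps its form.\<close>
  define U where "U a r = (if r = 0 then c k * a P i - c i * a P k
      else if r = 1 then c k * a P j - c j * a P k else a P k)" for a :: pt and r :: nat
  define V where "V a r = (if r = 0 then a Q i else if r = 1 then a Q j else lin Q c a)" for a :: pt and r :: nat
  have U3: "U a 0 = c k * a P i - c i * a P k" "U a 1 = c k * a P j - c j * a P k" "U a (Suc 0) = c k * a P j - c j * a P k" "U a 2 = a P k"
    and V3: "V a 0 = a Q i" "V a 1 = a Q j" "V a (Suc 0) = a Q j" "V a 2 = lin Q c a" for a
    by (simp_all add: U_def V_def)
  have rel: "vdot (U a) (V a) = c k * dot P Q a" for a
    using ijk by (auto simp: vdot_def U_def V_def dot_def algebra_simps)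
  have pfU: "polyfun (\<lambda>a. U a r)" for r unfolding U_def by (cases "r = 0"; cases "r = 1") auto
  have pfV: "polyfun (\<lambda>a. V a r)" for r unfolding V_def by (cases "r = 0"; cases "r = 1") auto
  have killU: "Dp c (\<lambda>a. U a r) a = 0" for r a
    unfolding U_def by (cases "r = 0"; cases "r = 1") (simp_all add: Dp_def vdot_def)
  have killV: "Dp c (\<lambda>a. V a 2) a = 0" for a
    by (simp add: V3 Dp_def vdot_def algebra_simps)
  have exU: "\<exists>l. \<forall>a. a P r = vdot l (U a)" if "r < 3" for r
  proof -
    have "r = i \<or> r = j \<or> r = k" using ijk that by auto
    then show ?thesis
    proof (elim disjE)
      assume "r = i" then show ?thesis using ck
        by (intro exI[of _ "\<lambda>x. if x = 0 then inverse (c k) else if x = 1 then 0 else inverse (c k) * c i"])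
          (simp add: vdot_def U3 field_simps)
    next
      assume "r = j" then show ?thesis using ck
        by (intro exI[of _ "\<lambda>x. if x = 0 then 0 else if x = 1 then inverse (c k) else inverse (c k) * c j"])
          (simp add: vdot_def U3 field_simps)
    next
      assume "r = k" then show ?thesis
        by (intro exI[of _ "\<lambda>x. if x = 0 then 0 else if x = 1 then 0 else 1"])
          (simp add: vdot_def U3)
    qed
  qed
  have exV: "\<exists>l. \<forall>a. a Q r = vdot l (V a)" if "r < 3" for r
  proof -
    have "r = i \<or> r = j \<or> r = k" using ijk that by auto
    then show ?thesis
    proof (elim disjE)
      assume "r = i" then show ?thesis
        by (intro exI[of _ "\<lambda>x. if x = 0 then 1 else 0"]) (simp add: vdot_def V3)
    next
      assume "r = j" then show ?thesis
        by (intro exI[of _ "\<lambda>x. if x = 1 then 1 else 0"]) (simp add: vdot_def V3)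
    next
      assume r: "r = k"
      have "lin Q c a = c i * a Q i + c j * a Q j + c k * a Q k" for a
        using ijk by (auto simp: vdot_def)
      then show ?thesis using ck r
        by (intro exI[of _ "\<lambda>x. if x = 0 then - c i / c k else if x = 1 then - c j / c k else 1 / c k"])
          (simp add: vdot_def[of _ "V _"] V3 field_simps)
    qed
  qed
  show ?thesis
  proof (intro exI[of _ "\<lambda>q. Dp c (\<lambda>a. smon m n q (U a) (V a))"] allI impI)
    fix f assume f: "multihom (deg4 0 m 0 n) f"
    have "deg4 0 m 0 n r = 0" if "r \<noteq> P" "r \<noteq> Q" for r using that by (cases r) auto
    from multihom_imp_monomial_span[OF f _ this exU exV] have "monomial_span U V m n f" by simp
    from Dp_std_span[OF monomial_span_imp_std_span[OF this rel pfU pfV] pfU pfV killU killV]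
    show "\<exists>k. \<forall>a. dot P Q a = 0 \<longrightarrow>
      Dp c f a = (\<Sum>q\<in>std' m n. k q * Dp c (\<lambda>a. smon m n q (U a) (V a)) a)" .
  qed
qed

section \<open>Highest weight vectors of polynomial representations\<close>

text \<open>The trace of an idempotent is its rank: for a maximal independent set \<open>I\<close>
  of columns and dual weights on the rows, the trace evaluates to \<open>card I\<close>.\<close>

lemma idempotent_trace:
  fixes C :: "nat \<Rightarrow> nat \<Rightarrow> complex"
  assumes idem: "\<And>i j. i < n \<Longrightarrow> j < n \<Longrightarrow> (\<Sum>k<n. C i k * C k j) = C i j"
    and tr: "(\<Sum>i<n. C i i) = 0" and "i < n" "j < n"
  shows "C i j = 0"
proof -
  define ind where "ind I \<longleftrightarrow> I \<subseteq> {..<n} \<and>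
    (\<forall>\<alpha>. (\<forall>p\<in>{..<n}. (\<Sum>k\<in>I. \<alpha> k * C p k) = 0) \<longrightarrow> (\<forall>k\<in>I. \<alpha> k = 0))" for I
  have "ind {}" by (simp add: ind_def)
  moreover have "\<forall>I. ind I \<longrightarrow> card I < Suc n"
    using card_mono[of "{..<n}"] by (simp add: ind_def less_Suc_eq_le)
  ultimately obtain I where I: "ind I" and max: "\<And>I'. ind I' \<Longrightarrow> card I' \<le> card I"
    using ex_has_greatest_nat[of ind "{}" card "Suc n"] by blast
  have finI: "finite I" and In: "I \<subseteq> {..<n}" using I finite_subset by (auto simp: ind_def)
  have indI: "\<And>\<alpha>. \<forall>p\<in>{..<n}. (\<Sum>k\<in>I. \<alpha> k * C p k) = 0 \<Longrightarrow> \<forall>k\<in>I. \<alpha> k = 0"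
    using I by (simp add: ind_def)
  obtain A w where A: "finite A" "A \<subseteq> {..<n}"
    and w: "\<forall>m\<in>I. \<forall>k\<in>I. (\<Sum>p\<in>A. w m p * C p k) = (if m = k then 1 else 0)"
    using dual_evaluations[where S = "{..<n}" and F = "\<lambda>k p. C p k", OF finI indI] by auto
  define y where "y k j = (\<Sum>p\<in>A. w k p * C p j)" for k j
  have span: "C p j = (\<Sum>k\<in>I. y k j * C p k)" if jn: "j < n" and pn: "p < n" for j p
  proof -
    have "\<exists>\<beta>. \<forall>p<n. C p j = (\<Sum>k\<in>I. \<beta> k * C p k)"
    proof (cases "j \<in> I")
      case True
      have "(\<Sum>k\<in>I. (if k = j then 1 else 0) * C p k) = (\<Sum>k\<in>I. if k = j then C p k else 0)" for p
        by (intro sum.cong) auto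
      then show ?thesis using True finI by (intro exI[of _ "\<lambda>k. if k = j then 1 else 0"]) simp
    next
      case False
      have "\<not> ind (insert j I)" using max[of "insert j I"] False finI by auto
      then obtain \<alpha> where \<alpha>: "\<forall>p\<in>{..<n}. (\<Sum>k\<in>insert j I. \<alpha> k * C p k) = 0" "\<exists>k\<in>insert j I. \<alpha> k \<noteq> 0"
        using In jn by (auto simp: ind_def simp del: sum.insert)
      have \<alpha>': "\<alpha> j * C p j + (\<Sum>k\<in>I. \<alpha> k * C p k) = 0" if "p < n" for p
        using \<alpha>(1) that False finI by auto
      have "\<alpha> j \<noteq> 0"
      proof
        assume "\<alpha> j = 0"
        then have "\<forall>k\<in>I. \<alpha> k = 0" using \<alpha>' by (intro indI) auto
        then show False using \<alpha>(2) \<open>\<alpha> j = 0\<close> by auto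
      qed
      then have "C p j = (\<Sum>k\<in>I. (- \<alpha> k / \<alpha> j) * C p k)" if "p < n" for p
      proof -
        have "(\<Sum>k\<in>I. (- \<alpha> k / \<alpha> j) * C p k) = - (\<Sum>k\<in>I. \<alpha> k * C p k) / \<alpha> j"
          by (simp add: sum_divide_distrib sum_negf)
        also have "- (\<Sum>k\<in>I. \<alpha> k * C p k) = \<alpha> j * C p j"
          using \<alpha>'[OF that] by (simp add: add_eq_0_iff2)
        finally show ?thesis using \<open>\<alpha> j \<noteq> 0\<close> by simp
      qed
      then show ?thesis by (intro exI[of _ "\<lambda>k. - \<alpha> k / \<alpha> j"]) blast
    qed
    then obtain \<beta> where \<beta>: "\<forall>p<n. C p j = (\<Sum>k\<in>I. \<beta> k * C p k)" by blast
    have "y m j = \<beta> m" if "m \<in> I" for m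
    proof -
      have "y m j = (\<Sum>p\<in>A. w m p * (\<Sum>k\<in>I. \<beta> k * C p k))"
        unfolding y_def using A(2) \<beta> by (intro sum.cong) auto
      also have "\<dots> = (\<Sum>k\<in>I. \<beta> k * (\<Sum>p\<in>A. w m p * C p k))"
        by (simp add: sum_distrib_left mult_ac) (rule sum.swap)
      also have "\<dots> = (\<Sum>k\<in>I. if m = k then \<beta> k else 0)"
        using w that by (intro sum.cong) auto
      finally show ?thesis using that finI by simp
    qed
    then show ?thesis using \<beta> pn by simp
  qed
  have "(\<Sum>i<n. C i i) = (\<Sum>i<n. \<Sum>k\<in>I. y k i * C i k)"
    by (intro sum.cong refl span) auto
  also have "\<dots> = (\<Sum>k\<in>I. \<Sum>i<n. \<Sum>p\<in>A. w k p * (C p i * C i k))"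
    by (subst sum.swap) (simp add: y_def sum_distrib_right sum_distrib_left mult_ac)
  also have "\<dots> = (\<Sum>k\<in>I. \<Sum>p\<in>A. w k p * (\<Sum>i<n. C p i * C i k))"
  proof (rule sum.cong[OF refl])
    fix k
    show "(\<Sum>i<n. \<Sum>p\<in>A. w k p * (C p i * C i k)) = (\<Sum>p\<in>A. w k p * (\<Sum>i<n. C p i * C i k))"
      by (subst sum.swap) (simp add: sum_distrib_left)
  qed
  also have "\<dots> = (\<Sum>k\<in>I. \<Sum>p\<in>A. w k p * C p k)"
  proof (intro sum.cong refl)
    fix k p assume "k \<in> I" "p \<in> A"
    then show "w k p * (\<Sum>i<n. C p i * C i k) = w k p * C p k"
      using idem[of p k] A(2) In by (simp add: subset_iff)
  qed
  also have "\<dots> = of_nat (card I)" using w by simp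
  finally have "I = {}" using tr finI by simp
  then show ?thesis using span[of j i] assms by simp
qed

text \<open>Division by \<open>s ^ kmax\<close> shows that \<open>Q\<close> is a polynomial in
  \<open>1/s\<close>. A finite limit at 0 keeps it bounded for large \<open>1/s\<close>, which
  forces it to be constant.\<close>

lemma polynomial_limit_at_zero:
  fixes a :: "'k \<Rightarrow> complex" and Q :: "complex \<Rightarrow> complex"
  assumes "finite K" and deg: "\<And>x. x \<in> K \<Longrightarrow> a x \<noteq> 0 \<Longrightarrow> k x \<le> kmax"
    and eq: "\<And>s. s \<noteq> 0 \<Longrightarrow> (\<Sum>x\<in>K. s ^ k x * a x) = s ^ kmax * Q s"
    and lim: "(Q \<longlongrightarrow> q) (at 0)"
  shows "Q 1 = q"
proof -
  define p where "p = (\<Sum>x\<in>K. monom (a x) (kmax - k x))"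
  have Qp: "Q s = poly p (inverse s)" if "s \<noteq> 0" for s
  proof -
    have "s ^ kmax * poly p (inverse s) = (\<Sum>x\<in>K. s ^ kmax * (a x * inverse s ^ (kmax - k x)))"
      by (simp add: p_def poly_sum poly_monom sum_distrib_left)
    also have "\<dots> = (\<Sum>x\<in>K. s ^ k x * a x)"
    proof (rule sum.cong[OF refl])
      fix x assume "x \<in> K"
      show "s ^ kmax * (a x * inverse s ^ (kmax - k x)) = s ^ k x * a x"
      proof (cases "a x = 0")
        case False
        then have "k x \<le> kmax" using deg \<open>x \<in> K\<close> by blast
        then have 1: "s ^ kmax = s ^ k x * s ^ (kmax - k x)" by (simp flip: power_add)
        have 2: "s ^ (kmax - k x) * inverse s ^ (kmax - k x) = 1"
          using that by (simp flip: power_mult_distrib)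
        have "s ^ kmax * (a x * inverse s ^ (kmax - k x)) = s ^ k x * a x * (s ^ (kmax - k x) * inverse s ^ (kmax - k x))"
          unfolding 1 by (simp only: mult_ac)
        then show ?thesis unfolding 2 by simp
      qed simp
    qed
    finally have "s ^ kmax * poly p (inverse s) = s ^ kmax * Q s" unfolding eq[OF that] .
    then show ?thesis using that by simp
  qed
  obtain c r where cr: "p = pCons c r" by (cases p)
  have "r = 0"
  proof (rule ccontr)
    assume "r \<noteq> 0"
    then obtain B where B: "\<And>z. B \<le> cmod z \<Longrightarrow> cmod q + 1 \<le> cmod (poly p z)"
      using poly_infinity[of r "cmod q + 1" c] cr by blast
    have "\<forall>\<^sub>F s in at 0. dist (Q s) q < 1" using lim by (rule tendstoD) simp
    moreover have "\<forall>\<^sub>F s in at (0::complex). norm s < inverse (\<bar>B\<bar> + 1) \<and> s \<noteq> 0"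
    proof -
      have "0 < inverse (\<bar>B\<bar> + 1)" by simp
      then show ?thesis unfolding eventually_at by (intro exI[of _ "inverse (\<bar>B\<bar> + 1)"]) (simp add: dist_norm)
    qed
    ultimately have "\<forall>\<^sub>F s in at (0::complex). False"
    proof eventually_elim
      case (elim s)
      have "B \<le> cmod (inverse s)"
      proof -
        have "\<bar>B\<bar> + 1 < inverse (cmod s)"
          using elim less_imp_inverse_less[of "cmod s" "inverse (\<bar>B\<bar> + 1)"] by simp
        then show ?thesis by (simp add: norm_inverse)
      qed
      then have "cmod q + 1 \<le> cmod (Q s)" using B Qp elim by simp
      moreover have "cmod (Q s) < cmod q + 1"
        using elim norm_triangle_ineq2[of "Q s" q] by (simp add: dist_norm)
      ultimately show False by simp
    qed
    then show False by simp
  qed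
  then have Q1: "Q s = Q 1" if "s \<noteq> 0" for s using Qp[of s] Qp[of 1] that cr by simp
  have "\<forall>\<^sub>F s in at (0::complex). s \<noteq> 0" by (simp add: eventually_at_filter)
  then have "\<forall>\<^sub>F s in at 0. Q s = Q 1" by (rule eventually_mono) (rule Q1)
  then have "(Q \<longlongrightarrow> Q 1) (at 0)" by (rule tendsto_eventually)
  then show ?thesis using lim tendsto_unique[OF at_neq_bot] by blast
qed

section \<open>Explicit 3 by 3 matrices\<close>

lemma lt3: "{..<3} = {0, 1, 2 :: nat}" by auto

lemma sum_lt3: "sum f {..<3} = f 0 + f 1 + f (2 :: nat)" for f :: "nat \<Rightarrow> 'a :: comm_monoid_add"
  by (simp add: lt3 add.assoc)

lemma less3_cases: "i < (3::nat) \<Longrightarrow> i = 0 \<or> i = 1 \<or> i = 2" by auto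

lemma det_2:
  assumes A: "A \<in> carrier_mat 2 2"
  shows "det A = A $$ (0,0) * A $$ (1,1) - A $$ (0,1) * (A $$ (1,0) :: complex)"
proof -
  have 1: "det (mat_delete A 0 0) = A $$ (1,1)" "det (mat_delete A 0 1) = A $$ (1,0)"
    using A by (subst det_single, simp_all add: mat_delete_def)+
  have "{..<2} = {0, 1 :: nat}" by auto
  then show ?thesis
    using laplace_expansion_row[OF A, of 0] 1 by (simp add: cofactor_def)
qed

lemma det_3:
  assumes A: "A \<in> carrier_mat 3 3"
  shows "det A = A $$ (0,0) * (A $$ (1,1) * A $$ (2,2) - A $$ (1,2) * A $$ (2,1))
     - A $$ (0,1) * (A $$ (1,0) * A $$ (2,2) - A $$ (1,2) * A $$ (2,0))
     + A $$ (0,2) * (A $$ (1,0) * A $$ (2,1) - A $$ (1,1) * (A $$ (2,0) :: complex))"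
proof -
  have d: "det (mat_delete A 0 0) = A $$ (1,1) * A $$ (2,2) - A $$ (1,2) * A $$ (2,1)"
    "det (mat_delete A 0 1) = A $$ (1,0) * A $$ (2,2) - A $$ (1,2) * A $$ (2,0)"
    "det (mat_delete A 0 2) = A $$ (1,0) * A $$ (2,1) - A $$ (1,1) * A $$ (2,0)"
    using A by (subst det_2, simp_all add: mat_delete_def numeral_2_eq_2)+
  show ?thesis
    using laplace_expansion_row[OF A, of 0] d by (simp add: sum_lt3 cofactor_def)
qed

definition m3 :: "(nat \<Rightarrow> nat \<Rightarrow> complex) \<Rightarrow> complex mat" where
  "m3 f = mat 3 3 (\<lambda>(i, j). f i j)"

lemma m3_carrier [simp]: "m3 f \<in> carrier_mat 3 3" by (simp add: m3_def)

lemma m3_index [simp]: "i < 3 \<Longrightarrow> j < 3 \<Longrightarrow> m3 f $$ (i, j) = f i j" by (simp add: m3_def)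

lemma m3_eqI: "A \<in> carrier_mat 3 3 \<Longrightarrow> (\<And>i j. i < 3 \<Longrightarrow> j < 3 \<Longrightarrow> A $$ (i, j) = f i j) \<Longrightarrow> A = m3 f"
  by (intro eq_matI) (auto simp: m3_def)

lemma m3_eta: "A \<in> carrier_mat 3 3 \<Longrightarrow> A = m3 (\<lambda>i j. A $$ (i, j))"
  by (intro m3_eqI) auto

lemma mult_index3:
  assumes "A \<in> carrier_mat 3 3" "B \<in> carrier_mat 3 3" "i < 3" "j < 3"
  shows "(A * B) $$ (i, j) = A $$ (i,0) * B $$ (0,j) + A $$ (i,1) * B $$ (1,j) + A $$ (i,2) * (B $$ (2,j) :: complex)"
proof -
  have "(A * B) $$ (i, j) = (\<Sum>k<3. A $$ (i,k) * B $$ (k,j))"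
    using assms by (simp add: scalar_prod_def atLeast0LessThan)
  then show ?thesis by (simp add: sum_lt3)
qed

lemma m3_mult: "m3 f * m3 g = m3 (\<lambda>i j. f i 0 * g 0 j + f i 1 * g 1 j + f i 2 * g 2 j)"
proof (rule m3_eqI)
  show "m3 f * m3 g \<in> carrier_mat 3 3" by (rule mult_carrier_mat[of _ 3 3]) simp_all
  fix i j :: nat assume "i < 3" "j < 3"
  then show "(m3 f * m3 g) $$ (i, j) = f i 0 * g 0 j + f i 1 * g 1 j + f i 2 * g 2 j"
    by (subst mult_index3) simp_all
qed

lemma det_m3: "det (m3 f) = f 0 0 * (f 1 1 * f 2 2 - f 1 2 * f 2 1)
     - f 0 1 * (f 1 0 * f 2 2 - f 1 2 * f 2 0) + f 0 2 * (f 1 0 * f 2 1 - f 1 1 * f 2 0)"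
  by (subst det_3) simp_all

lemma m3_cong: "(\<And>i j. i < 3 \<Longrightarrow> j < 3 \<Longrightarrow> f i j = g i j) \<Longrightarrow> m3 f = m3 g"
  by (intro m3_eqI) auto

lemma GL3_mult: "g \<in> GL3 \<Longrightarrow> h \<in> GL3 \<Longrightarrow> g * h \<in> GL3"
  by (auto simp: GL3_def det_mult)

lemma GL3_carrier: "g \<in> GL3 \<Longrightarrow> g \<in> carrier_mat 3 3" by (simp add: GL3_def)

lemma diag3_m3: "diag3 [x, y, z] = m3 (\<lambda>i j. if i = j then [x, y, z] ! i else 0)"
  by (simp add: diag3_def m3_def)

lemma diag3_GL3: "x \<noteq> 0 \<Longrightarrow> y \<noteq> 0 \<Longrightarrow> z \<noteq> 0 \<Longrightarrow> diag3 [x, y, z] \<in> GL3"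
  by (simp add: GL3_def diag3_m3 det_m3)

lemma diag3_mult: "diag3 [x, y, z] * diag3 [x', y', z'] = diag3 [x * x', y * y', z * z']"
  unfolding diag3_m3 m3_mult by (rule m3_cong, drule less3_cases, drule less3_cases, elim disjE) simp_all

lemma one_m3: "1\<^sub>m 3 = m3 (\<lambda>i j. if i = j then 1 else 0)"
  by (rule m3_eqI) auto

lemma one_diag3: "1\<^sub>m 3 = diag3 [1, 1, 1]"
  unfolding one_m3 diag3_m3 by (rule m3_cong, drule less3_cases, drule less3_cases, elim disjE) simp_all

section \<open>Characters of the torus and continuity of polynomial functions\<close>

definition cube :: "nat \<Rightarrow> (nat \<times> nat \<times> nat) set" where
  "cube B = {..B} \<times> {..B} \<times> {..B}"

fun mono3 :: "nat \<times> nat \<times> nat \<Rightarrow> complex \<Rightarrow> complex \<Rightarrow> complex \<Rightarrow> complex" where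
  "mono3 (i, j, k) x y z = x ^ i * y ^ j * z ^ k"

lemma finite_cube [simp]: "finite (cube B)" by (simp add: cube_def)

lemma mono3_mult: "mono3 \<kappa> (x * x') (y * y') (z * z') = mono3 \<kappa> x y z * mono3 \<kappa> x' y' z'"
  by (cases \<kappa>) (simp add: power_mult_distrib mult_ac)

lemma mono3_zero:
  assumes "\<And>x y z. x \<noteq> 0 \<Longrightarrow> y \<noteq> 0 \<Longrightarrow> z \<noteq> 0 \<Longrightarrow> (\<Sum>\<kappa>\<in>cube B. d \<kappa> * mono3 \<kappa> x y z) = 0" "\<kappa> \<in> cube B"
  shows "d \<kappa> = 0"
proof -
  have inf: "infinite (- {0 :: complex})" by (rule infinite_cofinite_complex) simp
  have e: "(\<Sum>\<kappa>\<in>cube B. d \<kappa> * mono3 \<kappa> x y z) = (\<Sum>i\<le>B. (\<Sum>j\<le>B. (\<Sum>k\<le>B. d (i, j, k) * z ^ k) * y ^ j) * x ^ i)" for x y z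
    unfolding cube_def sum.cartesian_product' by (simp add: sum_distrib_right sum_distrib_left mult_ac)
  obtain i j k where \<kappa>: "\<kappa> = (i, j, k)" by (cases \<kappa>)
  have ijk: "i \<le> B" "j \<le> B" "k \<le> B" using assms(2) by (auto simp: \<kappa> cube_def)
  have 1: "(\<Sum>j\<le>B. (\<Sum>k\<le>B. d (i, j, k) * z ^ k) * y ^ j) = 0" if "y \<noteq> 0" "z \<noteq> 0" for y z
    by (rule polyfun_zero_infinite[OF inf _ ijk(1), where c = "\<lambda>i. \<Sum>j\<le>B. (\<Sum>k\<le>B. d (i, j, k) * z ^ k) * y ^ j"])
      (use assms(1) that e in auto)
  have 2: "(\<Sum>k\<le>B. d (i, j, k) * z ^ k) = 0" if "z \<noteq> 0" for z
    by (rule polyfun_zero_infinite[OF inf _ ijk(2), where c = "\<lambda>j. \<Sum>k\<le>B. d (i, j, k) * z ^ k"])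
      (use 1 that in auto)
  show ?thesis unfolding \<kappa>
    by (rule polyfun_zero_infinite[OF inf _ ijk(3), where c = "\<lambda>k. d (i, j, k)"]) (use 2 in auto)
qed

lemma poly_fun3_diag:
  assumes "poly_fun3 f"
  shows "\<exists>D. \<forall>B\<ge>D. \<exists>d. \<forall>x y z. x \<noteq> 0 \<longrightarrow> y \<noteq> 0 \<longrightarrow> z \<noteq> 0 \<longrightarrow>
     f (diag3 [x, y, z]) = (\<Sum>\<kappa>\<in>cube B. d \<kappa> * mono3 \<kappa> x y z)"
proof -
  obtain D c where f: "\<forall>g\<in>GL3. f g = (\<Sum>e \<in> ({..<3} \<times> {..<3}) \<rightarrow>\<^sub>E {..D}.
                       c e * (\<Prod>p \<in> {..<3} \<times> {..<3}. (g $$ p) ^ (e p)))"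
    using assms unfolding poly_fun3_def by blast
  let ?E = "({..<3} \<times> {..<3}) \<rightarrow>\<^sub>E {..D} :: (nat \<times> nat \<Rightarrow> nat) set"
  define off where "off e \<longleftrightarrow> e (0,1) = 0 \<and> e (0,2) = 0 \<and> e (1,0) = 0 \<and> e (1,2) = 0 \<and> e (2,0) = 0 \<and> e (2,1) = 0" for e :: "nat \<times> nat \<Rightarrow> nat"
  define kap where "kap e = (e (0,0), e (1,1), e (2,2))" for e :: "nat \<times> nat \<Rightarrow> nat"
  have fin: "finite ?E" by (intro finite_PiE) auto
  have prod: "(\<Prod>p \<in> {..<3} \<times> {..<3}. (diag3 [x, y, z] $$ p) ^ (e p)) = (if off e then mono3 (kap e) x y z else 0)" for e x y z
  proof -
    have "(\<Prod>p \<in> {..<3} \<times> {..<3}. (diag3 [x, y, z] $$ p) ^ (e p))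
      = (\<Prod>i<3. \<Prod>j<3. (diag3 [x, y, z] $$ (i, j)) ^ e (i, j))"
      by (simp add: prod.cartesian_product)
    also have "\<dots> = (if off e then mono3 (kap e) x y z else 0)"
      by (auto simp: lt3 diag3_m3 off_def kap_def power_0_left)
    finally show ?thesis .
  qed
  show ?thesis
  proof (intro exI[of _ D] allI impI)
    fix B assume B: "D \<le> B"
    have kc: "kap e \<in> cube B" if "e \<in> ?E" for e
    proof -
      have "e (i, j) \<le> B" if "i < 3" "j < 3" for i j
        using PiE_mem[OF \<open>e \<in> ?E\<close>, of "(i, j)"] that B by auto
      then show ?thesis by (simp add: kap_def cube_def)
    qed
    show "\<exists>d. \<forall>x y z. x \<noteq> 0 \<longrightarrow> y \<noteq> 0 \<longrightarrow> z \<noteq> 0 \<longrightarrow>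
       f (diag3 [x, y, z]) = (\<Sum>\<kappa>\<in>cube B. d \<kappa> * mono3 \<kappa> x y z)"
    proof (intro exI[of _ "\<lambda>\<kappa>. \<Sum>e\<in>?E. if off e \<and> kap e = \<kappa> then c e else 0"] allI impI)
      fix x y z :: complex assume nz: "x \<noteq> 0" "y \<noteq> 0" "z \<noteq> 0"
      have "(\<Sum>\<kappa>\<in>cube B. (\<Sum>e\<in>?E. if off e \<and> kap e = \<kappa> then c e else 0) * mono3 \<kappa> x y z)
         = (\<Sum>e\<in>?E. \<Sum>\<kappa>\<in>cube B. if off e \<and> kap e = \<kappa> then c e * mono3 \<kappa> x y z else 0)"
        by (subst sum.swap) (auto simp: sum_distrib_right intro!: sum.cong)
      also have "\<dots> = (\<Sum>e\<in>?E. c e * (if off e then mono3 (kap e) x y z else 0))"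
      proof (rule sum.cong[OF refl])
        fix e assume e: "e \<in> ?E"
        show "(\<Sum>\<kappa>\<in>cube B. if off e \<and> kap e = \<kappa> then c e * mono3 \<kappa> x y z else 0)
            = c e * (if off e then mono3 (kap e) x y z else 0)"
          using kc[OF e] by (cases "off e") (auto simp: sum.delta)
      qed
      also have "\<dots> = f (diag3 [x, y, z])"
        using f diag3_GL3[OF nz] by (simp add: prod)
      finally show "f (diag3 [x, y, z]) = (\<Sum>\<kappa>\<in>cube B. (\<Sum>e\<in>?E. if off e \<and> kap e = \<kappa> then c e else 0) * mono3 \<kappa> x y z)" by simp
    qed
  qed
qed

lemma poly_fun3_tendsto:
  assumes "poly_fun3 f" "\<And>i j. i < 3 \<Longrightarrow> j < 3 \<Longrightarrow> ((\<lambda>s. g s $$ (i, j)) \<longlongrightarrow> g0 $$ (i, j)) F"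
    "\<forall>\<^sub>F s in F. g s \<in> GL3" "g0 \<in> GL3"
  shows "((\<lambda>s. f (g s)) \<longlongrightarrow> f g0) F"
proof -
  obtain D c where f: "\<forall>g\<in>GL3. f g = (\<Sum>e \<in> ({..<3} \<times> {..<3}) \<rightarrow>\<^sub>E {..D}.
                       c e * (\<Prod>p \<in> {..<3} \<times> {..<3}. (g $$ p) ^ (e p)))"
    using assms(1) unfolding poly_fun3_def by blast
  have "((\<lambda>s. \<Sum>e \<in> ({..<3} \<times> {..<3}) \<rightarrow>\<^sub>E {..D}. c e * (\<Prod>p \<in> {..<3} \<times> {..<3}. (g s $$ p) ^ (e p)))
     \<longlongrightarrow> (\<Sum>e \<in> ({..<3} \<times> {..<3}) \<rightarrow>\<^sub>E {..D}. c e * (\<Prod>p \<in> {..<3} \<times> {..<3}. (g0 $$ p) ^ (e p)))) F"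
    by (intro tendsto_sum tendsto_mult tendsto_const tendsto_prod tendsto_power) (use assms(2) in auto)
  moreover have "\<forall>\<^sub>F s in F. (\<Sum>e \<in> ({..<3} \<times> {..<3}) \<rightarrow>\<^sub>E {..D}. c e * (\<Prod>p \<in> {..<3} \<times> {..<3}. (g s $$ p) ^ (e p))) = f (g s)"
    using assms(3) by eventually_elim (use f in auto)
  ultimately show ?thesis using f assms(4) by (simp add: tendsto_cong)
qed

section \<open>Vectors, covectors and weights of a representation\<close>

definition act :: "(complex mat \<Rightarrow> complex mat) \<Rightarrow> nat \<Rightarrow> complex mat \<Rightarrow> (nat \<Rightarrow> complex) \<Rightarrow> nat \<Rightarrow> complex" where
  "act \<rho> n g v i = (\<Sum>j<n. \<rho> g $$ (i, j) * v j)"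

definition coact :: "(complex mat \<Rightarrow> complex mat) \<Rightarrow> nat \<Rightarrow> (nat \<Rightarrow> complex) \<Rightarrow> complex mat \<Rightarrow> nat \<Rightarrow> complex" where
  "coact \<rho> n \<xi> g j = (\<Sum>i<n. \<xi> i * \<rho> g $$ (i, j))"

definition pair :: "nat \<Rightarrow> (nat \<Rightarrow> complex) \<Rightarrow> (nat \<Rightarrow> complex) \<Rightarrow> complex" where
  "pair n \<xi> v = (\<Sum>i<n. \<xi> i * v i)"

lemma poly_rep_mult_index:
  assumes "poly_rep n \<rho>" "g \<in> GL3" "h \<in> GL3" "i < n" "j < n"
  shows "\<rho> (g * h) $$ (i, j) = (\<Sum>k<n. \<rho> g $$ (i, k) * \<rho> h $$ (k, j))"
proof -
  have "\<rho> g \<in> carrier_mat n n" "\<rho> h \<in> carrier_mat n n" "\<rho> (g * h) = \<rho> g * \<rho> h"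
    using assms unfolding poly_rep_def by blast+
  then show ?thesis using assms by (simp add: scalar_prod_def atLeast0LessThan)
qed

lemma act_mult:
  assumes "poly_rep n \<rho>" "g \<in> GL3" "h \<in> GL3" "i < n"
  shows "act \<rho> n (g * h) v i = act \<rho> n g (act \<rho> n h v) i"
proof -
  have "act \<rho> n (g * h) v i = (\<Sum>j<n. \<Sum>k<n. \<rho> g $$ (i, k) * (\<rho> h $$ (k, j) * v j))"
    unfolding act_def using poly_rep_mult_index[OF assms]
    by (intro sum.cong) (auto simp: sum_distrib_right mult.assoc)
  also have "\<dots> = (\<Sum>k<n. \<Sum>j<n. \<rho> g $$ (i, k) * (\<rho> h $$ (k, j) * v j))" by (rule sum.swap)
  finally show ?thesis by (simp add: act_def sum_distrib_left)
qed

lemma coact_mult: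
  assumes "poly_rep n \<rho>" "g \<in> GL3" "h \<in> GL3" "j < n"
  shows "coact \<rho> n \<xi> (g * h) j = coact \<rho> n (coact \<rho> n \<xi> g) h j"
proof -
  have "coact \<rho> n \<xi> (g * h) j = (\<Sum>i<n. \<Sum>k<n. \<xi> i * \<rho> g $$ (i, k) * \<rho> h $$ (k, j))"
    unfolding coact_def using poly_rep_mult_index[OF assms(1-3) _ assms(4)]
    by (intro sum.cong) (auto simp: sum_distrib_left mult.assoc)
  also have "\<dots> = (\<Sum>k<n. \<Sum>i<n. \<xi> i * \<rho> g $$ (i, k) * \<rho> h $$ (k, j))" by (rule sum.swap)
  finally show ?thesis by (simp add: coact_def sum_distrib_right)
qed

lemma pair_coact: "pair n (coact \<rho> n \<xi> g) v = pair n \<xi> (act \<rho> n g v)"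
proof -
  have "pair n (coact \<rho> n \<xi> g) v = (\<Sum>j<n. \<Sum>i<n. \<xi> i * (\<rho> g $$ (i, j) * v j))"
    by (simp add: pair_def coact_def sum_distrib_right mult.assoc)
  also have "\<dots> = (\<Sum>i<n. \<Sum>j<n. \<xi> i * (\<rho> g $$ (i, j) * v j))" by (rule sum.swap)
  finally show ?thesis by (simp add: pair_def act_def sum_distrib_left)
qed

lemma act_cong: "(\<And>j. j < n \<Longrightarrow> v j = w j) \<Longrightarrow> act \<rho> n g v i = act \<rho> n g w i"
  by (simp add: act_def)

lemma act_scale: "act \<rho> n g (\<lambda>j. c * v j) i = c * act \<rho> n g v i"
  by (simp add: act_def sum_distrib_left mult.left_commute)

lemma coact_cong: "(\<And>j. j < n \<Longrightarrow> v j = w j) \<Longrightarrow> coact \<rho> n v g i = coact \<rho> n w g i"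
  by (simp add: coact_def)

lemma coact_scale: "coact \<rho> n (\<lambda>j. c * v j) g i = c * coact \<rho> n v g i"
  by (simp add: coact_def sum_distrib_left mult.assoc)

lemma pair_cong: "(\<And>j. j < n \<Longrightarrow> v j = w j) \<Longrightarrow> pair n \<xi> v = pair n \<xi> w"
  by (simp add: pair_def)

lemma pair_scale: "pair n \<xi> (\<lambda>j. c * v j) = c * pair n \<xi> v"
  by (simp add: pair_def sum_distrib_left mult.left_commute)

lemma poly_rep_one: "poly_rep n \<rho> \<Longrightarrow> \<rho> (1\<^sub>m 3) = 1\<^sub>m n"
  unfolding poly_rep_def by blast

lemma one_GL3: "1\<^sub>m 3 \<in> GL3" by (simp add: GL3_def)

lemma act_one: "poly_rep n \<rho> \<Longrightarrow> i < n \<Longrightarrow> act \<rho> n (1\<^sub>m 3) v i = v i"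
proof -
  assume a: "poly_rep n \<rho>" "i < n"
  have "act \<rho> n (1\<^sub>m 3) v i = (\<Sum>j<n. if i = j then v j else 0)"
    unfolding act_def poly_rep_one[OF a(1)] using a(2) by (intro sum.cong) auto
  then show ?thesis using a by simp
qed

lemma coact_one: "poly_rep n \<rho> \<Longrightarrow> i < n \<Longrightarrow> coact \<rho> n v (1\<^sub>m 3) i = v i"
proof -
  assume a: "poly_rep n \<rho>" "i < n"
  have "coact \<rho> n v (1\<^sub>m 3) i = (\<Sum>j<n. if i = j then v j else 0)"
    unfolding coact_def poly_rep_one[OF a(1)] using a(2) by (intro sum.cong) auto
  then show ?thesis using a by simp
qed

lemma choice2: "(\<And>i j. \<exists>x. R i j x) \<Longrightarrow> \<exists>f. \<forall>i j. R i j (f i j)"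
  by (rule choice, rule allI, rule choice, rule allI)

text \<open>The coefficient matrices \<open>c \<kappa>\<close> are the projectors onto the weight
  spaces, as \<open>weight_projectors\<close> shows.\<close>

lemma weight_expansion:
  assumes "poly_rep n \<rho>"
  shows "\<exists>D. \<forall>B\<ge>D. \<exists>c. \<forall>x y z. x \<noteq> 0 \<longrightarrow> y \<noteq> 0 \<longrightarrow> z \<noteq> 0 \<longrightarrow>
     (\<forall>i<n. \<forall>j<n. \<rho> (diag3 [x, y, z]) $$ (i, j) = (\<Sum>\<kappa>\<in>cube B. c \<kappa> i j * mono3 \<kappa> x y z))"
proof -
  define R where "R i j B d \<longleftrightarrow> (i < n \<longrightarrow> j < n \<longrightarrow> (\<forall>x y z. x \<noteq> 0 \<longrightarrow> y \<noteq> 0 \<longrightarrow> z \<noteq> 0 \<longrightarrow>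
     \<rho> (diag3 [x, y, z]) $$ (i, j) = (\<Sum>\<kappa>\<in>cube B. d \<kappa> * mono3 \<kappa> x y z)))" for i j B d
  have "\<exists>D. \<forall>B\<ge>D. \<exists>d. R i j B d" for i j
  proof (cases "i < n \<and> j < n")
    case True
    then have "poly_fun3 (\<lambda>g. \<rho> g $$ (i, j))" using assms unfolding poly_rep_def by blast
    from poly_fun3_diag[OF this] obtain D where D: "\<forall>B\<ge>D. \<exists>d. \<forall>x y z. x \<noteq> 0 \<longrightarrow> y \<noteq> 0 \<longrightarrow> z \<noteq> 0 \<longrightarrow>
     \<rho> (diag3 [x, y, z]) $$ (i, j) = (\<Sum>\<kappa>\<in>cube B. d \<kappa> * mono3 \<kappa> x y z)" ..
    show ?thesis
    proof (intro exI[of _ D] allI impI)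
      fix B assume "D \<le> B"
      with D obtain d where "\<forall>x y z. x \<noteq> 0 \<longrightarrow> y \<noteq> 0 \<longrightarrow> z \<noteq> 0 \<longrightarrow>
        \<rho> (diag3 [x, y, z]) $$ (i, j) = (\<Sum>\<kappa>\<in>cube B. d \<kappa> * mono3 \<kappa> x y z)" by blast
      then have "R i j B d" unfolding R_def by simp
      then show "\<exists>d. R i j B d" by blast
    qed
  qed (auto simp: R_def)
  from choice2[where R = "\<lambda>i j D. \<forall>B\<ge>D. \<exists>d. R i j B d", OF this] obtain D where D: "\<And>i j B. D i j \<le> B \<Longrightarrow> \<exists>d. R i j B d" by blast
  show ?thesis
  proof (intro exI[of _ "\<Sum>i<n. \<Sum>j<n. D i j"] allI impI)
    fix B assume B: "(\<Sum>i<n. \<Sum>j<n. D i j) \<le> B"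
    have "\<exists>d. R i j B d" for i j
    proof (cases "i < n \<and> j < n")
      case True
      have "D i j \<le> (\<Sum>j<n. D i j)" using True by (intro member_le_sum) auto
      also have "\<dots> \<le> (\<Sum>i<n. \<Sum>j<n. D i j)" using True by (intro member_le_sum[where f = "\<lambda>i. \<Sum>j<n. D i j"]) auto
      finally show ?thesis using B D by simp
    qed (auto simp: R_def)
    from choice2[where R = "\<lambda>i j. R i j B", OF this] obtain c where "\<And>i j. R i j B (c i j)" by blast
    then show "\<exists>c. \<forall>x y z. x \<noteq> 0 \<longrightarrow> y \<noteq> 0 \<longrightarrow> z \<noteq> 0 \<longrightarrow>
     (\<forall>i<n. \<forall>j<n. \<rho> (diag3 [x, y, z]) $$ (i, j) = (\<Sum>\<kappa>\<in>cube B. c \<kappa> i j * mono3 \<kappa> x y z))"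
      unfolding R_def by (intro exI[of _ "\<lambda>\<kappa> i j. c i j \<kappa>"]) simp
  qed
qed

section \<open>Alternants and unipotent matrices along a one-parameter subgroup\<close>

lemma rearrangement: "b < a \<Longrightarrow> d < c \<Longrightarrow> a * d + b * c < a * c + b * (d :: nat)"
proof -
  assume "b < a" "d < c"
  then obtain p q where "a = Suc (b + p)" "c = Suc (d + q)" using less_imp_Suc_add by blast
  then show ?thesis by (simp add: algebra_simps)
qed

text \<open>The six-term expansion of an alternant at \<open>(s ^ d0, s ^ d1, s ^ d2)\<close>, kept
  as a polynomial in \<open>s\<close> because its degree carries the highest weight.\<close>

definition altpoly :: "nat \<Rightarrow> nat \<Rightarrow> nat \<Rightarrow> nat \<Rightarrow> nat \<Rightarrow> nat \<Rightarrow> complex poly" where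
  "altpoly d0 d1 d2 e0 e1 e2 = monom 1 (e0 * d0 + e1 * d1 + e2 * d2) - monom 1 (e0 * d0 + e2 * d1 + e1 * d2)
     - monom 1 (e1 * d0 + e0 * d1 + e2 * d2) + monom 1 (e1 * d0 + e2 * d1 + e0 * d2)
     + monom 1 (e2 * d0 + e0 * d1 + e1 * d2) - monom 1 (e2 * d0 + e1 * d1 + e0 * d2)"

text \<open>By the rearrangement inequality the identity permutation has the strictly largest
  exponent, so its monomial cannot cancel.\<close>

lemma degree_altpoly:
  assumes "d2 < d1" "d1 < d0" "e2 < e1" "e1 < e0"
  shows "degree (altpoly d0 d1 d2 e0 e1 e2) = e0 * d0 + e1 * d1 + e2 * d2"
proof -
  let ?T = "e0 * d0 + e1 * d1 + e2 * d2"
  have 1: "e0 * d0 + e2 * d1 + e1 * d2 < ?T" using rearrangement[OF assms(3) assms(1)] by simp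
  have 2: "e1 * d0 + e0 * d1 + e2 * d2 < ?T" using rearrangement[OF assms(4) assms(2)] by simp
  have 3: "e1 * d0 + e2 * d1 + e0 * d2 < ?T"
    using rearrangement[OF less_trans[OF assms(3,4)] assms(1)] 2 by simp
  have 4: "e2 * d0 + e0 * d1 + e1 * d2 < ?T"
    using rearrangement[OF less_trans[OF assms(3,4)] assms(2)] 1 by simp
  have 5: "e2 * d0 + e1 * d1 + e0 * d2 < ?T"
    using rearrangement[OF less_trans[OF assms(3,4)] less_trans[OF assms(1,2)]] by simp
  have m: "degree (monom (1::complex) k) = k" for k by (simp add: degree_monom_eq)
  have "degree (monom (1::complex) ?T - monom 1 (e0 * d0 + e2 * d1 + e1 * d2)) = ?T"
    using degree_add_eq_left[of "- monom (1::complex) (e0 * d0 + e2 * d1 + e1 * d2)" "monom 1 ?T"] 1 m by simp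
  then have A: "degree (monom (1::complex) ?T - monom 1 (e0 * d0 + e2 * d1 + e1 * d2) - monom 1 (e1 * d0 + e0 * d1 + e2 * d2)) = ?T"
    using degree_add_eq_left[of "- monom (1::complex) (e1 * d0 + e0 * d1 + e2 * d2)" "monom (1::complex) ?T - monom 1 (e0 * d0 + e2 * d1 + e1 * d2)"] 2 m by simp
  show ?thesis unfolding altpoly_def
  proof -
    let ?A = "monom (1::complex) ?T - monom 1 (e0 * d0 + e2 * d1 + e1 * d2) - monom 1 (e1 * d0 + e0 * d1 + e2 * d2)"
    have B: "degree (?A + monom 1 (e1 * d0 + e2 * d1 + e0 * d2)) = ?T"
      using degree_add_eq_left[of "monom (1::complex) (e1 * d0 + e2 * d1 + e0 * d2)" ?A] A 3 m by simp
    have C: "degree (?A + monom 1 (e1 * d0 + e2 * d1 + e0 * d2) + monom 1 (e2 * d0 + e0 * d1 + e1 * d2)) = ?T"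
      using degree_add_eq_left[of "monom (1::complex) (e2 * d0 + e0 * d1 + e1 * d2)" "?A + monom 1 (e1 * d0 + e2 * d1 + e0 * d2)"] B 4 m by simp
    show "degree (?A + monom 1 (e1 * d0 + e2 * d1 + e0 * d2) + monom 1 (e2 * d0 + e0 * d1 + e1 * d2) - monom 1 (e2 * d0 + e1 * d1 + e0 * d2)) = ?T"
      using degree_add_eq_left[of "- monom (1::complex) (e2 * d0 + e1 * d1 + e0 * d2)" "?A + monom 1 (e1 * d0 + e2 * d1 + e0 * d2) + monom 1 (e2 * d0 + e0 * d1 + e1 * d2)"] C 5 m by simp
  qed
qed

lemma alternant_eq: "alternant [l0, l1, l2] [x, y, z] =
   x ^ (l0 + 2) * (y ^ (l1 + 1) * z ^ l2 - y ^ l2 * z ^ (l1 + 1))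
   - x ^ (l1 + 1) * (y ^ (l0 + 2) * z ^ l2 - y ^ l2 * z ^ (l0 + 2))
   + x ^ l2 * (y ^ (l0 + 2) * z ^ (l1 + 1) - y ^ (l1 + 1) * z ^ (l0 + 2))"
  unfolding alternant_def m3_def[symmetric] det_m3 by simp

lemma alternant_altpoly:
  "alternant [l0, l1, l2] [s ^ d0, s ^ d1, s ^ d2] = poly (altpoly d0 d1 d2 (l0 + 2) (l1 + 1) l2) s"
  unfolding alternant_eq altpoly_def
  by (simp add: poly_monom power_mult[symmetric] power_add[symmetric] algebra_simps del: power_Suc power_Suc2)

definition upper :: "complex \<Rightarrow> complex \<Rightarrow> complex \<Rightarrow> complex mat" where
  "upper a b c = m3 (\<lambda>i j. if i = j then 1 else if i = 0 \<and> j = 1 then a else if i = 0 \<and> j = 2 then b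
     else if i = 1 \<and> j = 2 then c else 0)"

definition lower :: "complex \<Rightarrow> complex \<Rightarrow> complex \<Rightarrow> complex mat" where
  "lower a b c = m3 (\<lambda>i j. if i = j then 1 else if i = 1 \<and> j = 0 then a else if i = 2 \<and> j = 0 then b
     else if i = 2 \<and> j = 1 then c else 0)"

lemma upper_GL3: "upper a b c \<in> GL3" by (simp add: upper_def GL3_def det_m3)
lemma lower_GL3: "lower a b c \<in> GL3" by (simp add: lower_def GL3_def det_m3)

text \<open>Conjugation by the torus multiplies the unipotent entries by powers of \<open>s\<close>;
  for strictly decreasing \<open>d0\<close>, \<open>d1\<close>, \<open>d2\<close> it contracts them
  to 0 as \<open>s\<close> tends to 0.\<close>

lemma diag3_upper:
  assumes "d2 \<le> d1" "d1 \<le> d0"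
  shows "diag3 [s ^ d0, s ^ d1, s ^ d2] * upper a b c
   = upper (a * s ^ (d0 - d1)) (b * s ^ (d0 - d2)) (c * s ^ (d1 - d2)) * diag3 [s ^ d0, s ^ d1, s ^ d2]"
proof -
  have "s ^ d0 = s ^ (d0 - d1) * s ^ d1" "s ^ d0 = s ^ (d0 - d2) * s ^ d2" "s ^ d1 = s ^ (d1 - d2) * s ^ d2"
    using assms by (simp_all flip: power_add)
  then show ?thesis unfolding diag3_m3 upper_def m3_mult
    by (intro m3_cong, drule_tac less3_cases, drule_tac less3_cases, elim disjE) (simp_all add: mult_ac)
qed

lemma lower_diag3:
  assumes "d2 \<le> d1" "d1 \<le> d0"
  shows "lower a b c * diag3 [s ^ d0, s ^ d1, s ^ d2]
   = diag3 [s ^ d0, s ^ d1, s ^ d2] * lower (a * s ^ (d0 - d1)) (b * s ^ (d0 - d2)) (c * s ^ (d1 - d2))"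
proof -
  have "s ^ d0 = s ^ (d0 - d1) * s ^ d1" "s ^ d0 = s ^ (d0 - d2) * s ^ d2" "s ^ d1 = s ^ (d1 - d2) * s ^ d2"
    using assms by (simp_all flip: power_add)
  then show ?thesis unfolding diag3_m3 lower_def m3_mult
    by (intro m3_cong, drule_tac less3_cases, drule_tac less3_cases, elim disjE) (simp_all add: mult_ac)
qed

lemma tendsto_power_zero: "0 < k \<Longrightarrow> ((\<lambda>s. a * s ^ k) \<longlongrightarrow> 0) (at (0::complex))"
proof -
  assume "0 < k"
  have "((\<lambda>s. a * s ^ k) \<longlongrightarrow> a * 0 ^ k) (at (0::complex))" by (intro tendsto_intros)
  then show ?thesis using \<open>0 < k\<close> by (simp add: power_0_left)
qed

lemma unipotent_tendsto:
  assumes "poly_fun3 f" "d2 < d1" "d1 < d0"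
  shows "((\<lambda>s. f (upper (a * s ^ (d0 - d1)) (b * s ^ (d0 - d2)) (c * s ^ (d1 - d2)))) \<longlongrightarrow> f (1\<^sub>m 3)) (at 0)"
    and "((\<lambda>s. f (lower (a * s ^ (d0 - d1)) (b * s ^ (d0 - d2)) (c * s ^ (d1 - d2)))) \<longlongrightarrow> f (1\<^sub>m 3)) (at 0)"
proof -
  have t: "((\<lambda>s. a * s ^ (d0 - d1)) \<longlongrightarrow> 0) (at (0::complex))"
     "((\<lambda>s. b * s ^ (d0 - d2)) \<longlongrightarrow> 0) (at (0::complex))"
     "((\<lambda>s. c * s ^ (d1 - d2)) \<longlongrightarrow> 0) (at (0::complex))"
    using assms by (intro tendsto_power_zero; simp)+
  show "((\<lambda>s. f (upper (a * s ^ (d0 - d1)) (b * s ^ (d0 - d2)) (c * s ^ (d1 - d2)))) \<longlongrightarrow> f (1\<^sub>m 3)) (at 0)"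
  proof (rule poly_fun3_tendsto[OF assms(1)])
    fix i j :: nat assume "i < 3" "j < 3"
    then show "((\<lambda>s. upper (a * s ^ (d0 - d1)) (b * s ^ (d0 - d2)) (c * s ^ (d1 - d2)) $$ (i, j)) \<longlongrightarrow> 1\<^sub>m 3 $$ (i, j)) (at 0)"
      by (drule_tac less3_cases, drule_tac less3_cases, elim disjE) (simp_all add: upper_def t)
  qed (simp_all add: upper_GL3 one_GL3)
  show "((\<lambda>s. f (lower (a * s ^ (d0 - d1)) (b * s ^ (d0 - d2)) (c * s ^ (d1 - d2)))) \<longlongrightarrow> f (1\<^sub>m 3)) (at 0)"
  proof (rule poly_fun3_tendsto[OF assms(1)])
    fix i j :: nat assume "i < 3" "j < 3"
    then show "((\<lambda>s. lower (a * s ^ (d0 - d1)) (b * s ^ (d0 - d2)) (c * s ^ (d1 - d2)) $$ (i, j)) \<longlongrightarrow> 1\<^sub>m 3 $$ (i, j)) (at 0)"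
      by (drule_tac less3_cases, drule_tac less3_cases, elim disjE) (simp_all add: lower_def t)
  qed (simp_all add: lower_GL3 one_GL3)
qed

lemma wt_digits:
  fixes a b k l N :: nat
  assumes "a * N + k = b * N + l" "k < N" "l < N"
  shows "a = b \<and> k = l"
proof -
  have "(a * N + k) div N = a" "(b * N + l) div N = b" using assms(2,3) by auto
  then have "a = b" using assms(1) by metis
  then show ?thesis using assms(1) by simp
qed

text \<open>All three identities compare coefficients of independent characters: the first two in
  the multiplicativity of \<rho> on pairs of diagonal matrices, the third in the second.\<close>

lemma weight_projectors:
  assumes rep: "poly_rep n \<rho>"
    and c: "\<And>x y z i j. x \<noteq> 0 \<Longrightarrow> y \<noteq> 0 \<Longrightarrow> z \<noteq> 0 \<Longrightarrow> i < n \<Longrightarrow> j < n \<Longrightarrow>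
       \<rho> (diag3 [x, y, z]) $$ (i, j) = (\<Sum>\<kappa>\<in>cube B. c \<kappa> i j * mono3 \<kappa> x y z)"
    and \<kappa>: "\<kappa> \<in> cube B" and ij: "i < n" "j < n"
  shows "x \<noteq> 0 \<Longrightarrow> y \<noteq> 0 \<Longrightarrow> z \<noteq> 0 \<Longrightarrow>
      (\<Sum>k<n. \<rho> (diag3 [x, y, z]) $$ (i, k) * c \<kappa> k j) = mono3 \<kappa> x y z * c \<kappa> i j"
    and "x \<noteq> 0 \<Longrightarrow> y \<noteq> 0 \<Longrightarrow> z \<noteq> 0 \<Longrightarrow>
      (\<Sum>k<n. c \<kappa> i k * \<rho> (diag3 [x, y, z]) $$ (k, j)) = mono3 \<kappa> x y z * c \<kappa> i j"
    and "(\<Sum>k<n. c \<kappa> i k * c \<kappa> k j) = c \<kappa> i j"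
proof -
  have mult: "\<rho> (diag3 [x * x', y * y', z * z']) $$ (i, j)
      = (\<Sum>k<n. \<rho> (diag3 [x, y, z]) $$ (i, k) * \<rho> (diag3 [x', y', z']) $$ (k, j))"
    if "x \<noteq> 0" "y \<noteq> 0" "z \<noteq> 0" "x' \<noteq> 0" "y' \<noteq> 0" "z' \<noteq> 0" for x y z x' y' z'
    using poly_rep_mult_index[OF rep diag3_GL3 diag3_GL3 ij, of x y z x' y' z'] that
    by (simp add: diag3_mult)
  show left: "(\<Sum>k<n. \<rho> (diag3 [x, y, z]) $$ (i, k) * c \<kappa> k j) = mono3 \<kappa> x y z * c \<kappa> i j"
    if nz: "x \<noteq> 0" "y \<noteq> 0" "z \<noteq> 0" for x y z
  proof -
    let ?d = "\<lambda>\<kappa>. (\<Sum>k<n. \<rho> (diag3 [x, y, z]) $$ (i, k) * c \<kappa> k j) - mono3 \<kappa> x y z * c \<kappa> i j"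
    have "?d \<kappa> = 0"
    proof (rule mono3_zero[where d = ?d, OF _ \<kappa>])
      fix x' y' z' :: complex assume nz': "x' \<noteq> 0" "y' \<noteq> 0" "z' \<noteq> 0"
      have "(\<Sum>k<n. \<rho> (diag3 [x, y, z]) $$ (i, k) * \<rho> (diag3 [x', y', z']) $$ (k, j))
        = (\<Sum>k<n. \<Sum>\<kappa>\<in>cube B. \<rho> (diag3 [x, y, z]) $$ (i, k) * c \<kappa> k j * mono3 \<kappa> x' y' z')"
        using c[OF nz' _ ij(2)] by (simp add: sum_distrib_left mult.assoc)
      also have "\<dots> = (\<Sum>\<kappa>\<in>cube B. (\<Sum>k<n. \<rho> (diag3 [x, y, z]) $$ (i, k) * c \<kappa> k j) * mono3 \<kappa> x' y' z')"
        by (subst sum.swap) (simp add: sum_distrib_right)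
      finally have 1: "(\<Sum>k<n. \<rho> (diag3 [x, y, z]) $$ (i, k) * \<rho> (diag3 [x', y', z']) $$ (k, j))
        = (\<Sum>\<kappa>\<in>cube B. (\<Sum>k<n. \<rho> (diag3 [x, y, z]) $$ (i, k) * c \<kappa> k j) * mono3 \<kappa> x' y' z')" .
      have 2: "\<rho> (diag3 [x * x', y * y', z * z']) $$ (i, j) = (\<Sum>\<kappa>\<in>cube B. mono3 \<kappa> x y z * c \<kappa> i j * mono3 \<kappa> x' y' z')"
        using c[of "x * x'" "y * y'" "z * z'" i j] nz nz' ij by (simp add: mono3_mult mult_ac)
      show "(\<Sum>\<kappa>\<in>cube B. ?d \<kappa> * mono3 \<kappa> x' y' z') = 0"
        using mult[OF nz nz'] unfolding 1 2 by (simp add: left_diff_distrib sum_subtractf)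
    qed
    then show ?thesis by simp
  qed
  show right: "(\<Sum>k<n. c \<kappa> i k * \<rho> (diag3 [x, y, z]) $$ (k, j)) = mono3 \<kappa> x y z * c \<kappa> i j"
    if nz: "x \<noteq> 0" "y \<noteq> 0" "z \<noteq> 0" for x y z
  proof -
    let ?d = "\<lambda>\<kappa>. (\<Sum>k<n. c \<kappa> i k * \<rho> (diag3 [x, y, z]) $$ (k, j)) - mono3 \<kappa> x y z * c \<kappa> i j"
    have "?d \<kappa> = 0"
    proof (rule mono3_zero[where d = ?d, OF _ \<kappa>])
      fix x' y' z' :: complex assume nz': "x' \<noteq> 0" "y' \<noteq> 0" "z' \<noteq> 0"
      have "(\<Sum>k<n. \<rho> (diag3 [x', y', z']) $$ (i, k) * \<rho> (diag3 [x, y, z]) $$ (k, j))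
        = (\<Sum>k<n. \<Sum>\<kappa>\<in>cube B. c \<kappa> i k * \<rho> (diag3 [x, y, z]) $$ (k, j) * mono3 \<kappa> x' y' z')"
        using c[OF nz' ij(1)] by (simp add: sum_distrib_right sum_distrib_left mult_ac)
      also have "\<dots> = (\<Sum>\<kappa>\<in>cube B. (\<Sum>k<n. c \<kappa> i k * \<rho> (diag3 [x, y, z]) $$ (k, j)) * mono3 \<kappa> x' y' z')"
        by (subst sum.swap) (simp add: sum_distrib_right)
      finally have 1: "(\<Sum>k<n. \<rho> (diag3 [x', y', z']) $$ (i, k) * \<rho> (diag3 [x, y, z]) $$ (k, j))
        = (\<Sum>\<kappa>\<in>cube B. (\<Sum>k<n. c \<kappa> i k * \<rho> (diag3 [x, y, z]) $$ (k, j)) * mono3 \<kappa> x' y' z')" .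
      have 2: "\<rho> (diag3 [x' * x, y' * y, z' * z]) $$ (i, j) = (\<Sum>\<kappa>\<in>cube B. mono3 \<kappa> x y z * c \<kappa> i j * mono3 \<kappa> x' y' z')"
        using c[of "x' * x" "y' * y" "z' * z" i j] nz nz' ij by (simp add: mono3_mult mult_ac)
      show "(\<Sum>\<kappa>\<in>cube B. ?d \<kappa> * mono3 \<kappa> x' y' z') = 0"
        using mult[OF nz' nz] unfolding 1 2 by (simp add: left_diff_distrib sum_subtractf)
    qed
    then show ?thesis by simp
  qed
  show "(\<Sum>k<n. c \<kappa> i k * c \<kappa> k j) = c \<kappa> i j"
  proof -
    let ?d = "\<lambda>\<kappa>'. (\<Sum>k<n. c \<kappa> i k * c \<kappa>' k j) - (if \<kappa>' = \<kappa> then c \<kappa> i j else 0)"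
    have "?d \<kappa> = 0"
    proof (rule mono3_zero[where d = ?d, OF _ \<kappa>])
      fix x y z :: complex assume nz: "x \<noteq> 0" "y \<noteq> 0" "z \<noteq> 0"
      have "(\<Sum>k<n. c \<kappa> i k * \<rho> (diag3 [x, y, z]) $$ (k, j))
        = (\<Sum>k<n. \<Sum>\<kappa>'\<in>cube B. c \<kappa> i k * c \<kappa>' k j * mono3 \<kappa>' x y z)"
        using c[OF nz _ ij(2)] by (simp add: sum_distrib_left mult.assoc)
      also have "\<dots> = (\<Sum>\<kappa>'\<in>cube B. (\<Sum>k<n. c \<kappa> i k * c \<kappa>' k j) * mono3 \<kappa>' x y z)"
        by (subst sum.swap) (simp add: sum_distrib_right)
      finally have 1: "(\<Sum>\<kappa>'\<in>cube B. (\<Sum>k<n. c \<kappa> i k * c \<kappa>' k j) * mono3 \<kappa>' x y z) = mono3 \<kappa> x y z * c \<kappa> i j"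
        using right[OF nz] by simp
      have "(\<Sum>\<kappa>'\<in>cube B. (if \<kappa>' = \<kappa> then c \<kappa> i j else 0) * mono3 \<kappa>' x y z)
         = (\<Sum>\<kappa>'\<in>cube B. if \<kappa>' = \<kappa> then c \<kappa> i j * mono3 \<kappa>' x y z else 0)"
        by (intro sum.cong) auto
      also have "\<dots> = c \<kappa> i j * mono3 \<kappa> x y z" using \<kappa> by simp
      finally show "(\<Sum>\<kappa>'\<in>cube B. ?d \<kappa>' * mono3 \<kappa>' x y z) = 0"
        using 1 by (simp add: left_diff_distrib sum_subtractf)
    qed
    then show ?thesis by simp
  qed
qed

text \<open>
  The weights occurring in \<open>\<rho>\<close> are separated by the one-parameter subgroup \<open>(s^(N^2), s^N, s)\<close>. Its top
  weight is \<open>(l0, l1, 0)\<close> by the character formula, and unipotent invariance of the top weight space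
  follows by contracting with \<open>s \<rightarrow> 0\<close>.\<close>

lemma highest_weight:
  assumes sch: "schur_rep [l0, l1, 0] n \<rho>" and l: "l1 \<le> l0" and n: "0 < n"
  shows "\<exists>v \<xi>. pair n \<xi> v \<noteq> 0 \<and>
    (\<forall>x y z i. x \<noteq> 0 \<longrightarrow> y \<noteq> 0 \<longrightarrow> z \<noteq> 0 \<longrightarrow> i < n \<longrightarrow> act \<rho> n (diag3 [x, y, z]) v i = x ^ l0 * y ^ l1 * v i) \<and>
    (\<forall>a b c i. i < n \<longrightarrow> act \<rho> n (upper a b c) v i = v i) \<and>
    (\<forall>x y z i. x \<noteq> 0 \<longrightarrow> y \<noteq> 0 \<longrightarrow> z \<noteq> 0 \<longrightarrow> i < n \<longrightarrow> coact \<rho> n \<xi> (diag3 [x, y, z]) i = x ^ l0 * y ^ l1 * \<xi> i) \<and>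
    (\<forall>a b c i. i < n \<longrightarrow> coact \<rho> n \<xi> (lower a b c) i = \<xi> i)"
proof -
  have rep: "poly_rep n \<rho>" using sch unfolding schur_rep_def by blast
  obtain D where D: "\<forall>B\<ge>D. \<exists>c. \<forall>x y z. x \<noteq> 0 \<longrightarrow> y \<noteq> 0 \<longrightarrow> z \<noteq> 0 \<longrightarrow>
     (\<forall>i<n. \<forall>j<n. \<rho> (diag3 [x, y, z]) $$ (i, j) = (\<Sum>\<kappa>\<in>cube B. c \<kappa> i j * mono3 \<kappa> x y z))"
    using weight_expansion[OF rep] by blast
  \<comment> \<open>Large enough for the expansion and for the box to contain (l0, l1, 0); the extra
    1 makes \<open>N \<ge> 2\<close>, hence \<open>d2 < d1 < d0\<close>.\<close>
  define B where "B = D + l0 + 1"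
  have "D \<le> B" by (simp add: B_def)
  with D obtain c where "\<forall>x y z. x \<noteq> 0 \<longrightarrow> y \<noteq> 0 \<longrightarrow> z \<noteq> 0 \<longrightarrow>
     (\<forall>i<n. \<forall>j<n. \<rho> (diag3 [x, y, z]) $$ (i, j) = (\<Sum>\<kappa>\<in>cube B. c \<kappa> i j * mono3 \<kappa> x y z))" by blast
  then have c: "\<rho> (diag3 [x, y, z]) $$ (i, j) = (\<Sum>\<kappa>\<in>cube B. c \<kappa> i j * mono3 \<kappa> x y z)"
    if "x \<noteq> 0" "y \<noteq> 0" "z \<noteq> 0" "i < n" "j < n" for x y z i j using that by blast
  define N where "N = Suc B"
  define d0 d1 d2 where "d0 = N * N" and "d1 = N" and "d2 = (1 :: nat)"
  have N2: "2 \<le> N" by (simp add: N_def B_def)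
  have dd: "d2 < d1" "d1 < d0" using N2 by (auto simp: d0_def d1_def d2_def)
  \<comment> \<open>With \<open>N > B\<close> the exponents are digits in base \<open>N\<close>, so
    \<open>wt\<close> separates the characters in the box.\<close>
  define wt where "wt \<kappa> = (case \<kappa> of (i, j, k) \<Rightarrow> i * d0 + j * d1 + k * d2)" for \<kappa> :: "nat \<times> nat \<times> nat"
  have mono_wt: "mono3 \<kappa> (s ^ d0) (s ^ d1) (s ^ d2) = s ^ wt \<kappa>" for \<kappa> s
    by (cases \<kappa>) (simp add: wt_def power_add mult.commute flip: power_mult)
  have inj: "\<kappa> = \<kappa>'" if "\<kappa> \<in> cube B" "\<kappa>' \<in> cube B" "wt \<kappa> = wt \<kappa>'" for \<kappa> \<kappa>'
  proof -
    obtain i j k i' j' k' where k: "\<kappa> = (i, j, k)" "\<kappa>' = (i', j', k')" by (cases \<kappa>; cases \<kappa>') auto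
    have b: "j < N" "k < N" "j' < N" "k' < N" using that by (auto simp: k cube_def N_def)
    have "(i * N + j) * N + k = (i' * N + j') * N + k'"
      using that(3) by (simp add: wt_def k d0_def d1_def d2_def algebra_simps)
    from wt_digits[OF this b(2,4)] wt_digits[of i N j i' j'] b show ?thesis by (simp add: k)
  qed
  define NZ where "NZ = {\<kappa> \<in> cube B. \<exists>i<n. \<exists>j<n. c \<kappa> i j \<noteq> 0}"
  have "NZ \<noteq> {}"
  proof
    assume "NZ = {}"
    then have "c \<kappa> 0 0 = 0" if "\<kappa> \<in> cube B" for \<kappa> using that n unfolding NZ_def by blast
    then have "\<rho> (diag3 [1, 1, 1]) $$ (0, 0) = 0" using c[of 1 1 1 0 0] n by simp
    moreover have "\<rho> (diag3 [1, 1, 1]) = 1\<^sub>m n" using poly_rep_one[OF rep] by (simp add: one_diag3)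
    ultimately show False using n by simp
  qed
  moreover have "finite NZ" by (simp add: NZ_def)
  ultimately have "Max (wt ` NZ) \<in> wt ` NZ" by (intro Max_in) auto
  then obtain \<kappa>0 where \<kappa>0: "\<kappa>0 \<in> NZ" "wt \<kappa>0 = Max (wt ` NZ)" by auto
  have top: "wt \<kappa> \<le> wt \<kappa>0" if "\<kappa> \<in> NZ" for \<kappa>
    using that \<open>finite NZ\<close> by (simp add: \<kappa>0(2))
  have \<kappa>0c: "\<kappa>0 \<in> cube B" using \<kappa>0 by (simp add: NZ_def)
  \<comment> \<open>The trace of a weight projector is the multiplicity of that weight in the
    character.\<close>
  define m where "m \<kappa> = (\<Sum>i<n. c \<kappa> i i)" for \<kappa>
  have idem: "(\<Sum>k<n. c \<kappa>0 i k * c \<kappa>0 k j) = c \<kappa>0 i j" if "i < n" "j < n" for i j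
    by (rule weight_projectors(3)[OF rep c \<kappa>0c that])
  have m0: "m \<kappa>0 \<noteq> 0"
  proof
    assume "m \<kappa>0 = 0"
    then have "c \<kappa>0 i j = 0" if "i < n" "j < n" for i j
      using idempotent_trace[of n "c \<kappa>0", OF idem] that by (simp add: m_def)
    then show False using \<kappa>0(1) unfolding NZ_def by blast
  qed
  have mNZ: "m \<kappa> = 0" if "\<kappa> \<in> cube B" "\<kappa> \<notin> NZ" for \<kappa>
  proof -
    have "c \<kappa> i i = 0" if "i < n" for i using \<open>\<kappa> \<in> cube B\<close> \<open>\<kappa> \<notin> NZ\<close> that unfolding NZ_def by blast
    then show ?thesis by (simp add: m_def)
  qed
  define p1 where "p1 = (\<Sum>\<kappa>\<in>cube B. monom (m \<kappa>) (wt \<kappa>))"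
  have tr: "mat_trace (\<rho> (diag3 [s ^ d0, s ^ d1, s ^ d2])) = poly p1 s" if "s \<noteq> 0" for s
  proof -
    have g: "diag3 [s ^ d0, s ^ d1, s ^ d2] \<in> GL3" using that by (intro diag3_GL3) auto
    then have "\<rho> (diag3 [s ^ d0, s ^ d1, s ^ d2]) \<in> carrier_mat n n"
      using rep unfolding poly_rep_def by blast
    then have "mat_trace (\<rho> (diag3 [s ^ d0, s ^ d1, s ^ d2]))
       = (\<Sum>i<n. \<Sum>\<kappa>\<in>cube B. c \<kappa> i i * s ^ wt \<kappa>)"
      using that by (simp add: mat_trace_def c mono_wt)
    also have "\<dots> = (\<Sum>\<kappa>\<in>cube B. m \<kappa> * s ^ wt \<kappa>)"
      by (subst sum.swap) (simp add: m_def sum_distrib_right)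
    finally show ?thesis by (simp add: p1_def poly_sum poly_monom)
  qed
  let ?Z = "altpoly d0 d1 d2 2 1 0" and ?A = "altpoly d0 d1 d2 (l0 + 2) (l1 + 1) 0"
  \<comment> \<open>The bialternant formula is given only at distinct nonzero arguments. Real
    \<open>s > 1\<close> provide infinitely many of these, enough for an identity of polynomials
    whose degrees can be compared.\<close>
  have eq: "p1 * ?Z = ?A"
  proof (rule ccontr)
    assume "p1 * ?Z \<noteq> ?A"
    then have "finite {s. poly (p1 * ?Z - ?A) s = 0}" by (intro poly_roots_finite) simp
    moreover have "of_real ` {1<..} \<subseteq> {s. poly (p1 * ?Z - ?A) s = 0}"
    proof (rule image_subsetI)
      fix r :: real assume r: "r \<in> {1<..}"
      let ?s = "of_real r :: complex"
      have s0: "?s \<noteq> 0" using r by simp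
      have ne: "?s ^ a \<noteq> ?s ^ b" if "a \<noteq> b" for a b
        using r that by (simp flip: of_real_power add: power_inject_exp)
      have dis: "distinct [?s ^ d0, ?s ^ d1, ?s ^ d2]" using ne dd by simp
      have nz: "\<forall>i<3. [?s ^ d0, ?s ^ d1, ?s ^ d2] ! i \<noteq> 0"
        using s0 by (auto dest!: less3_cases)
      have "mat_trace (\<rho> (diag3 [?s ^ d0, ?s ^ d1, ?s ^ d2])) * alternant [0, 0, 0] [?s ^ d0, ?s ^ d1, ?s ^ d2]
         = alternant [l0, l1, 0] [?s ^ d0, ?s ^ d1, ?s ^ d2]"
        using sch dis nz unfolding schur_rep_def by simp
      then have "poly p1 ?s * poly ?Z ?s = poly ?A ?s"
        unfolding tr[OF s0] alternant_altpoly add_0 .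
      then show "?s \<in> {s. poly (p1 * ?Z - ?A) s = 0}" by (simp only: poly_diff poly_mult diff_self mem_Collect_eq)
    qed
    ultimately have "finite (of_real ` {1<..} :: complex set)" by (rule rev_finite_subset)
    then have "finite {1::real<..}" by (rule finite_imageD) (simp add: inj_on_def)
    then show False using infinite_Ioi by blast
  qed
  have degA0: "degree ?Z = 2 * d0 + 1 * d1 + 0 * d2" by (rule degree_altpoly) (use dd in auto)
  have degA: "degree ?A = (l0 + 2) * d0 + (l1 + 1) * d1 + 0 * d2"
    by (rule degree_altpoly) (use dd l in auto)
  have cp: "coeff p1 (wt \<kappa>0) = m \<kappa>0"
  proof -
    have "coeff p1 (wt \<kappa>0) = (\<Sum>\<kappa>\<in>cube B. if \<kappa> = \<kappa>0 then m \<kappa> else 0)"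
      unfolding p1_def coeff_sum coeff_monom using inj \<kappa>0c by (intro sum.cong) auto
    then show ?thesis using \<kappa>0c by simp
  qed
  have "degree p1 \<le> wt \<kappa>0"
    unfolding p1_def
  proof (rule degree_sum_le)
    fix \<kappa> assume k: "\<kappa> \<in> cube B"
    show "degree (monom (m \<kappa>) (wt \<kappa>)) \<le> wt \<kappa>0"
    proof (cases "\<kappa> \<in> NZ")
      case True then show ?thesis using top degree_monom_le order.trans by blast
    next
      case False then show ?thesis using mNZ[OF k] by simp
    qed
  qed simp
  then have degp: "degree p1 = wt \<kappa>0" using cp m0 le_degree by (metis order_antisym)
  have "degree (p1 * ?Z) = degree p1 + degree ?Z"
  proof (rule degree_mult_eq)
    show "p1 \<noteq> 0" using cp m0 by auto
    show "?Z \<noteq> 0" using degA0 dd by auto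
  qed
  then have "wt \<kappa>0 = wt (l0, l1, 0)"
    unfolding eq degA degA0 degp by (simp add: wt_def algebra_simps)
  then have \<kappa>0l: "\<kappa>0 = (l0, l1, 0)"
    by (intro inj[OF \<kappa>0c]) (use l in \<open>auto simp: cube_def B_def\<close>)
  obtain i0 j0 where ij0: "i0 < n" "j0 < n" "c \<kappa>0 i0 j0 \<noteq> 0" using \<kappa>0(1) unfolding NZ_def by blast
  \<comment> \<open>From a nonzero entry of the top projector: its column is a highest weight
    vector, its row a highest weight covector, and by idempotency their pairing is that
    entry.\<close>
  define v where "v j = c \<kappa>0 j j0" for j
  define \<xi> where "\<xi> i = c \<kappa>0 i0 i" for i
  have torus: "act \<rho> n (diag3 [x, y, z]) v i = x ^ l0 * y ^ l1 * v i"
    if "x \<noteq> 0" "y \<noteq> 0" "z \<noteq> 0" "i < n" for x y z i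
    using weight_projectors(1)[OF rep c \<kappa>0c that(4) ij0(2) that(1-3)]
    by (simp add: act_def v_def \<kappa>0l)
  have torus': "coact \<rho> n \<xi> (diag3 [x, y, z]) i = x ^ l0 * y ^ l1 * \<xi> i"
    if "x \<noteq> 0" "y \<noteq> 0" "z \<noteq> 0" "i < n" for x y z i
    using weight_projectors(2)[OF rep c \<kappa>0c ij0(1) that(4) that(1-3)]
    by (simp add: coact_def \<xi>_def \<kappa>0l)
  have gGL: "diag3 [s ^ d0, s ^ d1, s ^ d2] \<in> GL3" if "s \<noteq> 0" for s using that by (intro diag3_GL3) auto
  have wl: "wt \<kappa>0 = l0 * d0 + l1 * d1" by (simp add: \<kappa>0l wt_def)
  have pfij: "poly_fun3 (\<lambda>g. \<rho> g $$ (i, j))" if "i < n" "j < n" for i j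
    using rep that unfolding poly_rep_def by blast
  have up: "act \<rho> n (upper a b e) v i = v i" if i: "i < n" for a b e i
  proof -
    define U where "U s = upper (a * s ^ (d0 - d1)) (b * s ^ (d0 - d2)) (e * s ^ (d1 - d2))" for s
    define f where "f \<kappa> = (\<Sum>k<n. c \<kappa> i k * act \<rho> n (upper a b e) v k)" for \<kappa>
    have "act \<rho> n (U 1) v i = v i"
    \<comment> \<open>The vector t_s u v, with t_s the torus element and u the unipotent one, is
      computed in two ways: its weights do not exceed the top one, and it equals
      \<open>s ^ wt \<kappa>0\<close> times U(s) v, where U(s) tends to 1 as \<open>s\<close> tends
      to 0.\<close>
    proof (rule polynomial_limit_at_zero[where K = "cube B" and a = f and k = wt and kmax = "wt \<kappa>0" and Q = "\<lambda>s. act \<rho> n (U s) v i"])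
      fix \<kappa> assume k: "\<kappa> \<in> cube B" "f \<kappa> \<noteq> 0"
      have "\<kappa> \<in> NZ"
      proof (rule ccontr)
        assume "\<kappa> \<notin> NZ"
        then have "\<forall>i<n. \<forall>j<n. c \<kappa> i j = 0" using k(1) unfolding NZ_def by blast
        then show False using k(2) i by (simp add: f_def)
      qed
      then show "wt \<kappa> \<le> wt \<kappa>0" by (rule top)
    next
      fix s :: complex assume s: "s \<noteq> 0"
      let ?g = "diag3 [s ^ d0, s ^ d1, s ^ d2]"
      have "(\<Sum>\<kappa>\<in>cube B. s ^ wt \<kappa> * f \<kappa>) = (\<Sum>k<n. (\<Sum>\<kappa>\<in>cube B. c \<kappa> i k * s ^ wt \<kappa>) * act \<rho> n (upper a b e) v k)"
        unfolding f_def sum_distrib_left sum_distrib_right by (subst sum.swap) (simp add: mult_ac)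
      also have "\<dots> = act \<rho> n ?g (act \<rho> n (upper a b e) v) i"
        unfolding act_def[of _ _ ?g] using s i by (simp add: c mono_wt)
      also have "\<dots> = act \<rho> n (?g * upper a b e) v i"
        using act_mult[OF rep gGL[OF s] upper_GL3 i] by simp
      also have "?g * upper a b e = U s * ?g"
        unfolding U_def by (rule diag3_upper) (use dd in auto)
      also have "act \<rho> n (U s * ?g) v i = act \<rho> n (U s) (act \<rho> n ?g v) i"
        using act_mult[OF rep _ gGL[OF s] i] upper_GL3 by (simp add: U_def)
      also have "\<dots> = act \<rho> n (U s) (\<lambda>j. s ^ wt \<kappa>0 * v j) i"
        by (rule act_cong) (use s torus in \<open>simp add: wl power_add power_mult mult.commute\<close>)
      also have "\<dots> = s ^ wt \<kappa>0 * act \<rho> n (U s) v i" by (rule act_scale)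
      finally show "(\<Sum>\<kappa>\<in>cube B. s ^ wt \<kappa> * f \<kappa>) = s ^ wt \<kappa>0 * act \<rho> n (U s) v i" .
    next
      have "((\<lambda>s. act \<rho> n (U s) v i) \<longlongrightarrow> act \<rho> n (1\<^sub>m 3) v i) (at 0)"
        unfolding act_def U_def
        by (intro tendsto_sum tendsto_mult tendsto_const unipotent_tendsto(1) pfij) (use i dd in auto)
      then show "((\<lambda>s. act \<rho> n (U s) v i) \<longlongrightarrow> v i) (at 0)" using act_one[OF rep i] by simp
    qed simp
    then show ?thesis by (simp add: U_def)
  qed
  have low: "coact \<rho> n \<xi> (lower a b e) i = \<xi> i" if i: "i < n" for a b e i
  proof -
    define U where "U s = lower (a * s ^ (d0 - d1)) (b * s ^ (d0 - d2)) (e * s ^ (d1 - d2))" for s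
    define f where "f \<kappa> = (\<Sum>k<n. coact \<rho> n \<xi> (lower a b e) k * c \<kappa> k i)" for \<kappa>
    have "coact \<rho> n \<xi> (U 1) i = \<xi> i"
    proof (rule polynomial_limit_at_zero[where K = "cube B" and a = f and k = wt and kmax = "wt \<kappa>0" and Q = "\<lambda>s. coact \<rho> n \<xi> (U s) i"])
      fix \<kappa> assume k: "\<kappa> \<in> cube B" "f \<kappa> \<noteq> 0"
      have "\<kappa> \<in> NZ"
      proof (rule ccontr)
        assume "\<kappa> \<notin> NZ"
        then have "\<forall>i<n. \<forall>j<n. c \<kappa> i j = 0" using k(1) unfolding NZ_def by blast
        then show False using k(2) i by (simp add: f_def)
      qed
      then show "wt \<kappa> \<le> wt \<kappa>0" by (rule top)
    next
      fix s :: complex assume s: "s \<noteq> 0"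
      let ?g = "diag3 [s ^ d0, s ^ d1, s ^ d2]"
      have "(\<Sum>\<kappa>\<in>cube B. s ^ wt \<kappa> * f \<kappa>) = (\<Sum>k<n. coact \<rho> n \<xi> (lower a b e) k * (\<Sum>\<kappa>\<in>cube B. c \<kappa> k i * s ^ wt \<kappa>))"
        unfolding f_def sum_distrib_left sum_distrib_right by (subst sum.swap) (simp add: mult_ac)
      also have "\<dots> = coact \<rho> n (coact \<rho> n \<xi> (lower a b e)) ?g i"
        unfolding coact_def[of _ _ _ ?g] using s i by (simp add: c mono_wt)
      also have "\<dots> = coact \<rho> n \<xi> (lower a b e * ?g) i"
        using coact_mult[OF rep lower_GL3 gGL[OF s] i] by simp
      also have "lower a b e * ?g = ?g * U s"
        unfolding U_def by (rule lower_diag3) (use dd in auto)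
      also have "coact \<rho> n \<xi> (?g * U s) i = coact \<rho> n (coact \<rho> n \<xi> ?g) (U s) i"
        using coact_mult[OF rep gGL[OF s] _ i] lower_GL3 by (simp add: U_def)
      also have "\<dots> = coact \<rho> n (\<lambda>j. s ^ wt \<kappa>0 * \<xi> j) (U s) i"
        by (rule coact_cong) (use s torus' in \<open>simp add: wl power_add power_mult mult.commute\<close>)
      also have "\<dots> = s ^ wt \<kappa>0 * coact \<rho> n \<xi> (U s) i" by (rule coact_scale)
      finally show "(\<Sum>\<kappa>\<in>cube B. s ^ wt \<kappa> * f \<kappa>) = s ^ wt \<kappa>0 * coact \<rho> n \<xi> (U s) i" .
    next
      have "((\<lambda>s. coact \<rho> n \<xi> (U s) i) \<longlongrightarrow> coact \<rho> n \<xi> (1\<^sub>m 3) i) (at 0)"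
        unfolding coact_def U_def
        by (intro tendsto_sum tendsto_mult tendsto_const unipotent_tendsto(2) pfij) (use i dd in auto)
      then show "((\<lambda>s. coact \<rho> n \<xi> (U s) i) \<longlongrightarrow> \<xi> i) (at 0)" using coact_one[OF rep i] by simp
    qed simp
    then show ?thesis by (simp add: U_def)
  qed
  have "pair n \<xi> v \<noteq> 0" using ij0 idem[OF ij0(1,2)] by (simp add: pair_def \<xi>_def v_def)
  then show ?thesis using torus torus' up low by (intro exI[of _ v] exI[of _ \<xi>]) auto
qed

section \<open>The dimension from the character\<close>

lemma power_minus_one_eq: "(s::complex) ^ k - 1 = (s - 1) * (\<Sum>i<k. s ^ i)"
  by (simp add: power_diff_1_eq)

text \<open>Principal specialisation: at \<open>(s ^ 2, s, 1)\<close> both alternants factor as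
  Vandermonde products. After cancelling \<open>(s - 1) ^ 3\<close>, the limit at
  \<open>s = 1\<close> gives Weyl's dimension formula.\<close>

lemma schur_rep_dim:
  assumes sch: "schur_rep [m + k, k, 0] n \<rho>"
  shows "2 * n = (m + 1) * (k + 1) * (m + k + 2)"
proof -
  have rep: "poly_rep n \<rho>" using sch unfolding schur_rep_def by blast
  define G where "G j s = (\<Sum>i<j. s ^ i)" for j and s :: complex
  define tr where "tr s = (\<Sum>i<n. \<rho> (diag3 [s ^ 2, s, 1]) $$ (i, i))" for s
  have eq: "tr s * (s * (s + 1)) = s ^ (k + 1) * G (m + 1) s * G (m + k + 2) s * G (k + 1) s"
    if "s \<noteq> 0" "s \<noteq> 1" "s \<noteq> -1" for s
  proof -
    have ne: "s ^ 2 \<noteq> s" "s ^ 2 \<noteq> 1" using that by (auto simp: power2_eq_square square_eq_1_iff)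
    have nz: "\<forall>i<3. [s ^ 2, s, 1] ! i \<noteq> 0" using that by (auto dest!: less3_cases)
    have g: "diag3 [s ^ 2, s, 1] \<in> GL3" using that by (intro diag3_GL3) auto
    then have "\<rho> (diag3 [s ^ 2, s, 1]) \<in> carrier_mat n n" using rep unfolding poly_rep_def by blast
    then have t: "mat_trace (\<rho> (diag3 [s ^ 2, s, 1])) = tr s" by (simp add: mat_trace_def tr_def)
    have ch: "mat_trace (\<rho> (diag3 [s ^ 2, s, 1])) * alternant [0, 0, 0] [s ^ 2, s, 1]
       = alternant [m + k, k, 0] [s ^ 2, s, 1]"
      using sch ne nz that unfolding schur_rep_def by simp
    have alt: "alternant [i, j, 0] [s ^ 2, s, 1]
       = (s ^ (i + 2) - s ^ (j + 1)) * (s ^ (i + 2) - 1) * (s ^ (j + 1) - 1)" for i j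
    proof -
      have p: "(s ^ 2) ^ e = s ^ e * s ^ e" for e by (simp add: power_mult[symmetric] mult_2 power_add)
      have "a * a * (b * 1 - 1 * 1) - b * b * (a * 1 - 1 * 1) + 1 * 1 * (a * 1 - b * 1) = (a - b) * (a - 1) * (b - 1)" for a b :: complex
        by (simp add: algebra_simps)
      then show ?thesis unfolding alternant_eq p power_one power_0 by (simp only: mult_1)
    qed
    have "tr s * ((s ^ 2 - s) * (s ^ 2 - 1) * (s - 1))
      = (s ^ (m + k + 2) - s ^ (k + 1)) * (s ^ (m + k + 2) - 1) * (s ^ (k + 1) - 1)"
      using ch unfolding t alt by (simp only: add_0 power_one_right)
    also have "s ^ (m + k + 2) - s ^ (k + 1) = s ^ (k + 1) * (s ^ (m + 1) - 1)"
      by (simp add: algebra_simps power_add)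
    also have "s ^ (k + 1) * (s ^ (m + 1) - 1) * (s ^ (m + k + 2) - 1) * (s ^ (k + 1) - 1)
      = (s - 1) ^ 3 * (s ^ (k + 1) * G (m + 1) s * G (m + k + 2) s * G (k + 1) s)"
      unfolding power_minus_one_eq[of s "m + 1"] power_minus_one_eq[of s "m + k + 2"] power_minus_one_eq[of s "k + 1"] G_def[symmetric]
      by (simp only: power3_eq_cube mult_ac)
    also have "tr s * ((s ^ 2 - s) * (s ^ 2 - 1) * (s - 1)) = (s - 1) ^ 3 * (tr s * (s * (s + 1)))"
    proof -
      have "s ^ 2 - s = (s - 1) * s" "s ^ 2 - 1 = (s - 1) * (s + 1)"
        by (simp_all add: power2_eq_square algebra_simps)
      then show ?thesis by (simp only: power3_eq_cube mult_ac)
    qed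
    finally have "(s - 1) ^ 3 * (tr s * (s * (s + 1)))
      = (s - 1) ^ 3 * (s ^ (k + 1) * G (m + 1) s * G (m + k + 2) s * G (k + 1) s)" .
    then show ?thesis using that(2) by simp
  qed
  have "((\<lambda>s. tr s * (s * (s + 1))) \<longlongrightarrow> (\<Sum>i<n. \<rho> (1\<^sub>m 3) $$ (i, i)) * (1 * (1 + 1))) (at 1)"
    unfolding tr_def
  proof (intro tendsto_mult tendsto_sum tendsto_add tendsto_ident_at tendsto_const)
    fix i assume "i \<in> {..<n}"
    then have polyfun: "poly_fun3 (\<lambda>g. \<rho> g $$ (i, i))" using rep unfolding poly_rep_def by blast
    show "((\<lambda>s. \<rho> (diag3 [s ^ 2, s, 1]) $$ (i, i)) \<longlongrightarrow> \<rho> (1\<^sub>m 3) $$ (i, i)) (at 1)"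
    proof (rule poly_fun3_tendsto[OF polyfun])
      fix i j :: nat assume "i < 3" "j < 3"
      moreover have "((\<lambda>s. s ^ 2) \<longlongrightarrow> 1 ^ 2) (at (1::complex))" by (intro tendsto_intros)
      ultimately show "((\<lambda>s. diag3 [s ^ 2, s, 1] $$ (i, j)) \<longlongrightarrow> 1\<^sub>m 3 $$ (i, j)) (at 1)"
        by (drule_tac less3_cases, drule_tac less3_cases, elim disjE) (simp_all add: diag3_m3)
    next
      have "\<forall>\<^sub>F s in at (1::complex). s \<noteq> 0" by (rule tendsto_imp_eventually_ne[OF tendsto_ident_at]) simp
      then show "\<forall>\<^sub>F s in at 1. diag3 [s ^ 2, s, 1] \<in> GL3"
        by eventually_elim (rule diag3_GL3, auto)
    qed (rule one_GL3)
  qed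
  moreover have "(\<Sum>i<n. \<rho> (1\<^sub>m 3) $$ (i, i)) = of_nat n" by (simp add: poly_rep_one[OF rep])
  ultimately have l1: "((\<lambda>s. tr s * (s * (s + 1))) \<longlongrightarrow> of_nat n * 2) (at 1)" by simp
  have "((\<lambda>s. s ^ (k + 1) * G (m + 1) s * G (m + k + 2) s * G (k + 1) s)
     \<longlongrightarrow> 1 ^ (k + 1) * G (m + 1) 1 * G (m + k + 2) 1 * G (k + 1) 1) (at 1)"
    unfolding G_def by (intro tendsto_intros)
  moreover have "\<forall>\<^sub>F s in at (1::complex). s \<noteq> 0 \<and> s \<noteq> 1 \<and> s \<noteq> -1"
  proof (intro eventually_conj)
    show "\<forall>\<^sub>F s in at (1::complex). s \<noteq> 0" "\<forall>\<^sub>F s in at (1::complex). s \<noteq> -1"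
      by (rule tendsto_imp_eventually_ne[OF tendsto_ident_at], simp)+
    show "\<forall>\<^sub>F s in at (1::complex). s \<noteq> 1" by (simp add: eventually_at_filter)
  qed
  then have "\<forall>\<^sub>F s in at (1::complex). s ^ (k + 1) * G (m + 1) s * G (m + k + 2) s * G (k + 1) s = tr s * (s * (s + 1))"
    by eventually_elim (rule eq[symmetric], auto)
  ultimately have "((\<lambda>s. tr s * (s * (s + 1))) \<longlongrightarrow> 1 ^ (k + 1) * G (m + 1) 1 * G (m + k + 2) 1 * G (k + 1) 1) (at 1)"
    by (rule Lim_transform_eventually)
  from tendsto_unique[OF at_neq_bot l1 this]
  have "(of_nat (2 * n) :: complex) = of_nat ((m + 1) * (k + 1) * (m + k + 2))"
    by (simp add: G_def algebra_simps)
  then show ?thesis by (simp only: of_nat_eq_iff)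
qed

section \<open>Gauss decomposition, the big cell and matrix coefficients\<close>

definition minor1 :: "complex mat \<Rightarrow> complex" where "minor1 g = g $$ (0,0)"

definition minor2 :: "complex mat \<Rightarrow> complex" where
  "minor2 g = g $$ (0,0) * g $$ (1,1) - g $$ (0,1) * g $$ (1,0)"

text \<open>Elimination with pivots equal to quotients of successive leading minors. The entry
  \<open>a\<close> is made explicit because it becomes a factor of the kernel in
  \<open>tensor_kernel\<close>.\<close>

lemma lower_diag_upper:
  assumes "g \<in> GL3" "minor1 g \<noteq> 0" "minor2 g \<noteq> 0"
  obtains a b c d e f where
    "g = lower a b c * (diag3 [minor1 g, minor2 g / minor1 g, det g / minor2 g] * upper d e f)"
    "a = g $$ (1,0) / minor1 g"
proof -
  define F where "F i j = g $$ (i, j)" for i j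
  have g: "g = m3 F" unfolding F_def by (rule m3_eta[OF GL3_carrier[OF assms(1)]])
  have m: "minor1 g = F 0 0" "minor2 g = F 0 0 * F 1 1 - F 0 1 * F 1 0"
    by (simp_all add: minor1_def minor2_def F_def)
  define p q r where "p = F 0 0" and "q = F 0 0 * F 1 1 - F 0 1 * F 1 0" and "r = det g"
  have nz: "p \<noteq> 0" "q \<noteq> 0" using assms m by (auto simp: p_def q_def)
  have r: "r = F 0 0 * (F 1 1 * F 2 2 - F 1 2 * F 2 1)
     - F 0 1 * (F 1 0 * F 2 2 - F 1 2 * F 2 0) + F 0 2 * (F 1 0 * F 2 1 - F 1 1 * F 2 0)"
    unfolding r_def g det_m3 ..
  define a b d e where "a = F 1 0 / p" and "b = F 2 0 / p" and "d = F 0 1 / p" and "e = F 0 2 / p"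
  define c f where "c = (p * F 2 1 - F 2 0 * F 0 1) / q" and "f = (p * F 1 2 - F 1 0 * F 0 2) / q"
  have f1: "F 0 0 = p" "F 1 0 = a * p" "F 2 0 = b * p" "F 0 1 = p * d" "F 0 2 = p * e"
    using nz by (simp_all add: p_def a_def b_def d_def e_def)
  have f11: "F 1 1 = a * p * d + q / p" using nz f1 by (simp add: q_def field_simps)
  have f12: "F 1 2 = a * p * e + q / p * f"
  proof -
    have "q * f = p * F 1 2 - F 1 0 * F 0 2" using nz by (simp add: f_def)
    then have "p * F 1 2 = p * (a * p * e) + q * f" by (simp only: f1) (simp add: algebra_simps)
    then show ?thesis using nz by (simp add: field_simps)
  qed
  have f21: "F 2 1 = b * p * d + c * (q / p)"
  proof -
    have "q * c = p * F 2 1 - F 2 0 * F 0 1" using nz by (simp add: c_def)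
    then have "p * F 2 1 = p * (b * p * d) + q * c" by (simp only: f1) (simp add: algebra_simps)
    then show ?thesis using nz by (simp add: field_simps)
  qed
  have f22: "F 2 2 = b * p * e + c * (q / p) * f + r / q"
  proof -
    have qp: "q = p * (q / p)" using nz by simp
    have "r = q * (F 2 2 - (b * p * e + c * (q / p) * f))"
      unfolding r f1 f11 f12 f21 by (subst (5) qp) (simp add: algebra_simps)
    then show ?thesis using nz by (simp add: field_simps)
  qed
  have eq: "g = lower a b c * (diag3 [p, q / p, r / q] * upper d e f)"
    unfolding g lower_def upper_def diag3_m3 m3_mult
    by (rule m3_cong, drule less3_cases, drule less3_cases, elim disjE)
      (simp_all add: f1[unfolded One_nat_def] f11[unfolded One_nat_def] f12[unfolded One_nat_def] f21[unfolded One_nat_def] f22 mult.assoc)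
  have pm: "p = minor1 g" "q = minor2 g" "r = det g" by (simp_all add: m p_def q_def r_def)
  show ?thesis
  proof (rule that)
    show "g = lower a b c * (diag3 [minor1 g, minor2 g / minor1 g, det g / minor2 g] * upper d e f)"
      using eq unfolding pm .
    show "a = g $$ (1,0) / minor1 g" by (simp add: a_def F_def p_def minor1_def)
  qed
qed

definition pert :: "complex mat \<Rightarrow> complex \<Rightarrow> complex mat" where
  "pert g s = m3 (\<lambda>i j. g $$ (i, j) + (if i = j then s else 0))"

definition cont3 :: "(complex mat \<Rightarrow> complex) \<Rightarrow> bool" where
  "cont3 F \<longleftrightarrow> (\<forall>g\<in>GL3. ((\<lambda>s. F (pert g s)) \<longlongrightarrow> F g) (at 0))"

lemma pert_carrier: "pert g s \<in> carrier_mat 3 3" by (simp add: pert_def)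

lemma pert_tendsto: "i < 3 \<Longrightarrow> j < 3 \<Longrightarrow> ((\<lambda>s. pert g s $$ (i, j)) \<longlongrightarrow> g $$ (i, j)) (at 0)"
proof -
  assume ij: "i < 3" "j < 3"
  have "((\<lambda>s. g $$ (i, j) + s) \<longlongrightarrow> g $$ (i, j) + 0) (at 0)" by (intro tendsto_intros)
  then show ?thesis using ij by (cases "i = j") (simp_all add: pert_def)
qed

lemma pert_GL3: "g \<in> GL3 \<Longrightarrow> \<forall>\<^sub>F s in at 0. pert g s \<in> GL3"
proof -
  assume g: "g \<in> GL3"
  have "((\<lambda>s. det (pert g s)) \<longlongrightarrow> det g) (at 0)"
    unfolding det_3[OF GL3_carrier[OF g]] det_3[OF pert_carrier]
    by (intro tendsto_intros pert_tendsto) auto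
  moreover have "det g \<noteq> 0" using g by (simp add: GL3_def)
  ultimately have "\<forall>\<^sub>F s in at 0. det (pert g s) \<noteq> 0" by (rule tendsto_imp_eventually_ne)
  then show ?thesis by eventually_elim (simp add: GL3_def pert_def)
qed

lemma cont3_const: "cont3 (\<lambda>g. c)"
  by (simp add: cont3_def)

lemma cont3_index: "i < 3 \<Longrightarrow> j < 3 \<Longrightarrow> cont3 (\<lambda>g. g $$ (i, j))"
  by (simp add: cont3_def pert_tendsto)

lemma cont3_mult: "cont3 F \<Longrightarrow> cont3 G \<Longrightarrow> cont3 (\<lambda>g. F g * G g)"
  unfolding cont3_def by (intro ballI tendsto_mult) auto

lemma cont3_diff: "cont3 F \<Longrightarrow> cont3 G \<Longrightarrow> cont3 (\<lambda>g. F g - G g)"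
  unfolding cont3_def by (intro ballI tendsto_diff) auto

lemma cont3_power: "cont3 F \<Longrightarrow> cont3 (\<lambda>g. F g ^ k)"
  unfolding cont3_def by (intro ballI tendsto_power) auto

lemma cont3_sum: "(\<And>x. x \<in> A \<Longrightarrow> cont3 (F x)) \<Longrightarrow> cont3 (\<lambda>g. \<Sum>x\<in>A. F x g)"
  unfolding cont3_def by (intro ballI tendsto_sum) auto

lemma poly_fun3_cont3: "poly_fun3 f \<Longrightarrow> cont3 f"
  unfolding cont3_def by (rule ballI, rule poly_fun3_tendsto, assumption, rule pert_tendsto, assumption+, rule pert_GL3, assumption+)

text \<open>Along the line g + s I the two leading minors are monic polynomials in \<open>s\<close>,
  so all small nonzero \<open>s\<close> give points of the big cell, and the equality passes to the
  limit.\<close>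

lemma bigcell_extension:
  assumes "cont3 F" "cont3 G"
    and eq: "\<And>x. x \<in> GL3 \<Longrightarrow> minor1 x \<noteq> 0 \<Longrightarrow> minor2 x \<noteq> 0 \<Longrightarrow> F x = G x"
    and g: "g \<in> GL3"
  shows "F g = G g"
proof -
  let ?p = "[:g $$ (0,0), 1:]"
  let ?q = "[:g $$ (0,0) * g $$ (1,1) - g $$ (0,1) * g $$ (1,0), g $$ (0,0) + g $$ (1,1), 1:]"
  have fin: "finite {s. poly (?p * ?q) s = 0}" proof (rule poly_roots_finite)
    show "?p * ?q \<noteq> 0" unfolding mult_eq_0_iff by simp
  qed
  have "\<forall>\<^sub>F s in at 0. \<forall>r\<in>{s. poly (?p * ?q) s = 0}. s \<noteq> r"
    by (rule eventually_ball_finite[OF fin], rule ballI, rule eventually_neq_at_within)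
  moreover have "\<forall>\<^sub>F s in at 0. pert g s \<in> GL3" by (rule pert_GL3[OF g])
  ultimately have "\<forall>\<^sub>F s in at 0. F (pert g s) = G (pert g s)"
  proof eventually_elim
    case (elim s)
    have "poly (?p * ?q) s \<noteq> 0" using elim(1) by blast
    then have "poly ?p s \<noteq> 0" "poly ?q s \<noteq> 0" unfolding poly_mult mult_eq_0_iff by blast+
    moreover have p: "poly ?p s = minor1 (pert g s)" by (simp add: minor1_def pert_def)
    moreover have q: "poly ?q s = minor2 (pert g s)" by (simp add: minor2_def pert_def algebra_simps)
    ultimately have "minor1 (pert g s) \<noteq> 0" "minor2 (pert g s) \<noteq> 0" by metis+
    then show ?case by (rule eq[OF elim(2)])
  qed
  then have FG: "\<forall>\<^sub>F s in at 0. F (pert g s) = G (pert g s)" .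
  have F: "((\<lambda>s. F (pert g s)) \<longlongrightarrow> F g) (at 0)" and G: "((\<lambda>s. G (pert g s)) \<longlongrightarrow> G g) (at 0)"
    using assms unfolding cont3_def by blast+
  show ?thesis by (rule tendsto_unique[OF at_neq_bot Lim_transform_eventually[OF F FG] G])
qed

definition hw_data :: "nat \<Rightarrow> nat \<Rightarrow> nat \<Rightarrow> (complex mat \<Rightarrow> complex mat) \<Rightarrow> (nat \<Rightarrow> complex) \<Rightarrow> (nat \<Rightarrow> complex) \<Rightarrow> bool" where
  "hw_data l0 l1 n \<rho> v \<xi> \<longleftrightarrow> poly_rep n \<rho> \<and> pair n \<xi> v \<noteq> 0 \<and>
    (\<forall>x y z i. x \<noteq> 0 \<longrightarrow> y \<noteq> 0 \<longrightarrow> z \<noteq> 0 \<longrightarrow> i < n \<longrightarrow> act \<rho> n (diag3 [x, y, z]) v i = x ^ l0 * y ^ l1 * v i) \<and>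
    (\<forall>a b c i. i < n \<longrightarrow> act \<rho> n (upper a b c) v i = v i) \<and>
    (\<forall>x y z i. x \<noteq> 0 \<longrightarrow> y \<noteq> 0 \<longrightarrow> z \<noteq> 0 \<longrightarrow> i < n \<longrightarrow> coact \<rho> n \<xi> (diag3 [x, y, z]) i = x ^ l0 * y ^ l1 * \<xi> i) \<and>
    (\<forall>a b c i. i < n \<longrightarrow> coact \<rho> n \<xi> (lower a b c) i = \<xi> i)"

lemma hw_dataD:
  assumes "hw_data l0 l1 n \<rho> v \<xi>"
  shows "poly_rep n \<rho>" "pair n \<xi> v \<noteq> 0"
    "\<And>x y z i. x \<noteq> 0 \<Longrightarrow> y \<noteq> 0 \<Longrightarrow> z \<noteq> 0 \<Longrightarrow> i < n \<Longrightarrow> act \<rho> n (diag3 [x, y, z]) v i = x ^ l0 * y ^ l1 * v i"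
    "\<And>a b c i. i < n \<Longrightarrow> act \<rho> n (upper a b c) v i = v i"
    "\<And>x y z i. x \<noteq> 0 \<Longrightarrow> y \<noteq> 0 \<Longrightarrow> z \<noteq> 0 \<Longrightarrow> i < n \<Longrightarrow> coact \<rho> n \<xi> (diag3 [x, y, z]) i = x ^ l0 * y ^ l1 * \<xi> i"
    "\<And>a b c i. i < n \<Longrightarrow> coact \<rho> n \<xi> (lower a b c) i = \<xi> i"
  using assms by (simp_all add: hw_data_def)

lemma hw_act_diag_upper:
  assumes hw: "hw_data l0 l1 n \<rho> v \<xi>" and nz: "x \<noteq> 0" "y \<noteq> 0" "z \<noteq> 0" and i: "i < n"
  shows "act \<rho> n (diag3 [x, y, z] * upper d e f) v i = x ^ l0 * y ^ l1 * v i"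
proof -
  have "act \<rho> n (diag3 [x, y, z] * upper d e f) v i = act \<rho> n (diag3 [x, y, z]) (act \<rho> n (upper d e f) v) i"
    by (rule act_mult[OF hw_dataD(1)[OF hw] diag3_GL3[OF nz] upper_GL3 i])
  also have "\<dots> = act \<rho> n (diag3 [x, y, z]) v i"
    by (rule act_cong) (rule hw_dataD(4)[OF hw])
  finally show ?thesis using hw_dataD(3)[OF hw nz i] by simp
qed

lemma pair_cong_left: "(\<And>j. j < n \<Longrightarrow> v j = w j) \<Longrightarrow> pair n v x = pair n w x"
  by (simp add: pair_def)

lemma pair_scale_left: "pair n (\<lambda>j. c * v j) w = c * pair n v w"
  by (simp add: pair_def sum_distrib_left mult.assoc)

lemma minor1_cont3: "cont3 minor1"
  unfolding minor1_def[abs_def] by (rule cont3_index) simp_all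

lemma minor2_cont3: "cont3 minor2"
  unfolding minor2_def[abs_def] by (intro cont3_diff cont3_mult cont3_index) simp_all

lemma act_cont3:
  assumes "poly_rep n \<rho>" "i < n"
  shows "cont3 (\<lambda>g. act \<rho> n g v i)"
  unfolding act_def
proof (rule cont3_sum)
  fix j assume "j \<in> {..<n}"
  then have "poly_fun3 (\<lambda>g. \<rho> g $$ (i, j))" using assms unfolding poly_rep_def by blast
  then show "cont3 (\<lambda>g. \<rho> g $$ (i, j) * v j)" by (intro cont3_mult[OF poly_fun3_cont3] cont3_const)
qed

lemma power_quotient_minors:
  "p \<noteq> 0 \<Longrightarrow> p ^ (m + k) * (q / p) ^ k = p ^ m * (q :: complex) ^ k"
  by (simp add: power_divide power_add)

lemma GL3_det_nonzero: "g \<in> GL3 \<Longrightarrow> det g \<noteq> 0" by (simp add: GL3_def)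

lemma diag3_mult_one: "diag3 [x, y, z] * 1\<^sub>m 3 = diag3 [x, y, z]"
  by (rule right_mult_one_mat[of _ 3 3]) (simp add: diag3_m3)

text \<open>On the big cell the lower factor is absorbed by \<open>\<xi>\<close>, the upper one by
  \<open>v\<close>, and the torus acts by its weight. The third pivot does not appear because the
  third part of the partition is 0.\<close>

lemma matrix_coefficient:
  assumes hw: "hw_data (m + k) k n \<rho> v \<xi>" and g: "g \<in> GL3"
  shows "pair n \<xi> (act \<rho> n g v) = pair n \<xi> v * minor1 g ^ m * minor2 g ^ k"
proof (rule bigcell_extension[OF _ _ _ g])
  show "cont3 (\<lambda>g. pair n \<xi> (act \<rho> n g v))"
    unfolding pair_def using act_cont3[OF hw_dataD(1)[OF hw]]
    by (intro cont3_sum cont3_mult cont3_const) auto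
  show "cont3 (\<lambda>g. pair n \<xi> v * minor1 g ^ m * minor2 g ^ k)"
    by (intro cont3_mult cont3_const cont3_power minor1_cont3 minor2_cont3)
  fix x assume x: "x \<in> GL3" "minor1 x \<noteq> 0" "minor2 x \<noteq> 0"
  obtain a b c d e f where ldu: "x = lower a b c * (diag3 [minor1 x, minor2 x / minor1 x, det x / minor2 x] * upper d e f)"
    by (rule lower_diag_upper[OF x])
  let ?D = "diag3 [minor1 x, minor2 x / minor1 x, det x / minor2 x]"
  have nz: "minor1 x \<noteq> 0" "minor2 x / minor1 x \<noteq> 0" "det x / minor2 x \<noteq> 0"
    using x GL3_det_nonzero by auto
  have DU: "?D * upper d e f \<in> GL3" by (intro GL3_mult diag3_GL3 upper_GL3 nz)
  have "pair n \<xi> (act \<rho> n x v) = pair n \<xi> (act \<rho> n (lower a b c) (act \<rho> n (?D * upper d e f) v))"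
  proof (rule pair_cong)
    fix j assume "j < n"
    have "act \<rho> n x v j = act \<rho> n (lower a b c * (?D * upper d e f)) v j"
      by (rule arg_cong[OF ldu, where f = "\<lambda>y. act \<rho> n y v j"])
    also have "\<dots> = act \<rho> n (lower a b c) (act \<rho> n (?D * upper d e f) v) j"
      by (rule act_mult[OF hw_dataD(1)[OF hw] lower_GL3 DU \<open>j < n\<close>])
    finally show "act \<rho> n x v j = act \<rho> n (lower a b c) (act \<rho> n (?D * upper d e f) v) j" .
  qed
  also have "\<dots> = pair n (coact \<rho> n \<xi> (lower a b c)) (act \<rho> n (?D * upper d e f) v)"
    by (simp add: pair_coact)
  also have "\<dots> = pair n \<xi> (act \<rho> n (?D * upper d e f) v)"
    by (rule pair_cong_left) (rule hw_dataD(6)[OF hw])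
  also have "\<dots> = pair n \<xi> (\<lambda>i. (minor1 x ^ (m + k) * (minor2 x / minor1 x) ^ k) * v i)"
    by (rule pair_cong) (rule hw_act_diag_upper[OF hw nz])
  also have "\<dots> = minor1 x ^ m * minor2 x ^ k * pair n \<xi> v"
    unfolding pair_scale power_quotient_minors[OF x(2)] ..
  finally show "pair n \<xi> (act \<rho> n x v) = pair n \<xi> v * minor1 x ^ m * minor2 x ^ k" by simp
qed

section \<open>The kernel of the invariant tensor\<close>

definition rowv :: "complex mat \<Rightarrow> nat \<Rightarrow> nat \<Rightarrow> complex" where "rowv g i j = g $$ (i, j)"
definition colv :: "complex mat \<Rightarrow> nat \<Rightarrow> nat \<Rightarrow> complex" where "colv g j i = g $$ (i, j)"

lemma mult_index_vdot:
  "g \<in> GL3 \<Longrightarrow> h \<in> GL3 \<Longrightarrow> i < 3 \<Longrightarrow> j < 3 \<Longrightarrow> (g * h) $$ (i, j) = vdot (rowv g i) (colv h j)"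
  by (subst mult_index3) (auto simp: GL3_carrier vdot_def rowv_def colv_def)

lemma minor1_mult: "g \<in> GL3 \<Longrightarrow> h \<in> GL3 \<Longrightarrow> minor1 (g * h) = vdot (rowv g 0) (colv h 0)"
  by (simp add: minor1_def mult_index_vdot)

text \<open>The Cauchy-Binet formula: the cross products collect the 2 by 2 minors of two rows or
  two columns.\<close>

lemma minor2_mult:
  "g \<in> GL3 \<Longrightarrow> h \<in> GL3 \<Longrightarrow>
   minor2 (g * h) = vdot (cross (rowv g 0) (rowv g 1)) (cross (colv h 0) (colv h 1))"
  by (simp add: minor2_def mult_index_vdot) (simp add: vdot_def algebra_simps)

text \<open>With second row \<open>e\<close> such that \<open>x \<times> e = y\<close> and third row
  \<open>cnj y\<close>, the determinant is \<open>y \<cdot> cnj y \<noteq> 0\<close>. Thus every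
  nondegenerate point of the cone comes from a group element.\<close>

lemma GL3_with_rows:
  assumes "vdot x y = 0" "nz3 x" "nz3 y"
  shows "\<exists>g\<in>GL3. (\<forall>i<3. rowv g 0 i = x i) \<and> (\<forall>i<3. cross (rowv g 0) (rowv g 1) i = y i)"
proof -
  obtain e where e: "\<And>i. i < 3 \<Longrightarrow> cross x e i = y i" using orthogonal_imp_cross[OF assms(2,1)] by blast
  let ?g = "m3 (\<lambda>i j. if i = 0 then x j else if i = 1 then e j else cnj (y j))"
  have r: "rowv ?g 0 i = x i" "rowv ?g 1 i = e i" if "i < 3" for i
    using that by (simp_all add: rowv_def)
  have "det ?g = vdot (cross x e) (\<lambda>i. cnj (y i))"
    by (simp add: det_m3 vdot_def algebra_simps)
  also have "\<dots> = vdot y (\<lambda>i. cnj (y i))"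
    using e[of 0] e[of "Suc 0"] e[of 2] unfolding vdot_def by (simp del: cross_simps)
  finally have "?g \<in> GL3" using nz3_vdot_cnj[OF assms(3)] by (simp add: GL3_def)
  moreover have "cross (rowv ?g 0) (rowv ?g 1) i = cross x e i" if "i < 3" for i
    using less3_cases[OF that] r by (elim disjE) simp_all
  ultimately show ?thesis using r e by (intro bexI[of _ ?g]) auto
qed

lemma GL3_with_cols:
  assumes "vdot x y = 0" "nz3 x" "nz3 y"
  shows "\<exists>g\<in>GL3. (\<forall>i<3. colv g 0 i = x i) \<and> (\<forall>i<3. cross (colv g 0) (colv g 1) i = y i)"
proof -
  obtain g where g: "g \<in> GL3" "\<forall>i<3. rowv g 0 i = x i" "\<forall>i<3. cross (rowv g 0) (rowv g 1) i = y i"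
    using GL3_with_rows[OF assms] by blast
  let ?h = "transpose_mat g"
  have car: "g \<in> carrier_mat 3 3" using g by (simp add: GL3_carrier)
  have h: "?h \<in> GL3" using g(1) car by (simp add: GL3_def det_transpose)
  have c: "colv ?h j i = rowv g j i" if "i < 3" "j < 3" for i j
    using that car by (simp add: colv_def rowv_def)
  have "cross (colv ?h 0) (colv ?h 1) i = cross (rowv g 0) (rowv g 1) i" if "i < 3" for i
    using less3_cases[OF that] c by (elim disjE) simp_all
  then show ?thesis using h c g by (intro bexI[of _ ?h]) auto
qed

lemma vdot_cong3: "(\<And>i. i < 3 \<Longrightarrow> x i = x' i) \<Longrightarrow> (\<And>i. i < 3 \<Longrightarrow> y i = y' i) \<Longrightarrow> vdot x y = vdot x' y'"
  by (simp add: vdot_def)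

text \<open>A zero vector either kills the function or occurs with exponent 0 and can be replaced by
  a nonzero orthogonal one. This bridges the generators of \<open>cone_span\<close> and group
  elements, whose vectors are nonzero.\<close>

lemma cone_function_nonzero:
  assumes "vdot u z = 0" "0 < m + k"
  shows "(\<forall>x y. vdot x u ^ m * vdot y z ^ k = 0) \<or>
    (\<exists>u' z'. vdot u' z' = 0 \<and> nz3 u' \<and> nz3 z' \<and> (\<forall>x y. vdot x u' ^ m * vdot y z' ^ k = vdot x u ^ m * vdot y z ^ k))"
proof -
  have z0: "vdot x w = 0" if "\<not> nz3 w" for x w using that by (simp add: vdot_def nz3_def)
  consider "nz3 u" "nz3 z" | "\<not> nz3 u" "0 < m" | "\<not> nz3 z" "0 < k" | "\<not> nz3 u" "m = 0" "nz3 z" | "\<not> nz3 z" "k = 0" "nz3 u"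
    using assms(2) by auto
  then show ?thesis
  proof cases
    case 1 then show ?thesis using assms(1) by blast
  next
    case 2 then show ?thesis using z0[OF 2(1)] by simp
  next
    case 3 then show ?thesis using z0[OF 3(1)] by simp
  next
    case 4
    obtain u' where "nz3 u'" "vdot u' z = 0" using exists_orthogonal by blast
    then show ?thesis using 4 by (intro disjI2 exI[of _ u'] exI[of _ z]) simp
  next
    case 5
    obtain z' where "nz3 z'" "vdot z' u = 0" using exists_orthogonal by blast
    then show ?thesis using 5 by (intro disjI2 exI[of _ u] exI[of _ z']) (simp add: vdot_commute)
  qed
qed

lemma pair_add_right: "pair n x (\<lambda>j. v j + w j) = pair n x v + pair n x w"
  by (simp add: pair_def algebra_simps sum.distrib)

lemma pair_zero_right: "pair n x (\<lambda>j. 0) = 0"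
  by (simp add: pair_def)

lemma pair_sum_right: "pair n x (\<lambda>j. \<Sum>r\<in>I. \<alpha> r * w r j) = (\<Sum>r\<in>I. \<alpha> r * pair n x (w r))"
proof -
  have "pair n x (\<lambda>j. \<Sum>r\<in>I. \<alpha> r * w r j) = (\<Sum>j<n. \<Sum>r\<in>I. \<alpha> r * (x j * w r j))"
    by (simp add: pair_def sum_distrib_left mult_ac)
  also have "\<dots> = (\<Sum>r\<in>I. \<Sum>j<n. \<alpha> r * (x j * w r j))" by (rule sum.swap)
  finally show ?thesis by (simp add: pair_def sum_distrib_left)
qed

text \<open>If \<open>\<tau> \<noteq> 0\<close> killed all vectors \<open>q u z\<close>, every
  function on the cone would be represented by a vector in a hyperplane of dimension n - 1, whereas
  there are n independent standard monomials.\<close>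

lemma kernel_spanning:
  fixes p q :: "(nat \<Rightarrow> complex) \<Rightarrow> (nat \<Rightarrow> complex) \<Rightarrow> nat \<Rightarrow> complex"
  assumes ker: "\<And>x y u z. vdot x y = 0 \<Longrightarrow> nz3 x \<Longrightarrow> nz3 y \<Longrightarrow> vdot u z = 0 \<Longrightarrow> nz3 u \<Longrightarrow> nz3 z \<Longrightarrow>
      pair n (p x y) (q u z) = \<kappa> * vdot x u ^ m * vdot y z ^ k"
    and \<kappa>: "\<kappa> \<noteq> 0" and mk: "0 < m + k" and n: "2 * n = (m + 1) * (k + 1) * (m + k + 2)"
    and tau: "\<And>u z. vdot u z = 0 \<Longrightarrow> nz3 u \<Longrightarrow> nz3 z \<Longrightarrow> pair n \<tau> (q u z) = 0"
    and i: "i < n"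
  shows "\<tau> i = 0"
proof (rule ccontr)
  assume ti: "\<tau> i \<noteq> 0"
  have rep: "\<exists>w. pair n \<tau> w = 0 \<and> (\<forall>a. dot X Y a = 0 \<longrightarrow> nz3 (a X) \<longrightarrow> nz3 (a Y) \<longrightarrow> f a = pair n (p (a X) (a Y)) w)"
    if "cone_span X Y m' k' f" "m' = m" "k' = k" for m' k' f
    using that
  proof (induction rule: cone_span.induct)
    case (cone_span_base u z m' k')
    show ?case
    proof (cases "\<forall>x y. vdot x u ^ m * vdot y z ^ k = 0")
      case True
      then have "vdot x u ^ m' * vdot y z ^ k' = 0" for x y unfolding cone_span_base.prems by blast
      then show ?thesis by (intro exI[of _ "\<lambda>_. 0"]) (simp only: pair_zero_right simp_thms)
    next
      case False
      obtain u' z' where uz: "vdot u' z' = 0" "nz3 u'" "nz3 z'"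
        "\<forall>x y. vdot x u' ^ m * vdot y z' ^ k = vdot x u ^ m * vdot y z ^ k"
        using cone_function_nonzero[OF cone_span_base(1) mk] False by blast
      show ?thesis
      proof (intro exI[of _ "\<lambda>j. inverse \<kappa> * q u' z' j"] conjI allI impI)
        show "pair n \<tau> (\<lambda>j. inverse \<kappa> * q u' z' j) = 0" using tau[OF uz(1-3)] by (simp add: pair_scale)
        fix a :: pt assume a: "dot X Y a = 0" "nz3 (a X)" "nz3 (a Y)"
        have "vdot (a X) (a Y) = 0" using a(1) by (simp add: dot_def vdot_def)
        from ker[OF this a(2,3) uz(1-3)]
        show "vdot (a X) u ^ m' * vdot (a Y) z ^ k' = pair n (p (a X) (a Y)) (\<lambda>j. inverse \<kappa> * q u' z' j)"
          using uz(4) \<kappa> cone_span_base by (simp add: pair_scale mult.assoc)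
      qed
    qed
  next
    case (cone_span_add m' k' f g)
    obtain w w' where "pair n \<tau> w = 0" "\<forall>a. dot X Y a = 0 \<longrightarrow> nz3 (a X) \<longrightarrow> nz3 (a Y) \<longrightarrow> f a = pair n (p (a X) (a Y)) w"
      "pair n \<tau> w' = 0" "\<forall>a. dot X Y a = 0 \<longrightarrow> nz3 (a X) \<longrightarrow> nz3 (a Y) \<longrightarrow> g a = pair n (p (a X) (a Y)) w'"
      using cone_span_add by blast
    then show ?case by (intro exI[of _ "\<lambda>j. w j + w' j"]) (simp add: pair_add_right)
  next
    case (cone_span_cmult m' k' f c)
    obtain w where "pair n \<tau> w = 0" "\<forall>a. dot X Y a = 0 \<longrightarrow> nz3 (a X) \<longrightarrow> nz3 (a Y) \<longrightarrow> f a = pair n (p (a X) (a Y)) w"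
      using cone_span_cmult by blast
    then show ?case by (intro exI[of _ "\<lambda>j. c * w j"]) (simp add: pair_scale)
  next
    case (cone_span_ideal m' k' h)
    show ?case by (intro exI[of _ "\<lambda>_. 0"]) (simp add: pair_zero_right)
  qed
  have "\<exists>w. pair n \<tau> w = 0 \<and> (\<forall>a. dot X Y a = 0 \<longrightarrow> nz3 (a X) \<longrightarrow> nz3 (a Y) \<longrightarrow> smon m k r (a X) (a Y) = pair n (p (a X) (a Y)) w)"
    if "r \<in> std m k" for r
  proof -
    have XY: "X \<noteq> Y" by simp
    have "cone_span X Y (bideg X Y m k X) (bideg X Y m k Y) (\<lambda>a. smon m k r (a X) (a Y))"
      by (rule multihom_imp_cone_span[OF multihom_smon[OF that XY] XY]) (simp add: bideg_def)
    from rep[OF this] show ?thesis by (simp add: bideg_def)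
  qed
  then obtain w where w: "\<And>r. r \<in> std m k \<Longrightarrow> pair n \<tau> (w r) = 0"
    "\<And>r a. r \<in> std m k \<Longrightarrow> dot X Y a = 0 \<Longrightarrow> nz3 (a X) \<Longrightarrow> nz3 (a Y) \<Longrightarrow> smon m k r (a X) (a Y) = pair n (p (a X) (a Y)) (w r)"
    by metis
  have cs: "card (std m k) = n" using card_std[of m k] n by simp
  \<comment> \<open>Leaving out coordinate \<open>i\<close> gives fewer equations than unknowns;
    that coordinate of the combination vanishes afterwards, because \<open>\<tau>\<close> kills it
    and \<open>\<tau> i \<noteq> 0\<close>.\<close>
  have "card ({..<n} - {i}) < card (std m k)" using i cs by simp
  from wide_system_kernel[OF _ finite_std(1) this, of "\<lambda>j r. w r j"] obtain \<alpha> where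
    \<alpha>: "\<exists>r\<in>std m k. \<alpha> r \<noteq> 0" "\<And>j. j < n \<Longrightarrow> j \<noteq> i \<Longrightarrow> (\<Sum>r\<in>std m k. \<alpha> r * w r j) = 0" by auto
  define W where "W j = (\<Sum>r\<in>std m k. \<alpha> r * w r j)" for j
  have "pair n \<tau> W = 0" unfolding W_def pair_sum_right using w(1) by simp
  moreover have "pair n \<tau> W = \<tau> i * W i"
  proof -
    have "pair n \<tau> W = (\<Sum>j<n. if j = i then \<tau> i * W i else 0)"
      unfolding pair_def using \<alpha>(2) by (intro sum.cong) (auto simp: W_def)
    then show ?thesis using i by simp
  qed
  ultimately have Wi: "W i = 0" using ti by simp
  have W0: "W j = 0" if "j < n" for j using \<alpha>(2) Wi that by (cases "j = i") (auto simp: W_def)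
  have "\<alpha> r = 0" if "r \<in> std m k" for r
  proof (rule std_independent[OF _ that])
    fix x y :: "nat \<Rightarrow> complex" assume xy: "vdot x y = 0" "x 2 = 1" "y 2 = 1"
    define a :: pt where "a = (\<lambda>_. x)(Y := y)"
    have a: "dot X Y a = 0" "nz3 (a X)" "nz3 (a Y)" "a X = x" "a Y = y"
      using xy by (simp_all add: a_def dot_def vdot_def nz3_def)
    have "(\<Sum>r\<in>std m k. \<alpha> r * smon m k r x y) = (\<Sum>r\<in>std m k. \<alpha> r * pair n (p x y) (w r))"
      using w(2)[OF _ a(1-3)] a(4,5) by simp
    also have "\<dots> = pair n (p x y) W" unfolding W_def pair_sum_right ..
    also have "\<dots> = 0" unfolding pair_def using W0 by simp
    finally show "(\<Sum>r\<in>std m k. \<alpha> r * smon m k r x y) = 0" .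
  qed
  then show False using \<alpha>(1) by blast
qed

lemma pair_commute: "pair n x y = pair n y x"
  by (simp add: pair_def mult.commute)

text \<open>The kernel (x\<cdot>u)^m (y\<cdot>z)^k is symmetric under exchange of its two pairs, so
  the spanning argument applies both to the orbit of \<open>v\<close> and to the orbit of
  \<open>\<xi>\<close>.\<close>

lemma hw_spanning:
  assumes hw: "hw_data (m + k) k n \<rho> v \<xi>" and mk: "0 < m + k"
    and n: "2 * n = (m + 1) * (k + 1) * (m + k + 2)" and i: "i < n"
  shows "(\<And>h. h \<in> GL3 \<Longrightarrow> pair n \<tau> (act \<rho> n h v) = 0) \<Longrightarrow> \<tau> i = 0"
    and "(\<And>g. g \<in> GL3 \<Longrightarrow> pair n (coact \<rho> n \<xi> g) \<tau> = 0) \<Longrightarrow> \<tau> i = 0"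
proof -
  define gg where "gg x y = (SOME g. g \<in> GL3 \<and> (\<forall>i<3. rowv g 0 i = x i) \<and> (\<forall>i<3. cross (rowv g 0) (rowv g 1) i = y i))" for x y
  define hh where "hh x y = (SOME g. g \<in> GL3 \<and> (\<forall>i<3. colv g 0 i = x i) \<and> (\<forall>i<3. cross (colv g 0) (colv g 1) i = y i))" for x y
  have gg: "gg x y \<in> GL3 \<and> (\<forall>i<3. rowv (gg x y) 0 i = x i) \<and> (\<forall>i<3. cross (rowv (gg x y) 0) (rowv (gg x y) 1) i = y i)"
    if "vdot x y = 0" "nz3 x" "nz3 y" for x y
    unfolding gg_def by (rule someI_ex) (use GL3_with_rows[OF that] in blast)
  have hh: "hh x y \<in> GL3 \<and> (\<forall>i<3. colv (hh x y) 0 i = x i) \<and> (\<forall>i<3. cross (colv (hh x y) 0) (colv (hh x y) 1) i = y i)"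
    if "vdot x y = 0" "nz3 x" "nz3 y" for x y
    unfolding hh_def by (rule someI_ex) (use GL3_with_cols[OF that] in blast)
  have ker: "pair n (coact \<rho> n \<xi> (gg x y)) (act \<rho> n (hh u z) v) = pair n \<xi> v * vdot x u ^ m * vdot y z ^ k"
    if "vdot x y = 0" "nz3 x" "nz3 y" "vdot u z = 0" "nz3 u" "nz3 z" for x y u z
  proof -
    note g = gg[OF that(1-3)] and h = hh[OF that(4-6)]
    have "pair n (coact \<rho> n \<xi> (gg x y)) (act \<rho> n (hh u z) v) = pair n \<xi> (act \<rho> n (gg x y * hh u z) v)"
      unfolding pair_coact by (rule pair_cong) (use act_mult[OF hw_dataD(1)[OF hw]] g h in simp)
    also have "\<dots> = pair n \<xi> v * minor1 (gg x y * hh u z) ^ m * minor2 (gg x y * hh u z) ^ k"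
      using g h by (intro matrix_coefficient[OF hw] GL3_mult) auto
    also have "minor1 (gg x y * hh u z) = vdot x u"
      using g h by (subst minor1_mult) (auto intro: vdot_cong3)
    also have "minor2 (gg x y * hh u z) = vdot y z"
      using g h by (subst minor2_mult) (auto intro: vdot_cong3)
    finally show ?thesis .
  qed
  show "\<tau> i = 0" if "\<And>h. h \<in> GL3 \<Longrightarrow> pair n \<tau> (act \<rho> n h v) = 0"
    by (rule kernel_spanning[OF ker hw_dataD(2)[OF hw] mk n _ i]) (use that hh in auto)
  show "\<tau> i = 0" if g0: "\<And>g. g \<in> GL3 \<Longrightarrow> pair n (coact \<rho> n \<xi> g) \<tau> = 0"
  proof (rule kernel_spanning[where p = "\<lambda>u z. act \<rho> n (hh u z) v" and q = "\<lambda>x y. coact \<rho> n \<xi> (gg x y)", OF _ hw_dataD(2)[OF hw] mk n _ i])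
    fix x y u z :: "nat \<Rightarrow> complex"
    assume "vdot x y = 0" "nz3 x" "nz3 y" "vdot u z = 0" "nz3 u" "nz3 z"
    then show "pair n (act \<rho> n (hh x y) v) (coact \<rho> n \<xi> (gg u z)) = pair n \<xi> v * vdot x u ^ m * vdot y z ^ k"
      using ker[of u z x y] by (simp add: pair_commute[of n "act \<rho> n (hh x y) v"] vdot_commute)
  next
    fix u z :: "nat \<Rightarrow> complex" assume "vdot u z = 0" "nz3 u" "nz3 z"
    then show "pair n \<tau> (coact \<rho> n \<xi> (gg u z)) = 0"
      using g0 gg by (simp add: pair_commute[of n \<tau>])
  qed
qed

section \<open>The invariant tensor on highest weight orbits\<close>

definition Tw :: "(nat \<Rightarrow> nat \<Rightarrow> nat \<Rightarrow> complex) \<Rightarrow> nat \<Rightarrow> nat \<Rightarrow> (nat \<Rightarrow> complex) \<Rightarrow> nat \<Rightarrow> complex" where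
  "Tw T n i w k = (\<Sum>j<n. T i j k * w j)"

lemma Tw_cong: "(\<And>j. j < n \<Longrightarrow> v j = w j) \<Longrightarrow> Tw T n i v k = Tw T n i w k"
  by (simp add: Tw_def)

lemma Tw_scale: "Tw T n i (\<lambda>j. c * w j) k = c * Tw T n i w k"
  by (simp add: Tw_def sum_distrib_left mult.left_commute)

lemma Tw_equivariant:
  assumes inv: "gl_invariant n1 n2 \<rho>1 \<rho>2 T" and "g \<in> GL3" "i < 3" "k < n2"
  shows "act \<rho>2 n2 g (Tw T n1 i w) k = (\<Sum>i'<3. g $$ (i', i) * Tw T n1 i' (act \<rho>1 n1 g w) k)"
proof -
  have inv': "(\<Sum>k'<n2. \<rho>2 g $$ (k, k') * T i j k') = (\<Sum>i'<3. \<Sum>j'<n1. g $$ (i', i) * \<rho>1 g $$ (j', j) * T i' j' k)"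
    if "j < n1" for j using assms that unfolding gl_invariant_def by blast
  have "act \<rho>2 n2 g (Tw T n1 i w) k = (\<Sum>k'<n2. \<Sum>j<n1. \<rho>2 g $$ (k, k') * T i j k' * w j)"
    by (simp add: act_def Tw_def sum_distrib_left mult.assoc)
  also have "\<dots> = (\<Sum>j<n1. (\<Sum>k'<n2. \<rho>2 g $$ (k, k') * T i j k') * w j)"
    by (subst sum.swap) (simp add: sum_distrib_right)
  also have "\<dots> = (\<Sum>j<n1. \<Sum>i'<3. \<Sum>j'<n1. g $$ (i', i) * (T i' j' k * (\<rho>1 g $$ (j', j) * w j)))"
  proof (rule sum.cong[OF refl])
    fix j assume "j \<in> {..<n1}"
    then have "j < n1" by simp
    show "(\<Sum>k'<n2. \<rho>2 g $$ (k, k') * T i j k') * w j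
      = (\<Sum>i'<3. \<Sum>j'<n1. g $$ (i', i) * (T i' j' k * (\<rho>1 g $$ (j', j) * w j)))"
      unfolding inv'[OF \<open>j < n1\<close>] by (simp add: sum_distrib_right sum_distrib_left mult_ac)
  qed
  also have "\<dots> = (\<Sum>i'<3. \<Sum>j<n1. \<Sum>j'<n1. g $$ (i', i) * (T i' j' k * (\<rho>1 g $$ (j', j) * w j)))"
    by (rule sum.swap)
  also have "\<dots> = (\<Sum>i'<3. \<Sum>j'<n1. \<Sum>j<n1. g $$ (i', i) * (T i' j' k * (\<rho>1 g $$ (j', j) * w j)))"
    by (intro sum.cong refl sum.swap)
  finally show ?thesis by (simp add: Tw_def act_def sum_distrib_left)
qed

text \<open>The weights \<nu> and \<mu> differ by the second unit vector, so only the component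
  \<open>i = 1\<close> survives at the identity. Invariance of \<open>v\<close> and
  \<open>\<xi>\<close> under the unipotent groups determines everything on the big cell, and
  continuity does the rest.\<close>

theorem tensor_kernel:
  assumes hw1: "hw_data (a + b + 1) a n1 \<rho>1 v \<xi>1" and hw2: "hw_data (a + b + 1) (a + 1) n2 \<rho>2 v2 \<xi>"
    and inv: "gl_invariant n1 n2 \<rho>1 \<rho>2 T"
  shows "\<exists>c. \<forall>g\<in>GL3. \<forall>h\<in>GL3. \<forall>i<3. pair n2 (coact \<rho>2 n2 \<xi> g) (Tw T n1 i (act \<rho>1 n1 h v))
     = c * vdot (rowv g 0) (colv h 0) ^ b * vdot (cross (rowv g 0) (rowv g 1)) (cross (colv h 0) (colv h 1)) ^ a
        * cross (cross (rowv g 0) (rowv g 1)) (colv h 0) i"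
proof -
  define Th where "Th i x = pair n2 \<xi> (Tw T n1 i (act \<rho>1 n1 x v))" for i x
  have rep1: "poly_rep n1 \<rho>1" and rep2: "poly_rep n2 \<rho>2" using hw_dataD(1) hw1 hw2 by blast+
  have equiv: "pair n2 (coact \<rho>2 n2 \<xi> g) (Tw T n1 i (act \<rho>1 n1 x v)) = (\<Sum>i'<3. g $$ (i', i) * Th i' (g * x))"
    if "g \<in> GL3" "x \<in> GL3" "i < 3" for g x i
  proof -
    have "pair n2 (coact \<rho>2 n2 \<xi> g) (Tw T n1 i (act \<rho>1 n1 x v)) = pair n2 \<xi> (act \<rho>2 n2 g (Tw T n1 i (act \<rho>1 n1 x v)))"
      by (rule pair_coact)
    also have "\<dots> = pair n2 \<xi> (\<lambda>k. \<Sum>i'<3. g $$ (i', i) * Tw T n1 i' (act \<rho>1 n1 (g * x) v) k)"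
    proof (rule pair_cong)
      fix k assume "k < n2"
      then have "act \<rho>2 n2 g (Tw T n1 i (act \<rho>1 n1 x v)) k
          = (\<Sum>i'<3. g $$ (i', i) * Tw T n1 i' (act \<rho>1 n1 g (act \<rho>1 n1 x v)) k)"
        by (intro Tw_equivariant[OF inv] that)
      also have "\<dots> = (\<Sum>i'<3. g $$ (i', i) * Tw T n1 i' (act \<rho>1 n1 (g * x) v) k)"
        by (intro sum.cong refl arg_cong2[where f = "(*)"] Tw_cong) (simp add: act_mult[OF rep1 that(1,2)])
      finally show "act \<rho>2 n2 g (Tw T n1 i (act \<rho>1 n1 x v)) k = (\<Sum>i'<3. g $$ (i', i) * Tw T n1 i' (act \<rho>1 n1 (g * x) v) k)" .
    qed
    also have "\<dots> = (\<Sum>i'<3. g $$ (i', i) * Th i' (g * x))"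
      unfolding Th_def by (rule pair_sum_right)
    finally show ?thesis .
  qed
  have Thcong: "Th i x = pair n2 \<xi> (Tw T n1 i w)" if "\<And>j. j < n1 \<Longrightarrow> act \<rho>1 n1 x v j = w j" for i x w
    unfolding Th_def using Tw_cong[of n1 "act \<rho>1 n1 x v" w T i] that by (intro pair_cong) simp
  have DU: "Th i (diag3 [x, y, z] * upper d e f) = x ^ (a + b + 1) * y ^ a * Th i (1\<^sub>m 3)"
    if "x \<noteq> 0" "y \<noteq> 0" "z \<noteq> 0" for x y z d e f i
  proof -
    have "Th i (diag3 [x, y, z] * upper d e f) = pair n2 \<xi> (Tw T n1 i (\<lambda>j. (x ^ (a + b + 1) * y ^ a) * v j))"
      by (rule Thcong) (rule hw_act_diag_upper[OF hw1 that])
    also have "\<dots> = x ^ (a + b + 1) * y ^ a * pair n2 \<xi> (Tw T n1 i v)"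
      unfolding Tw_scale[abs_def] pair_scale ..
    also have "pair n2 \<xi> (Tw T n1 i v) = Th i (1\<^sub>m 3)"
      by (rule Thcong[symmetric]) (rule act_one[OF rep1])
    finally show ?thesis .
  qed
  have torus: "[x, y, z] ! i * Th i (diag3 [x, y, z]) = x ^ (a + b + 1) * y ^ (a + 1) * Th i (1\<^sub>m 3)"
    if nz: "x \<noteq> 0" "y \<noteq> 0" "z \<noteq> 0" and i: "i < 3" for x y z i
  proof -
    let ?D = "diag3 [x, y, z]"
    have "pair n2 (coact \<rho>2 n2 \<xi> ?D) (Tw T n1 i (act \<rho>1 n1 (1\<^sub>m 3) v)) = (\<Sum>i'<3. ?D $$ (i', i) * Th i' (?D * 1\<^sub>m 3))"
      by (rule equiv[OF diag3_GL3[OF nz] one_GL3 i])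
    also have "?D * 1\<^sub>m 3 = ?D" by (rule diag3_mult_one)
    also have "(\<Sum>i'<3. ?D $$ (i', i) * Th i' ?D) = [x, y, z] ! i * Th i ?D"
      using less3_cases[OF i] unfolding sum_lt3 by (elim disjE) (simp_all add: diag3_m3)
    also have "pair n2 (coact \<rho>2 n2 \<xi> ?D) (Tw T n1 i (act \<rho>1 n1 (1\<^sub>m 3) v))
        = pair n2 (\<lambda>j. (x ^ (a + b + 1) * y ^ (a + 1)) * \<xi> j) (Tw T n1 i (act \<rho>1 n1 (1\<^sub>m 3) v))"
      by (rule pair_cong_left) (rule hw_dataD(5)[OF hw2 nz])
    finally show ?thesis unfolding pair_scale_left Th_def by simp
  qed
  have upper0: "upper 0 0 0 = 1\<^sub>m 3" unfolding upper_def one_m3 by (rule m3_cong) auto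
  have D: "Th i (diag3 [x, y, z]) = x ^ (a + b + 1) * y ^ a * Th i (1\<^sub>m 3)"
    if "x \<noteq> 0" "y \<noteq> 0" "z \<noteq> 0" for x y z i
    using DU[OF that, of i 0 0 0] unfolding upper0 diag3_mult_one .
  \<comment> \<open>\<open>torus\<close> and \<open>D\<close> together say that the i-th torus entry
    and \<open>y\<close> act equally on \<open>Th i\<close> at the identity; a torus element where
    they differ forces 0.\<close>
  have Th0: "Th 0 (1\<^sub>m 3) = 0"
    using torus[of 2 1 1 0] D[of 2 1 1 0] by simp
  have Th2: "Th 2 (1\<^sub>m 3) = 0"
    using torus[of 1 1 2 2] D[of 1 1 2 2] by simp
  define c where "c = Th 1 (1\<^sub>m 3)"
  have cont: "cont3 (Th i)" for i
    unfolding Th_def[abs_def] pair_def Tw_def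
    by (intro cont3_sum cont3_mult cont3_const act_cont3[OF rep1]) auto
  have big: "Th 0 x = - c * x $$ (1,0) * minor1 x ^ b * minor2 x ^ a \<and>
      Th 1 x = c * minor1 x * minor1 x ^ b * minor2 x ^ a \<and> Th 2 x = 0"
    if x: "x \<in> GL3" "minor1 x \<noteq> 0" "minor2 x \<noteq> 0" for x
  proof -
    obtain l1 l2 l3 d e f where ldu: "x = lower l1 l2 l3 * (diag3 [minor1 x, minor2 x / minor1 x, det x / minor2 x] * upper d e f)"
      "l1 = x $$ (1,0) / minor1 x"
      by (rule lower_diag_upper[OF x])
    let ?D = "diag3 [minor1 x, minor2 x / minor1 x, det x / minor2 x]"
    let ?L = "lower l1 l2 l3"
    have nz: "minor1 x \<noteq> 0" "minor2 x / minor1 x \<noteq> 0" "det x / minor2 x \<noteq> 0"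
      using x GL3_det_nonzero by auto
    have DUG: "?D * upper d e f \<in> GL3" by (intro GL3_mult diag3_GL3 upper_GL3 nz)
    define t where "t = minor1 x * minor1 x ^ b * minor2 x ^ a"
    have t: "minor1 x ^ (a + b + 1) * (minor2 x / minor1 x) ^ a = t"
      using power_quotient_minors[OF x(2), of "b + 1" a "minor2 x"] by (simp add: t_def ac_simps)
    have xx: "Th i' x = Th i' (?L * (?D * upper d e f))" for i' by (rule arg_cong[OF ldu(1)])
    \<comment> \<open>The covector \<open>\<xi>\<close> absorbs the lower factor, which leaves a
      triangular system for the three values at \<open>x\<close>, solved in the order 2, 1,
      0.\<close>
    have L: "(\<Sum>i'<3. ?L $$ (i', i) * Th i' x) = t * Th i (1\<^sub>m 3)" if i: "i < 3" for i
    proof -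
      have "(\<Sum>i'<3. ?L $$ (i', i) * Th i' x) = pair n2 (coact \<rho>2 n2 \<xi> ?L) (Tw T n1 i (act \<rho>1 n1 (?D * upper d e f) v))"
        by (simp only: xx equiv[OF lower_GL3 DUG i])
      also have "\<dots> = Th i (?D * upper d e f)"
        unfolding Th_def by (rule pair_cong_left) (rule hw_dataD(6)[OF hw2])
      finally show ?thesis unfolding DU[OF nz] t .
    qed
    have T2: "Th 2 x = 0" using L[of 2] Th2 unfolding sum_lt3 by (simp add: lower_def)
    have T1: "Th 1 x = t * c" using L[of 1] T2 unfolding sum_lt3 by (simp add: lower_def c_def)
    have "Th 0 x + l1 * Th 1 x = 0" using L[of 0] T2 Th0 unfolding sum_lt3 by (simp add: lower_def)
    then have "Th 0 x = - (l1 * (t * c))" using T1 by (simp add: add_eq_0_iff2)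
    also have "l1 * t = x $$ (1,0) * minor1 x ^ b * minor2 x ^ a"
      using x(2) by (simp add: ldu(2) t_def)
    then have "- (l1 * (t * c)) = - c * x $$ (1,0) * minor1 x ^ b * minor2 x ^ a" by (simp add: mult_ac)
    finally have "Th 0 x = - c * x $$ (1,0) * minor1 x ^ b * minor2 x ^ a" .
    then show ?thesis using T1 T2 by (simp add: t_def mult_ac)
  qed
  have all0: "Th 0 x = - c * x $$ (1,0) * minor1 x ^ b * minor2 x ^ a" if "x \<in> GL3" for x
  proof (rule bigcell_extension[OF cont _ _ that])
    show "cont3 (\<lambda>x. - c * x $$ (1,0) * minor1 x ^ b * minor2 x ^ a)"
      by (intro cont3_mult cont3_const cont3_power minor1_cont3 minor2_cont3 cont3_index) simp_all
  qed (use big in blast)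
  have all1: "Th 1 x = c * minor1 x * minor1 x ^ b * minor2 x ^ a" if "x \<in> GL3" for x
  proof (rule bigcell_extension[OF cont _ _ that])
    show "cont3 (\<lambda>x. c * minor1 x * minor1 x ^ b * minor2 x ^ a)"
      by (intro cont3_mult cont3_const cont3_power minor1_cont3 minor2_cont3)
  qed (use big in blast)
  have all2: "Th 2 x = 0" if "x \<in> GL3" for x
    by (rule bigcell_extension[OF cont cont3_const _ that]) (use big in auto)
  show ?thesis
  proof (intro exI[of _ c] ballI allI impI)
    fix g h i assume g: "g \<in> GL3" and h: "h \<in> GL3" and i: "i < (3::nat)"
    let ?x = "rowv g 0" and ?x' = "rowv g 1" and ?u = "colv h 0"
    have gh: "g * h \<in> GL3" by (rule GL3_mult[OF g h])
    have x10: "(g * h) $$ (1,0) = vdot ?x' ?u" using mult_index_vdot[OF g h] by simp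
    have "pair n2 (coact \<rho>2 n2 \<xi> g) (Tw T n1 i (act \<rho>1 n1 h v)) = (\<Sum>i'<3. g $$ (i', i) * Th i' (g * h))"
      by (rule equiv[OF g h i])
    also have "\<dots> = (vdot ?x ?u * ?x' i - vdot ?x' ?u * ?x i) * c * minor1 (g * h) ^ b * minor2 (g * h) ^ a"
      unfolding sum_lt3 all0[OF gh] all1[OF gh] all2[OF gh] x10 minor1_mult[OF g h, symmetric]
      by (simp add: rowv_def algebra_simps)
    \<comment> \<open>The expansion of the triple product, \<open>(A \<times> B) \<times> C = (A
      \<cdot> C) B - (B \<cdot> C) A\<close>.\<close>
    also have "vdot ?x ?u * ?x' i - vdot ?x' ?u * ?x i = cross (cross ?x ?x') ?u i"
      using less3_cases[OF i] by (elim disjE) (simp_all add: vdot_def algebra_simps)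
    finally show "pair n2 (coact \<rho>2 n2 \<xi> g) (Tw T n1 i (act \<rho>1 n1 h v))
     = c * vdot ?x ?u ^ b * vdot (cross ?x ?x') (cross (colv h 0) (colv h 1)) ^ a * cross (cross ?x ?x') ?u i"
      unfolding minor1_mult[OF g h] minor2_mult[OF g h] by (simp only: mult_ac)
  qed
qed

section \<open>The Young flattening\<close>

text \<open>Differentiating x\<cdot>y in either half of \<open>M\<close> produces (p\<cdot>y)
  \<open>pol Q Y f\<close>, and the two contributions cancel. So \<open>M\<close> respects the
  equation of the first cone.\<close>

lemma M_mult_XY: "polyfun f \<Longrightarrow> M (\<lambda>a. dot X Y a * f a) a = dot X Y a * M f a"
proof -
  assume f: "polyfun f"
  have 1: "pol X P (pol Q Y (\<lambda>a. dot X Y a * f a)) a = dot P Y a * pol Q Y f a + dot X Y a * pol X P (pol Q Y f) a"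
    using f by (simp add: pol_mult pol_dot)
  have 2: "lap X Q (\<lambda>a. dot X Y a * f a) a = pol Q Y f a + dot X Y a * lap X Q f a"
    using f by (simp add: lap_def pd_dot pol_def algebra_simps)
  show ?thesis unfolding M_def 1 2 by (simp add: algebra_simps)
qed

lemma pd_lin: "pd s i (lin t u) = (\<lambda>a. if s = t \<and> i < 3 then u i else 0)"
proof -
  consider "i = 0" | "i = 1" | "i = 2" | "\<not> i < 3" by linarith
  then show ?thesis
    unfolding vdot_def by cases (auto simp: fun_eq_iff)
qed

lemma pd_lin_lin:
  "pd X i (\<lambda>a. lin X u a ^ Suc m * lin Y z a ^ k)
    = (\<lambda>a. of_nat (Suc m) * lin X u a ^ m * lin Y z a ^ k * (if i < 3 then u i else 0))"
proof -
  have "pd X i (\<lambda>a. lin Y z a ^ k) = (\<lambda>a. 0)"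
    by (cases k) (simp_all add: pd_lin fun_eq_iff del: power_Suc)
  then show ?thesis
    by (simp add: pd_lin fun_eq_iff mult_ac del: power_Suc of_nat_Suc)
qed

abbreviation unitv :: "nat \<Rightarrow> nat \<Rightarrow> complex" where
  "unitv i \<equiv> (\<lambda>j. if j = i then 1 else 0)"

lemma Dp_linear: "Dp c e a = c 0 * Dp (unitv 0) e a + c 1 * Dp (unitv 1) e a + c 2 * Dp (unitv 2) e a"
  by (simp add: Dp_def vdot_def algebra_simps)

text \<open>The identity \<open>(A \<times> B) \<cdot> (C \<times> D) = (A \<cdot> C) (B \<cdot> D)
  - (A \<cdot> D) (B \<cdot> C)\<close> for y, \<partial>x f, p, \<partial>q e.
  \<open>Dp (unitv i) e\<close> is the i-th component of p \<times> \<partial>q e.\<close>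

lemma M_product:
  assumes f: "multihom (deg4 m 0 n 0) f" and e: "multihom (deg4 0 m' 0 n') e"
  shows "M (\<lambda>a. f a * e a) a = - (\<Sum>i<3. cross (a Y) (\<lambda>j. pd X j f a) i * Dp (unitv i) e a)"
proof -
  have polyfun: "polyfun f" "polyfun e" using f e multihom_polyfun by blast+
  have fz: "pd Q i f = (\<lambda>a. 0)" for i by (rule multihom_pd_zero[OF f]) simp
  have ez: "pd X i e = (\<lambda>a. 0)" for i by (rule multihom_pd_zero[OF e]) simp
  have xq: "pd X i (pd Q j e) = (\<lambda>a. 0)" for i j
    using pd_commute[OF polyfun(2), of X i Q j] ez by simp
  have 1: "pol Q Y (\<lambda>a. f a * e a) = (\<lambda>a. f a * pol Q Y e a)"
    using polyfun fz by (simp add: pol_mult) (simp add: pol_def)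
  have "pol X P (pol Q Y e) = (\<lambda>a. 0)"
    unfolding pol_def[abs_def] using polyfun xq by (simp add: fun_eq_iff)
  then have 2: "pol X P (\<lambda>a. f a * pol Q Y e a) a = pol X P f a * pol Q Y e a"
    using polyfun by (simp add: pol_mult)
  have 3: "lap X Q (\<lambda>a. f a * e a) a = pd X 0 f a * pd Q 0 e a + pd X 1 f a * pd Q 1 e a + pd X 2 f a * pd Q 2 e a"
    unfolding lap_def using polyfun fz xq by simp
  show ?thesis unfolding M_def 1 2 3 sum_lt3
    by (simp add: pol_def dot_def Dp_def vdot_def algebra_simps)
qed

text \<open>Sums of products of a form in (x, y) and a form in (p, q): the shape in which
  \<open>M_product\<close> can be applied term by term.\<close>

inductive separated :: "(blk \<Rightarrow> nat) \<Rightarrow> (pt \<Rightarrow> complex) \<Rightarrow> bool" where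
  separated_base: "multihom (deg4 m 0 n 0) f \<Longrightarrow> multihom (deg4 0 m' 0 n') e \<Longrightarrow> separated (deg4 m m' n n') (\<lambda>a. f a * e a)"
| separated_add: "separated d f \<Longrightarrow> separated d g \<Longrightarrow> separated d (\<lambda>a. f a + g a)"
| separated_cmult: "separated d f \<Longrightarrow> separated d (\<lambda>a. c * f a)"

lemma separated_var: "separated d f \<Longrightarrow> i < 3 \<Longrightarrow> separated (d(s := Suc (d s))) (\<lambda>a. a s i * f a)"
proof (induction rule: separated.induct)
  case (separated_base m n f m' n' e)
  show ?case
  proof (cases s)
    case X
    have "multihom (deg4 (Suc m) 0 n 0) (\<lambda>a. a X i * f a)"
      using multihom_var_mult[OF separated_base(1,3), of X] by simp
    from separated.separated_base[OF this separated_base(2)] show ?thesis by (simp add: X mult.assoc)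
  next
    case Y
    have "multihom (deg4 m 0 (Suc n) 0) (\<lambda>a. a Y i * f a)"
      using multihom_var_mult[OF separated_base(1,3), of Y] by simp
    from separated.separated_base[OF this separated_base(2)] show ?thesis by (simp add: Y mult.assoc)
  next
    case P
    have "multihom (deg4 0 (Suc m') 0 n') (\<lambda>a. a P i * e a)"
      using multihom_var_mult[OF separated_base(2,3), of P] by simp
    from separated.separated_base[OF separated_base(1) this] show ?thesis by (simp add: P mult.left_commute)
  next
    case Q
    have "multihom (deg4 0 m' 0 (Suc n')) (\<lambda>a. a Q i * e a)"
      using multihom_var_mult[OF separated_base(2,3), of Q] by simp
    from separated.separated_base[OF separated_base(1) this] show ?thesis by (simp add: Q mult.left_commute)
  qed
next
  case (separated_add d f g)
  show ?case
    using separated.separated_add[OF separated_add.IH(1)[OF separated_add.prems] separated_add.IH(2)[OF separated_add.prems]] by (simp only: distrib_left)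
next
  case (separated_cmult d f c)
  show ?case
    using separated.separated_cmult[OF separated_cmult.IH[OF separated_cmult.prems], of c] by (simp only: mult.left_commute)
qed

lemma deg4_eta: "d = deg4 (d X) (d P) (d Y) (d Q)"
  by (rule deg4_ext) auto

lemma multihom_imp_separated: "multihom d f \<Longrightarrow> separated d f"
proof (induction rule: multihom.induct)
  case multihom_one
  have "multihom (deg4 0 0 0 0) (\<lambda>a. 1)" using multihom.multihom_one by (simp add: deg4_zero)
  from separated_base[OF this this] show ?case by (simp add: deg4_zero)
next
  case (multihom_zero d)
  show ?case by (subst deg4_eta) (use separated_base[OF multihom.multihom_zero multihom.multihom_zero] in simp)
next
  case (multihom_var_mult d f i s)
  then show ?case by (intro separated_var)
qed (auto intro: separated.intros)

lemma cone_span_polyfun: "cone_span s t m n f \<Longrightarrow> polyfun f"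
  by (induction rule: cone_span.induct) (auto simp: multihom_polyfun)

lemma separated_polyfun: "separated d f \<Longrightarrow> polyfun f"
  by (induction rule: separated.induct) (auto simp: multihom_polyfun)

section \<open>The flattening of the tensor and the rank comparison\<close>

locale invariant_tensor =
  fixes a b n1 n2 :: nat and \<rho>1 \<rho>2 :: "complex mat \<Rightarrow> complex mat"
    and T :: "nat \<Rightarrow> nat \<Rightarrow> nat \<Rightarrow> complex" and v \<xi> :: "nat \<Rightarrow> complex" and c :: complex
  assumes c0: "c \<noteq> 0"
    and ker: "\<And>g h i. g \<in> GL3 \<Longrightarrow> h \<in> GL3 \<Longrightarrow> i < 3 \<Longrightarrow>
      pair n2 (coact \<rho>2 n2 \<xi> g) (Tw T n1 i (act \<rho>1 n1 h v))
      = c * vdot (rowv g 0) (colv h 0) ^ b * vdot (cross (rowv g 0) (rowv g 1)) (cross (colv h 0) (colv h 1)) ^ a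
        * cross (cross (rowv g 0) (rowv g 1)) (colv h 0) i"
begin

text \<open>Sample points that index the rows of the flattening matrix: the (x, y) part of
  \<open>\<alpha>\<close> comes from the group element, the (p, q) part is free on its cone.\<close>

definition rows :: "(complex mat \<times> pt) set" where
  "rows = {(g, \<alpha>). g \<in> GL3 \<and> cone2 \<alpha> \<and> (\<forall>i<3. \<alpha> X i = rowv g 0 i) \<and>
     (\<forall>i<3. \<alpha> Y i = cross (rowv g 0) (rowv g 1) i)}"

text \<open>The flattening of \<open>S\<close> applied to \<open>w \<otimes> e\<close> and evaluated
  at the sample point \<open>(g, \<alpha>)\<close>.\<close>

definition flat :: "(nat \<Rightarrow> nat \<Rightarrow> nat \<Rightarrow> complex) \<Rightarrow> complex mat \<Rightarrow> pt \<Rightarrow> (nat \<Rightarrow> complex) \<Rightarrow> (pt \<Rightarrow> complex) \<Rightarrow> complex" where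
  "flat S g \<alpha> w e = (\<Sum>i<3. pair n2 (coact \<rho>2 n2 \<xi> g) (Tw S n1 i w) * Dp (unitv i) e \<alpha>)"

text \<open>Membership in the image of the flattening of \<open>T\<close>, on the sample points; the
  finite sums stand for elements of a tensor product.\<close>

definition representable :: "(pt \<Rightarrow> complex) \<Rightarrow> bool" where
  "representable H \<longleftrightarrow> (\<exists>(N::nat) w e. (\<forall>m<N. multihom (deg4 0 b 0 (a + 1)) (e m)) \<and>
     (\<forall>g \<alpha>. (g, \<alpha>) \<in> rows \<longrightarrow> H \<alpha> = (\<Sum>m<N. flat T g \<alpha> (w m) (e m))))"

lemma representableI:
  fixes N :: nat
  assumes "\<And>m. m < N \<Longrightarrow> multihom (deg4 0 b 0 (a + 1)) (e m)"
    and "\<And>g \<alpha>. (g, \<alpha>) \<in> rows \<Longrightarrow> H \<alpha> = (\<Sum>m<N. flat T g \<alpha> (w m) (e m))"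
  shows "representable H"
  unfolding representable_def
  by (rule exI[of _ N], rule exI[of _ w], rule exI[of _ e]) (use assms in auto)

lemma representableE:
  assumes "representable H"
  obtains N :: nat and w e where "\<forall>m<N. multihom (deg4 0 b 0 (a + 1)) (e m)"
    and "\<forall>g \<alpha>. (g, \<alpha>) \<in> rows \<longrightarrow> H \<alpha> = (\<Sum>m<N. flat T g \<alpha> (w m) (e m))"
  using assms unfolding representable_def by (elim exE conjE) (rule that)

lemma representable_zero: "representable (\<lambda>\<alpha>. 0)"
  by (rule representableI[of 0]) auto

lemma representable_cong:
  assumes "representable H" "\<And>g \<alpha>. (g, \<alpha>) \<in> rows \<Longrightarrow> H \<alpha> = H' \<alpha>"
  shows "representable H'"
  by (rule representableE[OF assms(1)], rule representableI) (use assms(2) in auto)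

lemma sum_lessThan_add: "(\<Sum>m<N + N'. f m) = (\<Sum>m<N. f m) + (\<Sum>m<N'. f (N + m))"
  for f :: "nat \<Rightarrow> complex"
  by (induction N') (auto simp: add.assoc)

lemma representable_add:
  assumes "representable H" "representable H'"
  shows "representable (\<lambda>\<alpha>. H \<alpha> + H' \<alpha>)"
proof -
  obtain N :: nat and w e where 1 [rule_format]: "\<forall>m<N. multihom (deg4 0 b 0 (a + 1)) (e m)"
    "\<forall>g \<alpha>. (g, \<alpha>) \<in> rows \<longrightarrow> H \<alpha> = (\<Sum>m<N. flat T g \<alpha> (w m) (e m))"
    by (rule representableE[OF assms(1)]) (rule that)
  obtain N' :: nat and w' e' where 2 [rule_format]: "\<forall>m<N'. multihom (deg4 0 b 0 (a + 1)) (e' m)"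
    "\<forall>g \<alpha>. (g, \<alpha>) \<in> rows \<longrightarrow> H' \<alpha> = (\<Sum>m<N'. flat T g \<alpha> (w' m) (e' m))"
    by (rule representableE[OF assms(2)]) (rule that)
  define w2 where "w2 m = (if m < N then w m else w' (m - N))" for m
  define e2 where "e2 m = (if m < N then e m else e' (m - N))" for m
  have "multihom (deg4 0 b 0 (a + 1)) (e2 m)" if "m < N + N'" for m
    using that 1(1)[of m] 2(1)[of "m - N"] by (simp add: e2_def)
  moreover have "H \<alpha> + H' \<alpha> = (\<Sum>m<N + N'. flat T g \<alpha> (w2 m) (e2 m))" if "(g, \<alpha>) \<in> rows" for g \<alpha>
    unfolding sum_lessThan_add using 1(2)[OF that] 2(2)[OF that] by (simp add: w2_def e2_def)
  ultimately show ?thesis by (rule representableI[of "N + N'"])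
qed

lemma flat_scale: "flat S g \<alpha> (\<lambda>j. k * w j) e = k * flat S g \<alpha> w e"
  unfolding flat_def Tw_scale[abs_def] pair_scale by (simp add: sum_distrib_left mult.assoc)

lemma representable_cmult:
  assumes "representable H"
  shows "representable (\<lambda>\<alpha>. k * H \<alpha>)"
proof -
  obtain N :: nat and w e where 1 [rule_format]: "\<forall>m<N. multihom (deg4 0 b 0 (a + 1)) (e m)"
    "\<forall>g \<alpha>. (g, \<alpha>) \<in> rows \<longrightarrow> H \<alpha> = (\<Sum>m<N. flat T g \<alpha> (w m) (e m))"
    by (rule representableE[OF assms(1)]) (rule that)
  have "k * H \<alpha> = (\<Sum>m<N. flat T g \<alpha> (\<lambda>j. k * w m j) (e m))" if "(g, \<alpha>) \<in> rows" for g \<alpha>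
    unfolding flat_scale 1(2)[OF that] by (simp only: sum_distrib_left)
  with 1(1) show ?thesis by (rule representableI)
qed

lemma representable_flat:
  assumes "\<And>g \<alpha>. (g, \<alpha>) \<in> rows \<Longrightarrow> H \<alpha> = flat T g \<alpha> w e" "multihom (deg4 0 b 0 (a + 1)) e"
  shows "representable H"
  by (rule representableI[of 1 "\<lambda>_. e" _ "\<lambda>_. w"]) (use assms in auto)

text \<open>For a generator f = (x\<cdot>u)^(b+1) (y\<cdot>z)^a one has y \<times> \<partial>x f =
  (b+1) (x\<cdot>u)^b (y\<cdot>z)^a (y \<times> u). This is (b+1)/c times the kernel of the tensor,
  at a group element whose columns give \<open>u\<close> and \<open>z\<close>.\<close>

lemma representable_cone_span:
  assumes "cone_span X Y m k f" "m = b + 1" "k = a" and e: "multihom (deg4 0 b 0 (a + 1)) e"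
  shows "representable (M (\<lambda>\<alpha>. f \<alpha> * e \<alpha>))"
  using assms(1-3)
proof (induction rule: cone_span.induct)
  case (cone_span_base u z m k)
  have e': "polyfun e" using e multihom_polyfun by blast
  have "0 < m + k" using cone_span_base by simp
  then consider "\<forall>x y. vdot x u ^ m * vdot y z ^ k = 0" |
    u' z' where "vdot u' z' = 0" "nz3 u'" "nz3 z'" "\<forall>x y. vdot x u' ^ m * vdot y z' ^ k = vdot x u ^ m * vdot y z ^ k"
    using cone_function_nonzero[OF cone_span_base(1), of m k] by blast
  then show ?case
  proof cases
    case 1
    have "vdot x u ^ m * vdot y z ^ k = 0" for x y using 1 by blast
    then have "(\<lambda>\<alpha>. lin X u \<alpha> ^ m * lin Y z \<alpha> ^ k * e \<alpha>) = (\<lambda>\<alpha>. 0)" by (simp only: mult_zero_left)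
    moreover have "M (\<lambda>\<alpha>. 0) = (\<lambda>\<alpha>. 0)" by (rule ext) (simp add: M_def lap_def)
    ultimately show ?thesis using representable_zero by simp
  next
    case (2 u' z')
    obtain h where h: "h \<in> GL3" "\<forall>i<3. colv h 0 i = u' i" "\<forall>i<3. cross (colv h 0) (colv h 1) i = z' i"
      using GL3_with_cols[OF 2(1-3)] by blast
    let ?f = "\<lambda>\<alpha>. lin X u' \<alpha> ^ Suc b * lin Y z' \<alpha> ^ a"
    have fe: "(\<lambda>\<alpha>. lin X u \<alpha> ^ m * lin Y z \<alpha> ^ k * e \<alpha>) = (\<lambda>\<alpha>. ?f \<alpha> * e \<alpha>)"
      using 2(4) cone_span_base by (simp add: fun_eq_iff)
    have hpf: "multihom (deg4 (Suc b) 0 a 0) ?f"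
      by (rule multihom_cong[OF multihom_lin_lin[of X Y "Suc b" a u' z']]) (auto simp: bideg_def intro: deg4_ext)
    have "M (\<lambda>\<alpha>. ?f \<alpha> * e \<alpha>) \<alpha> = flat T g \<alpha> (\<lambda>j. - (of_nat (Suc b) / c) * act \<rho>1 n1 h v j) e"
      if "(g, \<alpha>) \<in> rows" for g \<alpha>
    proof -
      have g: "g \<in> GL3" "\<forall>i<3. \<alpha> X i = rowv g 0 i" "\<forall>i<3. \<alpha> Y i = cross (rowv g 0) (rowv g 1) i"
        using that by (auto simp: rows_def)
      have v1: "vdot (\<alpha> X) u' = vdot (rowv g 0) (colv h 0)" using g h by (intro vdot_cong3) auto
      have v2: "vdot (\<alpha> Y) z' = vdot (cross (rowv g 0) (rowv g 1)) (cross (colv h 0) (colv h 1))"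
        using g h by (intro vdot_cong3) auto
      have cr: "cross (\<alpha> Y) (\<lambda>j. pd X j ?f \<alpha>) i
         = of_nat (Suc b) * lin X u' \<alpha> ^ b * lin Y z' \<alpha> ^ a * cross (cross (rowv g 0) (rowv g 1)) (colv h 0) i"
        if i: "i < 3" for i
      proof -
        define k where "k = of_nat (Suc b) * lin X u' \<alpha> ^ b * lin Y z' \<alpha> ^ a"
        have "pd X j ?f \<alpha> = k * u' j" if "j < 3" for j
          unfolding pd_lin_lin k_def using that by simp
        then show ?thesis using less3_cases[OF i] g(3) h(2) unfolding k_def[symmetric]
          by (elim disjE) (simp_all add: algebra_simps del: cross_simps(1-3) add: cross_def)
      qed
      have k: "(of_nat (Suc b) / c) * pair n2 (coact \<rho>2 n2 \<xi> g) (Tw T n1 i (act \<rho>1 n1 h v))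
          = cross (\<alpha> Y) (\<lambda>j. pd X j ?f \<alpha>) i" if "i < 3" for i
        unfolding ker[OF g(1) h(1) that] cr[OF that] v1 v2 using c0 by simp
      have "flat T g \<alpha> (\<lambda>j. - (of_nat (Suc b) / c) * act \<rho>1 n1 h v j) e
         = - (\<Sum>i<3. (of_nat (Suc b) / c * pair n2 (coact \<rho>2 n2 \<xi> g) (Tw T n1 i (act \<rho>1 n1 h v))) * Dp (unitv i) e \<alpha>)"
        unfolding flat_scale unfolding flat_def by (simp add: sum_distrib_left mult.assoc flip: sum_negf)
      also have "\<dots> = - (\<Sum>i<3. cross (\<alpha> Y) (\<lambda>j. pd X j ?f \<alpha>) i * Dp (unitv i) e \<alpha>)"
        using k by simp
      also have "\<dots> = M (\<lambda>\<alpha>. ?f \<alpha> * e \<alpha>) \<alpha>" using M_product[OF hpf e] by simp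
      finally show ?thesis by simp
    qed
    then show ?thesis unfolding fe by (rule representable_flat[OF _ e])
  qed
next
  case (cone_span_add m k f g)
  have polyfun: "polyfun f" "polyfun g" using cone_span_add cone_span_polyfun by blast+
  have "M (\<lambda>\<alpha>. (f \<alpha> + g \<alpha>) * e \<alpha>) = (\<lambda>\<alpha>. M (\<lambda>\<alpha>. f \<alpha> * e \<alpha>) \<alpha> + M (\<lambda>\<alpha>. g \<alpha> * e \<alpha>) \<alpha>)"
    using M_add[of "\<lambda>\<alpha>. f \<alpha> * e \<alpha>" "\<lambda>\<alpha>. g \<alpha> * e \<alpha>"] polyfun multihom_polyfun[OF e] by (simp add: distrib_right fun_eq_iff)
  then show ?case using representable_add cone_span_add by simp
next
  case (cone_span_cmult m k f c')
  have polyfun: "polyfun f" using cone_span_cmult cone_span_polyfun by blast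
  have "M (\<lambda>\<alpha>. (c' * f \<alpha>) * e \<alpha>) = (\<lambda>\<alpha>. c' * M (\<lambda>\<alpha>. f \<alpha> * e \<alpha>) \<alpha>)"
    using M_cmult[of "\<lambda>\<alpha>. f \<alpha> * e \<alpha>" c'] polyfun multihom_polyfun[OF e] by (simp add: mult.assoc fun_eq_iff)
  then show ?case using representable_cmult cone_span_cmult by simp
next
  case (cone_span_ideal m k h)
  have polyfun: "polyfun (\<lambda>\<alpha>. h \<alpha> * e \<alpha>)" using multihom_polyfun[OF cone_span_ideal(1)] multihom_polyfun[OF e] by simp
  show ?case
  proof (rule representable_cong[OF representable_zero])
    fix g \<alpha> assume "(g, \<alpha>) \<in> rows"
    then have "dot X Y \<alpha> = 0" by (auto simp: rows_def cone2_def)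
    then show "0 = M (\<lambda>\<alpha>. dot X Y \<alpha> * h \<alpha> * e \<alpha>) \<alpha>" using M_mult_XY[OF polyfun, of \<alpha>] by (simp add: mult.assoc)
  qed
qed

lemma representable_separated:
  assumes "separated d F" "d = deg4 (b + 1) b a (a + 1)"
  shows "representable (M F)"
  using assms
proof (induction rule: separated.induct)
  case (separated_base m n f m' n' e)
  have d: "m = b + 1" "m' = b" "n = a" "n' = a + 1"
    using fun_cong[OF separated_base(3), of X] fun_cong[OF separated_base(3), of P]
      fun_cong[OF separated_base(3), of Y] fun_cong[OF separated_base(3), of Q] by simp_all
  have "cone_span X Y (deg4 m 0 n 0 X) (deg4 m 0 n 0 Y) f"
  proof (rule multihom_imp_cone_span[OF separated_base(1)])
    fix r assume "r \<noteq> X" "r \<noteq> Y" then show "deg4 m 0 n 0 r = 0" by (cases r) auto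
  qed simp
  then have "cone_span X Y m n f" by simp
  then show ?case by (rule representable_cone_span) (use d separated_base(2) in auto)
next
  case (separated_add d f g)
  have "M (\<lambda>\<alpha>. f \<alpha> + g \<alpha>) = (\<lambda>\<alpha>. M f \<alpha> + M g \<alpha>)"
    using M_add separated_polyfun separated_add by blast
  then show ?case using representable_add separated_add by simp
next
  case (separated_cmult d f c')
  have "M (\<lambda>\<alpha>. c' * f \<alpha>) = (\<lambda>\<alpha>. c' * M f \<alpha>)" using M_cmult separated_polyfun separated_cmult by blast
  then show ?case using representable_cmult separated_cmult by simp
qed

lemma representable_target:
  assumes "multihom (deg4 b (b + 1) (a + 1) a) H"
  shows "representable H"
proof -
  obtain F where F: "multihom (deg4 (b + 1) b a (a + 1)) F" "\<forall>\<alpha>. cone2 \<alpha> \<longrightarrow> M F \<alpha> = H \<alpha>"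
    using M_surj[OF assms] unfolding imM_def by blast
  show ?thesis
    by (rule representable_cong[OF representable_separated[OF multihom_imp_separated[OF F(1)] refl]])
      (use F(2) in \<open>auto simp: rows_def\<close>)
qed

lemma flat_expand:
  "flat S g \<alpha> w e = (\<Sum>i<3. \<Sum>j<n1. \<Sum>l<n2. S i j l * (coact \<rho>2 n2 \<xi> g l * w j * Dp (unitv i) e \<alpha>))"
proof -
  have "flat S g \<alpha> w e = (\<Sum>i<3. \<Sum>l<n2. \<Sum>j<n1. S i j l * (coact \<rho>2 n2 \<xi> g l * w j * Dp (unitv i) e \<alpha>))"
    unfolding flat_def pair_def Tw_def by (simp add: sum_distrib_left sum_distrib_right mult_ac)
  also have "\<dots> = (\<Sum>i<3. \<Sum>j<n1. \<Sum>l<n2. S i j l * (coact \<rho>2 n2 \<xi> g l * w j * Dp (unitv i) e \<alpha>))"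
    by (intro sum.cong refl sum.swap)
  finally show ?thesis .
qed

text \<open>A rank one summand contributes a scalar times one derivation \<open>Dp (x t)\<close>, to
  which the bound of \<open>Dp_span\<close> applies.\<close>

lemma flat_rank_one_sum:
  assumes S: "\<And>i j l. i < 3 \<Longrightarrow> j < n1 \<Longrightarrow> l < n2 \<Longrightarrow> S i j l = (\<Sum>t<r. x t i * y t j * z t l)"
  shows "flat S g \<alpha> w e = (\<Sum>t<r. pair n2 (coact \<rho>2 n2 \<xi> g) (z t) * pair n1 (y t) w * Dp (x t) e \<alpha>)"
proof -
  have tw: "pair n2 (coact \<rho>2 n2 \<xi> g) (Tw S n1 i w)
      = (\<Sum>t<r. (x t i * pair n1 (y t) w) * pair n2 (coact \<rho>2 n2 \<xi> g) (z t))" if i: "i < 3" for i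
  proof -
    have "pair n2 (coact \<rho>2 n2 \<xi> g) (Tw S n1 i w)
       = pair n2 (coact \<rho>2 n2 \<xi> g) (\<lambda>l. \<Sum>t<r. (x t i * pair n1 (y t) w) * z t l)"
    proof (rule pair_cong)
      fix l assume l: "l < n2"
      have "Tw S n1 i w l = (\<Sum>j<n1. \<Sum>t<r. x t i * (y t j * w j) * z t l)"
        unfolding Tw_def using S[OF i _ l] by (simp add: sum_distrib_left sum_distrib_right mult_ac)
      also have "\<dots> = (\<Sum>t<r. \<Sum>j<n1. x t i * (y t j * w j) * z t l)" by (rule sum.swap)
      finally show "Tw S n1 i w l = (\<Sum>t<r. (x t i * pair n1 (y t) w) * z t l)"
        by (simp add: pair_def sum_distrib_left sum_distrib_right mult.assoc)
    qed
    then show ?thesis by (simp only: pair_sum_right)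
  qed
  have "flat S g \<alpha> w e = (\<Sum>i<3. \<Sum>t<r. pair n2 (coact \<rho>2 n2 \<xi> g) (z t) * pair n1 (y t) w * (x t i * Dp (unitv i) e \<alpha>))"
    unfolding flat_def by (rule sum.cong[OF refl]) (simp add: tw sum_distrib_left sum_distrib_right mult_ac)
  also have "\<dots> = (\<Sum>t<r. \<Sum>i<3. pair n2 (coact \<rho>2 n2 \<xi> g) (z t) * pair n1 (y t) w * (x t i * Dp (unitv i) e \<alpha>))"
    by (rule sum.swap)
  also have "\<dots> = (\<Sum>t<r. pair n2 (coact \<rho>2 n2 \<xi> g) (z t) * pair n1 (y t) w * Dp (x t) e \<alpha>)"
    unfolding sum_lt3 Dp_linear[of "x _"] by (simp add: distrib_left)
  finally show ?thesis .
qed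

lemma rows_point:
  assumes "vdot x y = 0" "x 2 = 1" "y 2 = 1" "vdot p q = 0"
  shows "\<exists>g. (g, case_blk x p y q) \<in> rows"
proof -
  have "nz3 x" "nz3 y" using assms by (auto simp: nz3_def)
  from GL3_with_rows[OF assms(1) this] obtain g where
    g: "g \<in> GL3" "\<forall>i<3. rowv g 0 i = x i" "\<forall>i<3. cross (rowv g 0) (rowv g 1) i = y i" by blast
  have "cone2 (case_blk x p y q)" using assms by (simp add: cone2_def dot_def vdot_def)
  then show ?thesis using g unfolding rows_def by (intro exI[of _ g]) simp
qed

text \<open>Products of standard monomials are independent on the sample points and have fixed
  preimages under the flattening of \<open>T\<close>. The same preimages, fed into the flattening of
  a nearby tensor of rank at most \<open>r\<close>, give a matrix that factors through
  \<open>r * card (std' b (a + 1))\<close> functions.\<close>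

theorem flattening_bound:
  assumes br: "border_rank_le 3 n1 n2 r T"
  shows "card (std b (a + 1)) * card (std (b + 1) a) \<le> r * card (std' b (a + 1))"
proof -
  let ?I = "std b (a + 1) \<times> std (b + 1) a"
  define H where "H k \<alpha> = smon b (a + 1) (fst k) (\<alpha> X) (\<alpha> Y) * smon (b + 1) a (snd k) (\<alpha> P) (\<alpha> Q)" for k and \<alpha> :: pt
  have hpH: "multihom (deg4 b (b + 1) (a + 1) a) (H k)" if "k \<in> ?I" for k
  proof -
    have 1: "multihom (bideg X Y b (a + 1)) (\<lambda>\<alpha>. smon b (a + 1) (fst k) (\<alpha> X) (\<alpha> Y))"
      by (rule multihom_smon) (use that in auto)
    have 2: "multihom (bideg P Q (b + 1) a) (\<lambda>\<alpha>. smon (b + 1) a (snd k) (\<alpha> P) (\<alpha> Q))"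
      by (rule multihom_smon) (use that in auto)
    show ?thesis unfolding H_def
      by (rule multihom_cong[OF multihom_mult[OF 1 2]]) (rule deg4_ext, simp_all add: bideg_def)
  qed
  have "\<exists>(N::nat) w e. (\<forall>m<N. multihom (deg4 0 b 0 (a + 1)) (e m)) \<and>
      (\<forall>g \<alpha>. (g, \<alpha>) \<in> rows \<longrightarrow> H k \<alpha> = (\<Sum>m<N. flat T g \<alpha> (w m) (e m)))" if "k \<in> ?I" for k
    using representable_target[OF hpH[OF that]] by (simp only: representable_def)
  then have "\<forall>k\<in>?I. \<exists>(N::nat) w e. (\<forall>m<N. multihom (deg4 0 b 0 (a + 1)) (e m)) \<and>
      (\<forall>g \<alpha>. (g, \<alpha>) \<in> rows \<longrightarrow> H k \<alpha> = (\<Sum>m<N. flat T g \<alpha> (w m) (e m)))" by (intro ballI)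
  from bchoice[OF this] obtain N :: "sidx \<times> sidx \<Rightarrow> nat" where "\<forall>k\<in>?I. \<exists>w e. (\<forall>m<N k. multihom (deg4 0 b 0 (a + 1)) (e m)) \<and>
      (\<forall>g \<alpha>. (g, \<alpha>) \<in> rows \<longrightarrow> H k \<alpha> = (\<Sum>m<N k. flat T g \<alpha> (w m) (e m)))" by (elim exE) (rule that)
  from bchoice[OF this] obtain w where "\<forall>k\<in>?I. \<exists>e. (\<forall>m<N k. multihom (deg4 0 b 0 (a + 1)) (e m)) \<and>
      (\<forall>g \<alpha>. (g, \<alpha>) \<in> rows \<longrightarrow> H k \<alpha> = (\<Sum>m<N k. flat T g \<alpha> (w k m) (e m)))" by (elim exE) (rule that)
  from bchoice[OF this] obtain e where q: "\<forall>k\<in>?I. (\<forall>m<N k. multihom (deg4 0 b 0 (a + 1)) (e k m)) \<and>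
      (\<forall>g \<alpha>. (g, \<alpha>) \<in> rows \<longrightarrow> H k \<alpha> = (\<Sum>m<N k. flat T g \<alpha> (w k m) (e k m)))" by (elim exE) (rule that)
  have e: "multihom (deg4 0 b 0 (a + 1)) (e k m)" if "k \<in> ?I" "m < N k" for k m
    using bspec[OF q that(1)] that(2) by simp
  have HT: "H k \<alpha> = (\<Sum>m<N k. flat T g \<alpha> (w k m) (e k m))" if "k \<in> ?I" "(g, \<alpha>) \<in> rows" for k g \<alpha>
    using bspec[OF q that(1)] that(2) by simp
  define B where "B k p = H k (snd p)" for k and p :: "complex mat \<times> pt"
  have "card ?I \<le> r * card (std' b (a + 1))"
  proof (rule rank_semicontinuous[where B = B and S = rows and 'j = "nat \<times> sidx"])
    show "finite ?I" by simp
  next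
    fix \<alpha> assume z: "\<forall>p\<in>rows. (\<Sum>k\<in>?I. \<alpha> k * B k p) = 0"
    show "\<forall>k\<in>?I. \<alpha> k = 0"
    proof
      fix k assume "k \<in> ?I"
      then obtain k1 k2 where k: "k = (k1, k2)" "k1 \<in> std b (a + 1)" "k2 \<in> std (b + 1) a" by auto
      have "\<alpha> (k1, k2) = 0"
      proof (rule std_independent[where c = "\<lambda>k2. \<alpha> (k1, k2)", OF _ k(3)])
        fix p q' :: "nat \<Rightarrow> complex" assume pq: "vdot p q' = 0" "p 2 = 1" "q' 2 = 1"
        show "(\<Sum>k2\<in>std (b + 1) a. \<alpha> (k1, k2) * smon (b + 1) a k2 p q') = 0"
        proof (rule std_independent[where c = "\<lambda>k1. \<Sum>k2\<in>std (b + 1) a. \<alpha> (k1, k2) * smon (b + 1) a k2 p q'", OF _ k(2)])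
          fix x y :: "nat \<Rightarrow> complex" assume xy: "vdot x y = 0" "x 2 = 1" "y 2 = 1"
          obtain g where "(g, case_blk x p y q') \<in> rows" using rows_point[OF xy pq(1)] by blast
          from bspec[OF z this]
          have "(\<Sum>k\<in>?I. \<alpha> k * (smon b (a + 1) (fst k) x y * smon (b + 1) a (snd k) p q')) = 0"
            by (simp add: B_def H_def)
          then show "(\<Sum>k1\<in>std b (a + 1). (\<Sum>k2\<in>std (b + 1) a. \<alpha> (k1, k2) * smon (b + 1) a k2 p q') * smon b (a + 1) k1 x y) = 0"
            by (simp add: sum.cartesian_product' sum_distrib_left mult_ac)
        qed
      qed
      then show "\<alpha> k = 0" by (simp add: k)
    qed
  next
    fix A :: "(complex mat \<times> pt) set" and \<epsilon> :: real
    assume A: "finite A" "A \<subseteq> rows" and \<epsilon>: "\<epsilon> > 0"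
    define cf where "cf p k m i j l = coact \<rho>2 n2 \<xi> (fst p) l * w k m j * Dp (unitv i) (e k m) (snd p)"
      for p :: "complex mat \<times> pt" and k m i j l
    \<comment> \<open>A Lipschitz constant for the dependence of one entry on the tensor; their
      finite sum \<open>Kt\<close> serves all sample points in \<open>A\<close> and all
      columns.\<close>
    define K where "K p k = (\<Sum>m<N k. \<Sum>i<3. \<Sum>j<n1. \<Sum>l<n2. cmod (cf p k m i j l))" for p k
    have K0: "0 \<le> K p k" for p k unfolding K_def by (intro sum_nonneg) simp
    define Kt where "Kt = (\<Sum>p\<in>A. \<Sum>k\<in>?I. K p k)"
    have Kt: "K p k \<le> Kt" if "p \<in> A" "k \<in> ?I" for p k
    proof -
      have "K p k \<le> (\<Sum>k\<in>?I. K p k)" using that(2) K0 by (intro member_le_sum) auto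
      also have "\<dots> \<le> Kt" unfolding Kt_def using that(1) A(1) K0
        by (intro member_le_sum[where f = "\<lambda>p. \<Sum>k\<in>?I. K p k"]) (auto intro: sum_nonneg)
      finally show ?thesis .
    qed
    have Kt0: "0 \<le> Kt" unfolding Kt_def by (intro sum_nonneg K0)
    define \<delta> where "\<delta> = \<epsilon> / (Kt + 1)"
    have \<delta>: "\<delta> > 0" using \<epsilon> Kt0 by (simp add: \<delta>_def)
    obtain S where S: "rank_le 3 n1 n2 r S" "\<forall>i<3. \<forall>j<n1. \<forall>k<n2. cmod (S i j k - T i j k) < \<delta>"
      using br \<delta> unfolding border_rank_le_def by blast
    obtain x y z where xyz: "\<forall>i<3. \<forall>j<n1. \<forall>k<n2. S i j k = (\<Sum>t<r. x t i * y t j * z t k)"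
      using S(1) unfolding rank_le_def by blast
    define B' where "B' k p = (\<Sum>m<N k. flat S (fst p) (snd p) (w k m) (e k m))" for k p
    have "\<exists>\<psi> :: sidx \<Rightarrow> pt \<Rightarrow> complex. \<forall>f. multihom (deg4 0 b 0 (a + 1)) f \<longrightarrow>
       (\<exists>k. \<forall>\<alpha>. dot P Q \<alpha> = 0 \<longrightarrow> Dp (x t) f \<alpha> = (\<Sum>q\<in>std' b (a + 1). k q * \<psi> q \<alpha>))" for t
      by (rule Dp_span)
    then have "\<forall>t. \<exists>\<psi> :: sidx \<Rightarrow> pt \<Rightarrow> complex. \<forall>f. multihom (deg4 0 b 0 (a + 1)) f \<longrightarrow>
       (\<exists>k. \<forall>\<alpha>. dot P Q \<alpha> = 0 \<longrightarrow> Dp (x t) f \<alpha> = (\<Sum>q\<in>std' b (a + 1). k q * \<psi> q \<alpha>))" by (rule allI)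
    from choice[OF this] obtain \<psi> :: "nat \<Rightarrow> sidx \<Rightarrow> pt \<Rightarrow> complex" where \<psi>: "\<forall>t f. multihom (deg4 0 b 0 (a + 1)) f \<longrightarrow>
       (\<exists>k. \<forall>\<alpha>. dot P Q \<alpha> = 0 \<longrightarrow> Dp (x t) f \<alpha> = (\<Sum>q\<in>std' b (a + 1). k q * \<psi> t q \<alpha>))"
      by (elim exE) (rule that)
    \<comment> \<open>The coefficients depend on the form but the functions
      \<open>\<psi> t q\<close> do not, which is what separates rows from columns in the
      factorization.\<close>
    define cc where "cc t f = (SOME k. \<forall>\<alpha>. dot P Q \<alpha> = 0 \<longrightarrow> Dp (x t) f \<alpha> = (\<Sum>q\<in>std' b (a + 1). k q * \<psi> t q \<alpha>))"
      for t f
    have cc: "Dp (x t) f \<alpha> = (\<Sum>q\<in>std' b (a + 1). cc t f q * \<psi> t q \<alpha>)"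
      if "multihom (deg4 0 b 0 (a + 1)) f" "dot P Q \<alpha> = 0" for t f \<alpha>
      using someI_ex[OF \<psi>[rule_format, OF that(1), of t]] that(2) unfolding cc_def by blast
    define yy where "yy j p = pair n2 (coact \<rho>2 n2 \<xi> (fst p)) (z (fst j)) * \<psi> (fst j) (snd j) (snd p)"
      for j :: "nat \<times> sidx" and p :: "complex mat \<times> pt"
    define zz where "zz j k = (\<Sum>m<N k. pair n1 (y (fst j)) (w k m) * cc (fst j) (e k m) (snd j))"
      for j :: "nat \<times> sidx" and k
    let ?J = "{..<r} \<times> std' b (a + 1)"
    have fact: "B' k p = (\<Sum>j\<in>?J. yy j p * zz j k)" if "p \<in> A" "k \<in> ?I" for p k
    proof -
      obtain g \<alpha> where p: "p = (g, \<alpha>)" by (cases p)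
      have pq: "dot P Q \<alpha> = 0" using that(1) A(2) p by (auto simp: rows_def cone2_def)
      have "B' k p = (\<Sum>m<N k. \<Sum>t<r. pair n2 (coact \<rho>2 n2 \<xi> g) (z t) * pair n1 (y t) (w k m) * Dp (x t) (e k m) \<alpha>)"
        unfolding B'_def p using xyz by (intro sum.cong refl) (simp add: flat_rank_one_sum[where x = x and y = y and z = z])
      also have "\<dots> = (\<Sum>m<N k. \<Sum>t<r. \<Sum>q\<in>std' b (a + 1).
          (pair n2 (coact \<rho>2 n2 \<xi> g) (z t) * \<psi> t q \<alpha>) * (pair n1 (y t) (w k m) * cc t (e k m) q))"
        using cc[OF e[OF that(2)] pq] by (intro sum.cong refl) (simp add: sum_distrib_left mult_ac)
      also have "\<dots> = (\<Sum>m<N k. \<Sum>j\<in>?J. yy j p * (pair n1 (y (fst j)) (w k m) * cc (fst j) (e k m) (snd j)))"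
        by (simp add: sum.cartesian_product' yy_def p)
      also have "\<dots> = (\<Sum>j\<in>?J. yy j p * zz j k)"
        by (subst sum.swap) (simp add: zz_def sum_distrib_left)
      finally show ?thesis .
    qed
    have close: "cmod (B' k p - B k p) < \<epsilon>" if "p \<in> A" "k \<in> ?I" for p k
    proof -
      have "(fst p, snd p) \<in> rows" using that(1) A(2) by auto
      then have "B' k p - B k p = (\<Sum>m<N k. flat S (fst p) (snd p) (w k m) (e k m) - flat T (fst p) (snd p) (w k m) (e k m))"
        unfolding B'_def B_def using HT[OF that(2)] by (simp add: sum_subtractf)
      also have "\<dots> = (\<Sum>m<N k. \<Sum>i<3. \<Sum>j<n1. \<Sum>l<n2. (S i j l - T i j l) * cf p k m i j l)"
        unfolding flat_expand cf_def by (simp add: left_diff_distrib sum_subtractf)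
      also have "cmod \<dots> \<le> (\<Sum>m<N k. \<Sum>i<3. \<Sum>j<n1. \<Sum>l<n2. \<delta> * cmod (cf p k m i j l))"
      proof (intro sum_norm_le)
        fix m i j l assume "i \<in> {..<3::nat}" "j \<in> {..<n1}" "l \<in> {..<n2}"
        then have "cmod (S i j l - T i j l) \<le> \<delta>" using S(2) by (simp add: less_imp_le)
        then show "cmod ((S i j l - T i j l) * cf p k m i j l) \<le> \<delta> * cmod (cf p k m i j l)"
          unfolding norm_mult by (rule mult_right_mono) simp
      qed
      also have "\<dots> = \<delta> * K p k" by (simp add: K_def sum_distrib_left)
      also have "\<dots> \<le> \<delta> * Kt" using Kt[OF that] \<delta> by simp
      also have "\<dots> < \<epsilon>" using \<epsilon> Kt0 by (simp add: \<delta>_def field_simps)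
      finally show ?thesis .
    qed
    show "\<exists>B' (J :: (nat \<times> sidx) set) y z. finite J \<and> card J \<le> r * card (std' b (a + 1)) \<and>
        (\<forall>p\<in>A. \<forall>k\<in>?I. cmod (B' k p - B k p) < \<epsilon> \<and> B' k p = (\<Sum>j\<in>J. y j p * z j k))"
      using fact close by (intro exI[of _ B'] exI[of _ ?J] exI[of _ yy] exI[of _ zz]) (simp add: card_cartesian_product)
  qed
  then show ?thesis by (simp add: card_cartesian_product)
qed

end

section \<open>Existence of the border rank and the numerical bounds\<close>

lemma border_rank_le_exists: "border_rank_le 3 n1 n2 (3 * n1) T"
proof -
  have "rank_le 3 n1 n2 (3 * n1) T"
    unfolding rank_le_def
  proof (intro exI allI impI)
    fix i j k assume ij: "i < (3::nat)" "j < n1" "k < n2"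
    have lt: "i * n1 + j < 3 * n1"
    proof -
      have "i * n1 + j < i * n1 + n1" using ij by simp
      also have "\<dots> = Suc i * n1" by simp
      also have "\<dots> \<le> 3 * n1" using ij by (intro mult_le_mono1) simp
      finally show ?thesis .
    qed
    \<comment> \<open>Summand \<open>l = i * n1 + j\<close> is the rank one tensor carrying the
      entries \<open>T i j\<close> in the third factor.\<close>
    have "(\<Sum>l<3 * n1. (if l div n1 = i then 1 else 0) * (if l mod n1 = j then 1 else 0) * T (l div n1) (l mod n1) k)
      = (\<Sum>l<3 * n1. if l = i * n1 + j then T i j k else 0)"
    proof (rule sum.cong[OF refl])
      fix l
      have "l = i * n1 + j \<longleftrightarrow> l div n1 = i \<and> l mod n1 = j"
        using ij by auto
      then show "(if l div n1 = i then 1 else 0) * (if l mod n1 = j then 1 else 0) * T (l div n1) (l mod n1) k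
        = (if l = i * n1 + j then T i j k else 0)" by auto
    qed
    also have "\<dots> = T i j k" using lt by simp
    finally show "T i j k = (\<Sum>l<3 * n1. (if l div n1 = i then 1 else 0) * (if l mod n1 = j then 1 else 0) * T (l div n1) (l mod n1) k)"
      by simp
  qed
  then show ?thesis unfolding border_rank_le_def by (intro allI impI exI[of _ T]) simp
qed

theorem invariant_tensor_border_rank:
  assumes sch1: "schur_rep [a + b + 1, a, 0] n1 \<rho>1" and sch2: "schur_rep [a + b + 1, a + 1, 0] n2 \<rho>2"
    and inv: "gl_invariant n1 n2 \<rho>1 \<rho>2 T" and ne: "\<exists>i<3. \<exists>j<n1. \<exists>k<n2. T i j k \<noteq> 0"
  shows "((b + 1) * (a + 2) * (a + b + 3) div 2) * ((b + 2) * (a + 1) * (a + b + 3) div 2)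
     \<le> border_rank 3 n1 n2 T * ((b + 1) * (a + 1) * (a + b + 4) div 2)"
proof -
  have n: "0 < n1" "0 < n2" using ne by auto
  have s1: "schur_rep [(b + 1) + a, a, 0] n1 \<rho>1" and s2: "schur_rep [b + (a + 1), a + 1, 0] n2 \<rho>2"
    using sch1 sch2 by (simp_all add: ac_simps)
  have hw: "\<exists>v \<xi>. hw_data l0 l1 n \<rho> v \<xi>" if "schur_rep [l0, l1, 0] n \<rho>" "l1 \<le> l0" "0 < n" for l0 l1 n \<rho>
    using highest_weight[OF that] that(1) unfolding hw_data_def schur_rep_def by (simp only: conj_assoc simp_thms)
  obtain v \<xi>1 where hw1: "hw_data ((b + 1) + a) a n1 \<rho>1 v \<xi>1" using hw[OF s1 _ n(1)] by force
  obtain v2 \<xi> where hw2: "hw_data (b + (a + 1)) (a + 1) n2 \<rho>2 v2 \<xi>" using hw[OF s2 _ n(2)] by force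
  have d1: "2 * n1 = (b + 1 + 1) * (a + 1) * (b + 1 + a + 2)" by (rule schur_rep_dim[OF s1])
  have d2: "2 * n2 = (b + 1) * (a + 1 + 1) * (b + (a + 1) + 2)" by (rule schur_rep_dim[OF s2])
  have e: "(b + 1) + a = a + b + 1" "b + (a + 1) = a + b + 1" by auto
  obtain c where c: "\<forall>g\<in>GL3. \<forall>h\<in>GL3. \<forall>i<3. pair n2 (coact \<rho>2 n2 \<xi> g) (Tw T n1 i (act \<rho>1 n1 h v))
     = c * vdot (rowv g 0) (colv h 0) ^ b * vdot (cross (rowv g 0) (rowv g 1)) (cross (colv h 0) (colv h 1)) ^ a
        * cross (cross (rowv g 0) (rowv g 1)) (colv h 0) i"
    using tensor_kernel[OF hw1[unfolded e] hw2[unfolded e] inv] by blast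
  \<comment> \<open>If the kernel vanished, spanning by the orbit of \<open>\<xi>\<close> would kill
    \<open>T\<close> on the orbit of \<open>v\<close>, and spanning by that orbit would give
    \<open>T = 0\<close>.\<close>
  have c0: "c \<noteq> 0"
  proof
    assume c0: "c = 0"
    have "T i j k = 0" if "i < 3" "j < n1" "k < n2" for i j k
    proof -
      have z: "Tw T n1 i (act \<rho>1 n1 h v) k = 0" if h: "h \<in> GL3" for h
        by (rule hw_spanning(2)[OF hw2 _ d2 \<open>k < n2\<close>]) (use c h c0 \<open>i < 3\<close> in auto)
      have "(\<lambda>j. T i j k) j = 0"
        by (rule hw_spanning(1)[OF hw1 _ d1 \<open>j < n1\<close>]) (use z in \<open>auto simp: pair_def Tw_def\<close>)
      then show ?thesis .
    qed
    then show False using ne by blast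
  qed
  interpret invariant_tensor a b n1 n2 \<rho>1 \<rho>2 T v \<xi> c
    by unfold_locales (use c0 c in auto)
  \<comment> \<open>The least bound is attained, since rank \<open>3 * n1\<close> always
    suffices.\<close>
  have "border_rank_le 3 n1 n2 (border_rank 3 n1 n2 T) T"
    unfolding border_rank_def by (rule LeastI) (rule border_rank_le_exists)
  from flattening_bound[OF this]
  have "card (std b (a + 1)) * card (std (b + 1) a) \<le> border_rank 3 n1 n2 T * card (std' b (a + 1))" .
  moreover have "card (std b (a + 1)) = (b + 1) * (a + 2) * (a + b + 3) div 2"
  proof -
    have "2 * card (std b (a + 1)) = (b + 1) * (a + 2) * (a + b + 3)"
      using card_std[of "b" "a + 1"] by (simp add: algebra_simps)
    then show ?thesis by linarith
  qed
  moreover have "card (std (b + 1) a) = (b + 2) * (a + 1) * (a + b + 3) div 2"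
  proof -
    have "2 * card (std (b + 1) a) = (b + 2) * (a + 1) * (a + b + 3)"
      using card_std[of "b + 1" "a"] by (simp add: algebra_simps)
    then show ?thesis by linarith
  qed
  moreover have "card (std' b (a + 1)) = (b + 1) * (a + 1) * (a + b + 4) div 2"
  proof -
    have "2 * card (std' b (a + 1)) = (b + 1) * (a + 1) * (a + b + 4)"
      using card_std'[of "b" "a + 1"] by (simp add: algebra_simps)
    then show ?thesis by linarith
  qed
  ultimately show ?thesis by simp
qed

theorem theorem4:
  fixes a b n1 n2 :: nat
    and \<rho>1 \<rho>2 :: "complex mat \<Rightarrow> complex mat"
    and T :: "nat \<Rightarrow> nat \<Rightarrow> nat \<Rightarrow> complex"
  assumes "a + b \<le> 4"
    and "schur_rep [a + b + 1, a, 0] n1 \<rho>1"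
    and "schur_rep [a + b + 1, a + 1, 0] n2 \<rho>2"
    and "gl_invariant n1 n2 \<rho>1 \<rho>2 T"
    and "\<exists>i<3. \<exists>j<n1. \<exists>k<n2. T i j k \<noteq> 0"
  shows "border_rank 3 n1 n2 T \<ge>
           [[5, 10, 17, 26, 37], [10, 19, 31, 46], [17, 31, 49], [26, 46], [37]] ! a ! b"
proof -
  define r where "r = border_rank 3 n1 n2 T"
  have bound: "((b + 1) * (a + 2) * (a + b + 3) div 2) * ((b + 2) * (a + 1) * (a + b + 3) div 2)
     \<le> r * ((b + 1) * (a + 1) * (a + b + 4) div 2)"
    unfolding r_def by (rule invariant_tensor_border_rank[OF assms(2-5)])
  \<comment> \<open>The condition \<open>a + b \<le> 4\<close> leaves exactly the positions of the
    triangular table; in each of them \<open>bound\<close> is a numerical inequality for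
    \<open>r\<close>.\<close>
  have "a \<in> {0, 1, 2, 3, 4}" "b \<in> {0, 1, 2, 3, 4}" using assms(1) by auto
  then have "[[5, 10, 17, 26, 37], [10, 19, 31, 46], [17, 31, 49], [26, 46], [37]] ! a ! b \<le> r"
    using bound assms(1) by (elim insertE emptyE) simp_all
  then show ?thesis by (simp add: r_def)
qed

end
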